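(* Let $n\in\mathbb{N}$, $n\ge 2$, $1<p<n$, $\frac{1}{p^*}=\frac1p-\frac1n$, and $R>0$. Then for every radially symmetric function $u\in W^{1,p}_0(B_R)$, $$ S_{n,p}\left(\frac{n-p}{p-1}\right)^{\frac1n-1}\left(\int_{B_R}\frac{|u(x)|^{p^*}}{\left[\log_{\frac{n-1}{p-1}}\frac{R}{|x|}\right]^{\frac{p(n-1)}{n-p}}}\,dx\right)^{\frac1{p^*}}\le \|\nabla u\|_{L^p(B_R)} . $$ The constant on the left-hand side is optimal (it cannot be replaced by a larger one in the inequality for all radially symmetric $u\in W^{1,p}_0(B_R)$), and it is attained: for all $a,b>0$, equality holds for the function $$ U_R(x)=\left[a+b\left\{\frac{1}{|x|^{\frac{n-p}{p-1}}}-\frac{1}{R^{\frac{n-p}{p-1}}}\right\}^{-\frac{p}{n-p}}\right]^{1-\frac np}. $$ Furthermore, the inequality is invariant under the scaling, for $\lambda>0$, $$ u_\lambda(x):=\lambda^{-\frac{p-1}{p}}u(x_\lambda),\qquad x_\lambda:=\left[\lambda|x|^{-\frac{n-p}{p-1}}+(1-\lambda)R^{-\frac{n-p}{p-1}}\right]^{-\frac{p-1}{n-p}}\frac{x}{|x|}, $$ that is, for every radially symmetric $u\in W^{1,p}_0(B_R)$ and every $\lambda>0$, each of the two sides of the inequality takes the same value for $u_\lambda$ as for $u$.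
   Context: $B_R$ is the open ball in $\mathbb{R}^n$ centered at the origin with radius $R>0$. For $q>0$, $q\ne1$ and $r>0$, the $q$-logarithm is $\log_q r:=\frac{r^{1-q}-1}{1-q}$. For $1<p<n$, $S_{n,p}$ is the best constant of the Sobolev inequality $S_{n,p}\|u\|_{L^{p^*}(\mathbb{R}^n)}\le\|\nabla u\|_{L^p(\mathbb{R}^n)}$, $u\in W^{1,p}(\mathbb{R}^n)$, given explicitly by $$S_{n,p}=\sqrt{\pi}\,n^{\frac1p}\left(\frac{n-p}{p-1}\right)^{\frac{p-1}{p}}\left[\frac{\Gamma\left(\frac np\right)\Gamma\left(n+1-\frac np\right)}{\Gamma(n)\Gamma\left(1+\frac n2\right)}\right]^{\frac1n},$$ where $\Gamma$ is the gamma function. *)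

theory Defs
  imports "HOL-Analysis.Analysis"
begin

section \<open>Sobolev spaces on subsets of Euclidean space\<close>

text \<open>Elements of \<open>L\<^sup>p(\<Omega>)\<close> and \<open>W\<^sup>1\<^sup>,\<^sup>p(\<Omega>)\<close> are represented by total functions; every notion below depends
  only on the almost-everywhere class of the restriction to \<open>\<Omega>\<close>.\<close>

primrec Ck :: "nat \<Rightarrow> (real^'n \<Rightarrow> real) \<Rightarrow> bool" where
  "Ck 0 f \<longleftrightarrow> continuous_on UNIV f"
| "Ck (Suc k) f \<longleftrightarrow>
     (\<forall>x. f differentiable (at x)) \<and> (\<forall>v. Ck k (\<lambda>x. frechet_derivative f (at x) v))"

definition test_functions :: "(real^'n) set \<Rightarrow> (real^'n \<Rightarrow> real) set" where
  "test_functions \<Omega> =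
     {\<phi>. (\<forall>k. Ck k \<phi>) \<and> compact (closure {x. \<phi> x \<noteq> 0}) \<and> closure {x. \<phi> x \<noteq> 0} \<subseteq> \<Omega>}"

definition Lp_space :: "real \<Rightarrow> (real^'n) set \<Rightarrow> (real^'n \<Rightarrow> 'b::euclidean_space) set" where
  "Lp_space p \<Omega> = {f. f \<in> borel_measurable (lebesgue_on \<Omega>) \<and>
                       integrable (lebesgue_on \<Omega>) (\<lambda>x. norm (f x) powr p)}"

definition Lp_norm :: "real \<Rightarrow> (real^'n) set \<Rightarrow> (real^'n \<Rightarrow> 'b::euclidean_space) \<Rightarrow> real" where
  "Lp_norm p \<Omega> f = (LINT x|lebesgue_on \<Omega>. norm (f x) powr p) powr (1 / p)"

definition locally_integrable :: "(real^'n) set \<Rightarrow> (real^'n \<Rightarrow> 'b::euclidean_space) \<Rightarrow> bool" where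
  "locally_integrable \<Omega> f \<longleftrightarrow>
     (\<forall>K. compact K \<and> K \<subseteq> \<Omega> \<longrightarrow> integrable (lebesgue_on K) f)"

definition is_weak_gradient ::
  "(real^'n) set \<Rightarrow> (real^'n \<Rightarrow> real) \<Rightarrow> (real^'n \<Rightarrow> real^'n) \<Rightarrow> bool" where
  "is_weak_gradient \<Omega> u g \<longleftrightarrow>
     locally_integrable \<Omega> u \<and> locally_integrable \<Omega> g \<and>
     (\<forall>\<phi>\<in>test_functions \<Omega>. \<forall>i.
        (LINT x|lebesgue_on \<Omega>. u x * frechet_derivative \<phi> (at x) (axis i 1)) =
        - (LINT x|lebesgue_on \<Omega>. g x $ i * \<phi> x))"

text \<open>On open \<open>\<Omega>\<close> a weak gradient is unique up to null sets, so the choice below is immaterial.\<close>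

definition weak_gradient :: "(real^'n) set \<Rightarrow> (real^'n \<Rightarrow> real) \<Rightarrow> (real^'n \<Rightarrow> real^'n)" where
  "weak_gradient \<Omega> u = (SOME g. is_weak_gradient \<Omega> u g)"

definition sobolev_space :: "real \<Rightarrow> (real^'n) set \<Rightarrow> (real^'n \<Rightarrow> real) set" where
  "sobolev_space p \<Omega> =
     {u \<in> Lp_space p \<Omega>. \<exists>g \<in> Lp_space p \<Omega>. is_weak_gradient \<Omega> u g}"

definition sobolev_norm :: "real \<Rightarrow> (real^'n) set \<Rightarrow> (real^'n \<Rightarrow> real) \<Rightarrow> real" where
  "sobolev_norm p \<Omega> u =
     (Lp_norm p \<Omega> u powr p + Lp_norm p \<Omega> (weak_gradient \<Omega> u) powr p) powr (1 / p)"

text \<open>\<open>W\<^sub>0\<^sup>1\<^sup>,\<^sup>p(\<Omega>)\<close>: the closure of the test functions in the Sobolev norm.\<close>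

definition sobolev_space0 :: "real \<Rightarrow> (real^'n) set \<Rightarrow> (real^'n \<Rightarrow> real) set" where
  "sobolev_space0 p \<Omega> =
     {u \<in> sobolev_space p \<Omega>.
        \<exists>\<phi>. (\<forall>k. \<phi> k \<in> test_functions \<Omega>) \<and>
            (\<lambda>k::nat. sobolev_norm p \<Omega> (\<lambda>x. \<phi> k x - u x)) \<longlonglongrightarrow> 0}"

definition radially_symmetric :: "(real^'n) set \<Rightarrow> (real^'n \<Rightarrow> real) \<Rightarrow> bool" where
  "radially_symmetric \<Omega> u \<longleftrightarrow> (\<exists>f. AE x in lebesgue_on \<Omega>. u x = f (norm x))"

definition radial_sobolev_space0 :: "real \<Rightarrow> (real^'n) set \<Rightarrow> (real^'n \<Rightarrow> real) set" where
  "radial_sobolev_space0 p \<Omega> = {u \<in> sobolev_space0 p \<Omega>. radially_symmetric \<Omega> u}"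


section \<open>The weighted inequality\<close>

definition log_q :: "real \<Rightarrow> real \<Rightarrow> real" where
  "log_q q r = (r powr (1 - q) - 1) / (1 - q)"

text \<open>The best constant of the Sobolev inequality on \<open>\<real>\<^sup>n\<close> (Aubin, Talenti), by its explicit value.\<close>

definition sobolev_const :: "real \<Rightarrow> real \<Rightarrow> real" where
  "sobolev_const n p =
     sqrt pi * n powr (1 / p) * ((n - p) / (p - 1)) powr ((p - 1) / p) *
     (Gamma (n / p) * Gamma (n + 1 - n / p) / (Gamma n * Gamma (1 + n / 2))) powr (1 / n)"

definition weighted_const :: "real \<Rightarrow> real \<Rightarrow> real" where
  "weighted_const n p = sobolev_const n p * ((n - p) / (p - 1)) powr (1 / n - 1)"

text \<open>In the definitions below \<open>n\<close> is the dimension \<open>CARD('n)\<close>; the values at the origin are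
  irrelevant.\<close>

definition weighted_integrand ::
  "real \<Rightarrow> real \<Rightarrow> real \<Rightarrow> real \<Rightarrow> (real^'n \<Rightarrow> real) \<Rightarrow> real^'n \<Rightarrow> real" where
  "weighted_integrand n p ps R u x =
     \<bar>u x\<bar> powr ps /
     log_q ((n - 1) / (p - 1)) (R / norm x) powr (p * (n - 1) / (n - p))"

definition weighted_norm ::
  "real \<Rightarrow> real \<Rightarrow> real \<Rightarrow> real \<Rightarrow> (real^'n \<Rightarrow> real) \<Rightarrow> real" where
  "weighted_norm n p ps R u =
     (LINT x|lebesgue_on (ball 0 R). weighted_integrand n p ps R u x) powr (1 / ps)"

definition extremal :: "real \<Rightarrow> real \<Rightarrow> real \<Rightarrow> real \<Rightarrow> real \<Rightarrow> real^'n \<Rightarrow> real" where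
  "extremal n p R a b x =
     (a + b * (1 / norm x powr ((n - p) / (p - 1)) - 1 / R powr ((n - p) / (p - 1)))
              powr (- (p / (n - p)))) powr (1 - n / p)"

definition scaled_point :: "real \<Rightarrow> real \<Rightarrow> real \<Rightarrow> real \<Rightarrow> real^'n \<Rightarrow> real^'n" where
  "scaled_point n p R \<mu> x =
     (\<mu> * norm x powr (- ((n - p) / (p - 1))) + (1 - \<mu>) * R powr (- ((n - p) / (p - 1))))
       powr (- ((p - 1) / (n - p))) *\<^sub>R (x /\<^sub>R norm x)"

definition scaled :: "real \<Rightarrow> real \<Rightarrow> real \<Rightarrow> real \<Rightarrow> (real^'n \<Rightarrow> real) \<Rightarrow> real^'n \<Rightarrow> real" where
  "scaled n p R \<mu> u x = \<mu> powr (- ((p - 1) / p)) * u (scaled_point n p R \<mu> x)"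

end

theory Submission
  imports Defs "HOL-Real_Asymp.Real_Asymp"
begin

text \<open>In polar coordinates, with \<open>s = |x| powr (- \<alpha>) - R powr (- \<alpha>)\<close> and \<open>\<alpha> = (n - p) / (p - 1)\<close>
  in place of \<open>|x|\<close>, the radius \<open>R\<close> disappears. The radial functions in \<open>W\<^sub>0\<^sup>1\<^sup>,\<^sup>p\<close> of the ball are
  exactly the \<open>f(s)\<close> with \<open>f s = \<integral>\<^sub>0\<^sup>s g\<close> and \<open>g \<in> L\<^sup>p(0,\<infinity>)\<close>; up to constants the right-hand side of
  the inequality is \<open>\<integral> |g|\<^sup>p\<close>, the left-hand side is \<open>\<integral> |f|\<^sup>q s powr (- \<gamma>)\<close>, and the transformation
  \<open>u\<^sub>\<lambda>\<close> is a dilation of \<open>s\<close>. What remains is Bliss' inequality, which follows by transporting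
  \<open>f\<^sup>q s powr (- \<gamma>) ds\<close> monotonically onto the corresponding density of the extremal function and using
  Young's inequality and the inequality of arithmetic and geometric means pointwise. That a radial
  \<open>u\<close> in \<open>W\<^sub>0\<^sup>1\<^sup>,\<^sup>p\<close> has this form is seen by restricting an approximating sequence of test functions to
  almost every ray; conversely, smooth compactly supported approximations of \<open>g\<close> on \<open>(0,\<infinity>)\<close> give radial
  test functions, constant near the origin.\<close>

section \<open>Smooth functions\<close>

text \<open>The coordinate works because the volume density contributes
  \<open>(s + c) powr (- \<gamma>)\<close>, while the gradient and the logarithmic weight each
  contribute the inverse power. In the transport step \<open>\<Phi> (T s) = M s\<close>, hence
  \<open>T' = m / mass T\<close>, and \<open>T\<close> is the identity for the extremal profile.
  Young's inequality pairs \<open>g\<close> with a product of powers of \<open>f\<close>,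
  \<open>T\<close> and \<open>s\<close>; the means are taken of \<open>T' / T\<close> and
  \<open>1 / s\<close> with weights \<open>1 / n\<close> and \<open>(n - 1) / n\<close>. Both are
  equalities at the extremal, so no constant is lost. The boundary terms have a favourable sign at
  the right end; that they vanish at 0 is proved from \<open>f\<close> being comparable to
  \<open>s\<close> there. Therefore Bliss' inequality is proved first for continuous positive
  \<open>g\<close> on a bounded interval and then extended by approximation and Fatou's lemma. The
  Sobolev norm involves a chosen weak gradient, so uniqueness of weak gradients comes before any
  computation with the norm. Density arguments use polynomials times smooth cutoffs instead of
  convolutions.\<close>

primrec smooth_upto :: "nat \<Rightarrow> ('a::real_normed_vector \<Rightarrow> real) \<Rightarrow> bool" where
  "smooth_upto 0 f \<longleftrightarrow> continuous_on UNIV f"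
| "smooth_upto (Suc k) f \<longleftrightarrow>
     (\<forall>x. f differentiable (at x)) \<and> (\<forall>v. smooth_upto k (\<lambda>x. frechet_derivative f (at x) v))"

definition smooth :: "('a::real_normed_vector \<Rightarrow> real) \<Rightarrow> bool" where
  "smooth f \<longleftrightarrow> (\<forall>k. smooth_upto k f)"

text \<open>\<open>Ck\<close> is tied to \<open>real^'n\<close>. The same notion on a general normed
  space is needed because test functions on the ball are built as functions of one real variable
  composed with the squared norm.\<close>

lemma Ck_eq_smooth_upto: "Ck k f = smooth_upto k f"
  by (induction k arbitrary: f) auto

lemma smooth_uptoI:
  assumes "\<And>x. (f has_derivative f' x) (at x)" "\<And>v. smooth_upto k (\<lambda>x. f' x v)"
  shows "smooth_upto (Suc k) f"
proof -
  have "frechet_derivative f (at x) = f' x" for x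
    using assms(1)[of x] by (metis frechet_derivative_at)
  then show ?thesis
    using assms by (auto simp: differentiable_def)
qed

lemma smooth_upto_has_derivative:
  assumes "smooth_upto (Suc k) f"
  shows "(f has_derivative frechet_derivative f (at x)) (at x)"
  using assms by (simp add: frechet_derivative_works)

lemma smooth_upto_SucD: "smooth_upto (Suc k) f \<Longrightarrow> smooth_upto k f"
proof (induction k arbitrary: f)
  case 0
  then show ?case
    by (auto intro!: differentiable_imp_continuous_on simp: differentiable_on_def
        intro: differentiable_at_withinI)
next
  case (Suc k)
  then show ?case
    by (metis smooth_upto.simps(2))
qed

lemma smooth_upto_const: "smooth_upto k (\<lambda>x. c)"
proof (induction k arbitrary: c)
  case (Suc k)
  show ?case
    by (rule smooth_uptoI[where f' = "\<lambda>_ _. 0"]) (use Suc in auto)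
qed auto

lemma smooth_upto_bounded_linear:
  assumes "bounded_linear f"
  shows "smooth_upto k f"
proof (cases k)
  case 0
  then show ?thesis
    using assms by (simp add: linear_continuous_on)
next
  case (Suc m)
  show ?thesis
    unfolding Suc
    by (rule smooth_uptoI[where f' = "\<lambda>_ v. f v"])
       (use assms in \<open>auto intro: bounded_linear.has_derivative[OF assms] smooth_upto_const
          bounded_linear_imp_has_derivative\<close>)
qed

lemma smooth_upto_add:
  "smooth_upto k f \<Longrightarrow> smooth_upto k g \<Longrightarrow> smooth_upto k (\<lambda>x. f x + g x)"
proof (induction k arbitrary: f g)
  case 0
  then show ?case by (auto intro: continuous_on_add)
next
  case (Suc k)
  show ?case
  proof (rule smooth_uptoI)
    show "((\<lambda>x. f x + g x) has_derivative
      (\<lambda>v. frechet_derivative f (at x) v + frechet_derivative g (at x) v)) (at x)" for x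
      using Suc.prems by (intro has_derivative_add smooth_upto_has_derivative)
    show "smooth_upto k (\<lambda>x. frechet_derivative f (at x) v + frechet_derivative g (at x) v)" for v
      using Suc by auto
  qed
qed

lemma smooth_upto_mult:
  "smooth_upto k f \<Longrightarrow> smooth_upto k g \<Longrightarrow> smooth_upto k (\<lambda>x. f x * g x)"
proof (induction k arbitrary: f g)
  case 0
  then show ?case by (auto intro: continuous_on_mult)
next
  case (Suc k)
  show ?case
  proof (rule smooth_uptoI)
    show "((\<lambda>x. f x * g x) has_derivative
      (\<lambda>v. f x * frechet_derivative g (at x) v + frechet_derivative f (at x) v * g x)) (at x)" for x
      using Suc.prems by (intro has_derivative_mult smooth_upto_has_derivative)
    show "smooth_upto k (\<lambda>x. f x * frechet_derivative g (at x) v +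
            frechet_derivative f (at x) v * g x)" for v
      using Suc.prems smooth_upto_SucD[of k f] smooth_upto_SucD[of k g]
      by (intro smooth_upto_add Suc.IH) auto
  qed
qed

lemma linear_real_eq_mult:
  fixes D :: "real \<Rightarrow> real"
  assumes "linear D"
  shows "D y = D 1 * y"
  using linear_scale[OF assms, of y 1] by simp

text \<open>A linear map on the reals is multiplication by its value at 1. The chain rule thus
  becomes a product, to which the product lemma and the induction hypothesis, with the derivative of
  \<open>h\<close> as new outer function, apply.\<close>

lemma smooth_upto_compose:
  fixes h :: "real \<Rightarrow> real" and f :: "'a::real_normed_vector \<Rightarrow> real"
  shows "smooth_upto k h \<Longrightarrow> smooth_upto k f \<Longrightarrow> smooth_upto k (\<lambda>x. h (f x))"
proof (induction k arbitrary: h f)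
  case 0
  then show ?case by (auto intro: continuous_on_compose2)
next
  case (Suc k)
  show ?case
  proof (rule smooth_uptoI)
    fix x
    have "((\<lambda>x. h (f x)) has_derivative
      (\<lambda>v. frechet_derivative h (at (f x)) (frechet_derivative f (at x) v))) (at x)"
      using has_derivative_compose[OF smooth_upto_has_derivative[OF Suc.prems(2)]
          smooth_upto_has_derivative[OF Suc.prems(1)]] .
    moreover have "linear (frechet_derivative h (at (f x)))"
      using smooth_upto_has_derivative[OF Suc.prems(1)] has_derivative_linear by blast
    ultimately show "((\<lambda>x. h (f x)) has_derivative
      (\<lambda>v. frechet_derivative h (at (f x)) 1 * frechet_derivative f (at x) v)) (at x)"
      by (subst (asm) linear_real_eq_mult)
    show "smooth_upto k (\<lambda>x. frechet_derivative h (at (f x)) 1 * frechet_derivative f (at x) v)" for v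
      using Suc.prems smooth_upto_SucD[OF Suc.prems(2)]
      by (intro smooth_upto_mult Suc.IH[of "\<lambda>y. frechet_derivative h (at y) 1"]) auto
  qed
qed

lemma smooth_has_derivative:
  "smooth f \<Longrightarrow> (f has_derivative frechet_derivative f (at x)) (at x)"
  using smooth_upto_has_derivative[of 0 f] by (simp add: smooth_def del: smooth_upto.simps)

lemma smooth_frechet_derivative: "smooth f \<Longrightarrow> smooth (\<lambda>x. frechet_derivative f (at x) v)"
  unfolding smooth_def by (metis smooth_upto.simps(2))

lemma smooth_continuous_on: "smooth f \<Longrightarrow> continuous_on A f"
  unfolding smooth_def by (metis smooth_upto.simps(1) continuous_on_subset subset_UNIV)

lemma smoothI_derivative:
  assumes "\<And>x. (f has_derivative f' x) (at x)" "\<And>v. smooth (\<lambda>x. f' x v)"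
  shows "smooth f"
proof -
  have "smooth_upto (Suc k) f" for k
    using assms by (intro smooth_uptoI) (auto simp: smooth_def)
  then show ?thesis
    unfolding smooth_def using smooth_upto_SucD by blast
qed

lemma smooth_const [intro]: "smooth (\<lambda>x. c)"
  by (simp add: smooth_def smooth_upto_const)

lemma smooth_bounded_linear: "bounded_linear f \<Longrightarrow> smooth f"
  by (simp add: smooth_def smooth_upto_bounded_linear)

lemma smooth_add [intro]: "smooth f \<Longrightarrow> smooth g \<Longrightarrow> smooth (\<lambda>x. f x + g x)"
  by (simp add: smooth_def smooth_upto_add)

lemma smooth_mult [intro]: "smooth f \<Longrightarrow> smooth g \<Longrightarrow> smooth (\<lambda>x. f x * g x)"
  by (simp add: smooth_def smooth_upto_mult)

lemma smooth_cmult [intro]: "smooth f \<Longrightarrow> smooth (\<lambda>x. c * f x)"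
  by (rule smooth_mult[OF smooth_const])

lemma smooth_diff [intro]: 
  assumes "smooth f" "smooth g" shows "smooth (\<lambda>x. f x - g x)"
  using smooth_add[OF assms(1) smooth_cmult[OF assms(2), of "-1"]] by simp

lemma smooth_sum: "(\<And>i. i \<in> I \<Longrightarrow> smooth (f i)) \<Longrightarrow> smooth (\<lambda>x. \<Sum>i\<in>I. f i x)"
  by (induction I rule: infinite_finite_induct) auto

lemma smooth_compose:
  fixes h :: "real \<Rightarrow> real" and f :: "'a::real_normed_vector \<Rightarrow> real"
  shows "smooth h \<Longrightarrow> smooth f \<Longrightarrow> smooth (\<lambda>x. h (f x))"
  by (simp add: smooth_def smooth_upto_compose)

lemma smooth_real_polynomial_function:
  "real_polynomial_function f \<Longrightarrow> smooth f"
  by (induction rule: real_polynomial_function.induct) (auto intro: smooth_bounded_linear)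

lemma smooth_norm_square: "smooth (\<lambda>x::'a::euclidean_space. (norm x)\<^sup>2)"
proof -
  have "smooth (\<lambda>x::'a. \<Sum>b\<in>Basis. (x \<bullet> b) * (x \<bullet> b))"
    by (intro smooth_sum smooth_mult smooth_bounded_linear bounded_linear_inner_left)
  then show ?thesis
    by (simp add: power2_norm_eq_inner euclidean_inner[symmetric])
qed

text \<open>Closure of an explicit family under differentiation replaces the computation of higher
  derivatives; it is made for polynomials in \<open>1 / x\<close> times
  \<open>exp (- (1 / x))\<close>.\<close>

lemma smooth_real_family:
  assumes "\<And>f. f \<in> F \<Longrightarrow> \<exists>f'\<in>F. \<forall>x::real. (f has_real_derivative f' x) (at x)" "f \<in> F"
  shows "smooth f"
proof -
  have scale: "smooth_upto k (\<lambda>x. c * g x)" if "smooth_upto k g" for k c and g :: "real \<Rightarrow> real"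
    using that by (intro smooth_upto_mult smooth_upto_const)
  have "smooth_upto k f" if "f \<in> F" for k f
    using that
  proof (induction k arbitrary: f)
    case 0
    then show ?case
      using assms(1) by (metis DERIV_continuous_on has_field_derivative_at_within smooth_upto.simps(1))
  next
    case (Suc k)
    obtain f' where f': "f' \<in> F" "\<And>x. (f has_real_derivative f' x) (at x)"
      using assms(1) Suc.prems by metis
    show ?case
    proof (rule smooth_uptoI)
      show "(f has_derivative (\<lambda>v. v * f' x)) (at x)" for x
        using f'(2)[of x] by (simp add: has_field_derivative_def mult_commute_abs)
      show "smooth_upto k (\<lambda>x. v * f' x)" for v
        using Suc.IH[OF f'(1)] by (rule scale)
    qed
  qed
  with assms(2) show ?thesis
    by (simp add: smooth_def)
qed

lemma smooth_has_real_derivative: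
  assumes "smooth f"
  obtains f' where "smooth f'" "\<And>x::real. (f has_real_derivative f' x) (at x)"
proof
  show "smooth (\<lambda>x. frechet_derivative f (at x) 1)"
    using assms by (rule smooth_frechet_derivative)
  show "(f has_real_derivative frechet_derivative f (at x) 1) (at x)" for x
  proof -
    have "linear (frechet_derivative f (at x))"
      using smooth_has_derivative[OF assms] has_derivative_linear by blast
    from linear_real_eq_mult[OF this]
    have "frechet_derivative f (at x) = (*) (frechet_derivative f (at x) 1)"
      by (rule ext)
    then show ?thesis
      using smooth_has_derivative[OF assms, of x] by (simp add: has_field_derivative_def)
  qed
qed

subsection \<open>A smooth cutoff\<close>

text \<open>\<open>exp_recip (real k * x - 1)\<close> vanishes where
  \<open>real k * x \<le> 1\<close> and tends to 1 for every \<open>x > 0\<close>. All cutoffs below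
  are built from such factors; a pointwise limit suffices, since they enter through dominated
  convergence or almost-everywhere statements.\<close>

definition exp_recip :: "real \<Rightarrow> real" where
  "exp_recip x = (if x > 0 then exp (- (1 / x)) else 0)"

lemma poly_exp_minus_tendsto_0: "((\<lambda>y. poly P y * exp (- y)) \<longlongrightarrow> 0) (at_top :: real filter)"
proof -
  have "((\<lambda>y. \<Sum>i\<le>degree P. coeff P i * (y ^ i / exp y)) \<longlongrightarrow> (\<Sum>i\<le>degree P. coeff P i * 0)) at_top"
    by (intro tendsto_sum tendsto_mult tendsto_const tendsto_power_div_exp_0)
  then show ?thesis
    by (simp add: poly_altdef exp_minus sum_divide_distrib divide_inverse[symmetric])
qed

lemma smooth_exp_recip: "smooth exp_recip"
proof -
  define E where "E P x = (if x > 0 then poly P (1 / x) * exp (- (1 / x)) else 0)" for P and x :: real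
  have right: "((\<lambda>x. poly P (1 / x) * exp (- (1 / x))) \<longlongrightarrow> 0) (at_right 0)" for P :: "real poly"
    using filterlim_compose[OF poly_exp_minus_tendsto_0[of P] filterlim_inverse_at_top_right]
    by (simp add: inverse_eq_divide)
  \<comment> \<open>With \<open>y = 1 / x\<close>, the derivative of
    \<open>poly P y * exp (- y)\<close> in \<open>x\<close> is
    \<open>y\<^sup>2 * poly (P - pderiv P) y * exp (- y)\<close>, which is the origin of the new
    polynomial.\<close>
  have deriv: "(E P has_real_derivative E ([:0, 0, 1:] * (P - pderiv P)) x) (at x)" for P x
  proof -
    consider "x > 0" | "x < 0" | "x = 0" by linarith
    then show ?thesis
    proof cases
      case 1
      have "((\<lambda>x. poly P (1 / x) * exp (- (1 / x))) has_real_derivative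
              E ([:0, 0, 1:] * (P - pderiv P)) x) (at x)"
        using 1 by (auto intro!: derivative_eq_intros poly_DERIV DERIV_chain2[OF poly_DERIV]
            simp: E_def field_simps power2_eq_square)
      then show ?thesis
        by (rule has_field_derivative_transform_within_open[of _ _ _ "{0<..}"])
           (use 1 in \<open>auto simp: E_def\<close>)
    next
      case 2
      show ?thesis
        by (rule has_field_derivative_transform_within_open[of "\<lambda>_. 0" _ _ "{..<0}"])
           (use 2 in \<open>auto simp: E_def\<close>)
    next
      case 3
      \<comment> \<open>Dividing by \<open>h\<close> multiplies \<open>P\<close> by the variable, so
        the difference quotient at 0 is again covered by \<open>right\<close>.\<close>
      have "((\<lambda>h. E P h / h) \<longlongrightarrow> 0) (at_right 0)"
        using right[of "[:0, 1:] * P"]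
        by (rule Lim_transform_eventually)
           (auto simp: eventually_at_filter E_def field_simps)
      moreover have "((\<lambda>h. E P h / h) \<longlongrightarrow> 0) (at_left 0)"
        by (rule Lim_transform_eventually[OF tendsto_const])
           (auto simp: eventually_at_filter E_def)
      ultimately have "((\<lambda>h. E P h / h) \<longlongrightarrow> 0) (at 0)"
        by (simp add: filterlim_at_split)
      with 3 show ?thesis
        by (simp add: has_field_derivative_iff E_def)
    qed
  qed
  have "smooth (E [:1:])"
    by (rule smooth_real_family[where F = "range E"]) (use deriv in auto)
  moreover have "E [:1:] = exp_recip"
    by (auto simp: E_def exp_recip_def)
  ultimately show ?thesis by simp
qed

lemma exp_recip_bounds: "0 \<le> exp_recip x" "exp_recip x \<le> 1"
  by (auto simp: exp_recip_def)

lemma exp_recip_eq_0: "x \<le> 0 \<Longrightarrow> exp_recip x = 0"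
  by (simp add: exp_recip_def)

lemma exp_recip_tendsto_1: "(\<lambda>k. exp_recip (real k * x - 1)) \<longlonglongrightarrow> 1" if "x > 0"
proof -
  have top: "filterlim (\<lambda>k. real k * x - 1) at_top sequentially"
    using that
    by (intro filterlim_tendsto_add_at_top[OF tendsto_const, where c = "-1", simplified add.commute, simplified]
        filterlim_at_top_mult_tendsto_pos[OF tendsto_const] filterlim_real_sequentially)
      (auto simp: mult.commute)
  have "(\<lambda>k. exp (- (1 / (real k * x - 1)))) \<longlonglongrightarrow> exp (- 0)"
    by (intro tendsto_intros tendsto_divide_0[OF tendsto_const] filterlim_at_top_imp_at_infinity top)
  moreover have "eventually (\<lambda>k. exp (- (1 / (real k * x - 1))) = exp_recip (real k * x - 1)) sequentially"
    using filterlim_at_top_dense[THEN iffD1, OF top, rule_format, of 0]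
    by eventually_elim (auto simp: exp_recip_def)
  ultimately show ?thesis
    by (simp add: tendsto_cong)
qed

section \<open>Bliss' inequality\<close>

text \<open>The comparison principle used in place of integrating from 0, where the functions are
  known only through their limit.\<close>

lemma nonneg_if_deriv_nonneg_and_tendsto_0:
  fixes F :: "real \<Rightarrow> real"
  assumes lim: "(F \<longlongrightarrow> 0) (at_right 0)"
    and deriv: "\<And>x. 0 < x \<Longrightarrow> x < b \<Longrightarrow> \<exists>D. (F has_real_derivative D) (at x) \<and> 0 \<le> D"
    and s: "0 < s" "s < b"
  shows "0 \<le> F s"
proof (rule tendsto_upperbound[OF lim])
  have "F a \<le> F s" if "0 < a" "a < s" for a
  proof (rule DERIV_nonneg_imp_nondecreasing[where f = F and a = a and b = s])
    show "\<exists>D. (F has_real_derivative D) (at x) \<and> 0 \<le> D" if "a \<le> x" "x \<le> s" for x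
      by (rule deriv) (use that \<open>0 < a\<close> s in linarith)+
  qed (use that in simp)
  then show "\<forall>\<^sub>F a in at_right 0. F a \<le> F s"
    using s(1) by (intro eventually_at_rightI) auto
qed simp

locale sobolev_exponents =
  fixes n p :: real
  assumes p_gt_1: "1 < p" and p_less_n: "p < n"
begin

text \<open>\<open>norm x powr (- \<alpha>)\<close> is the fundamental solution of the p-Laplacian
  up to a factor, \<open>q\<close> is the Sobolev exponent of \<open>p\<close> in dimension
  \<open>n\<close>, \<open>\<gamma>\<close> is the power of the logarithmic weight, and
  \<open>\<kappa>\<close> is the power inside the extremal functions.\<close>

definition \<alpha> :: real where "\<alpha> = (n - p) / (p - 1)"
definition \<kappa> :: real where "\<kappa> = p / (n - p)"
definition \<gamma> :: real where "\<gamma> = p * (n - 1) / (n - p)"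
definition q :: real where "q = n * p / (n - p)"

lemma alpha_pos: "0 < \<alpha>" and kappa_pos: "0 < \<kappa>"
  using p_gt_1 p_less_n by (auto simp: \<alpha>_def \<kappa>_def)

lemma gamma_eq: "\<gamma> = n / \<alpha> + 1" and q_eq_add: "q = \<gamma> + \<kappa>" and q_eq: "q = n * \<kappa>"
  and gamma_eq_mult: "\<gamma> = (n - 1) * \<kappa>" and gamma_div_p: "\<gamma> / p = 1 + 1 / \<alpha>"
  using p_gt_1 p_less_n
  by (auto simp: \<alpha>_def \<kappa>_def \<gamma>_def q_def divide_simps; auto simp: algebra_simps)+

lemma gamma_gt_1: "1 < \<gamma>"
  using gamma_eq alpha_pos p_gt_1 p_less_n by simp

lemma q_pos: "0 < q"
  using q_eq_add gamma_gt_1 kappa_pos by simp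

text \<open>Density and potential of the extremal profile \<open>h y = y * (1 + y powr \<kappa>) powr (- (1/\<kappa>))\<close>:
  \<open>mass = h powr q * y powr (- \<gamma>)\<close>, and \<open>(1 + y powr \<kappa>) powr (- n)\<close> is \<open>h' powr p\<close>.\<close>

definition mass :: "real \<Rightarrow> real" where
  "mass y = y powr \<kappa> * (1 + y powr \<kappa>) powr (- n)"

definition potential :: "real \<Rightarrow> real" where
  "potential y = y * (1 + y powr \<kappa>) powr (1 - n)"

lemma one_plus_powr_pos: "0 < 1 + (y::real) powr a"
  by (simp add: add_pos_nonneg)

lemma mass_pos: "0 < y \<Longrightarrow> 0 < mass y"
  unfolding mass_def using one_plus_powr_pos[of y \<kappa>] by (intro mult_pos_pos) auto

text \<open>The potential vanishes at both ends of the half line, so this identity makes the energy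
  of the extremal profile \<open>n / \<alpha>\<close> times its mass. Composed with the transport
  map, the potential has derivative \<open>m * T powr (- \<kappa>) - n / \<alpha> * m\<close>, which
  enters the transport argument.\<close>

lemma potential_deriv:
  assumes "0 < y"
  shows "(potential has_real_derivative (1 + y powr \<kappa>) powr (- n) - n / \<alpha> * mass y) (at y)"
proof -
  define w v a where "w = 1 + y powr \<kappa>" and "v = w powr (- n)" and "a = y powr (\<kappa> - 1)"
  have w: "w > 0"
    by (simp add: w_def one_plus_powr_pos)
  have ya: "y powr \<kappa> = a * y"
    using assms powr_add[of y "\<kappa> - 1" 1] by (simp add: a_def)
  have d: "((\<lambda>y. y * (1 + y powr \<kappa>) powr (1 - n)) has_real_derivative
     1 * (1 + y powr \<kappa>) powr (1 - n) +
     (1 - n) * (1 + y powr \<kappa>) powr (1 - n - of_nat 1) * (0 + \<kappa> * y powr (\<kappa> - 1)) * y) (at y)"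
    using assms
    by (intro DERIV_mult DERIV_ident DERIV_fun_powr DERIV_add DERIV_const has_real_derivative_powr)
       (auto simp: one_plus_powr_pos)
  have "w powr (1 - n) = w * v"
    using w(1) powr_add[of w 1 "- n"] by (simp add: v_def)
  then have "1 * w powr (1 - n) + (1 - n) * w powr (1 - n - of_nat 1) * (0 + \<kappa> * a) * y
     = w * v + (1 - n) * v * \<kappa> * a * y"
    by (simp add: v_def)
  also have "\<dots> = v - (n - 1) * \<kappa> * (a * y) * v + (a * y) * v"
    by (simp add: w_def ya algebra_simps)
  also have "\<dots> = v - n / \<alpha> * ((a * y) * v)"
    by (simp add: gamma_eq_mult[symmetric] gamma_eq) (simp add: algebra_simps)
  finally show ?thesis
    using d by (simp add: potential_def[abs_def] mass_def w_def v_def a_def ya[unfolded a_def])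
qed

text \<open>The left-hand side is the derivative of the auxiliary function \<open>W\<close> of
  \<open>Bliss_transport\<close>. Young's inequality turns the \<open>g\<close> term into
  \<open>g powr p\<close> plus \<open>(n - 1) / \<alpha>\<close> times
  \<open>m * T powr (- \<kappa>)\<close>; the inequality of means absorbs what then remains of
  \<open>m\<close> and \<open>m * T powr (- \<kappa>)\<close> into the two negative terms. Both are
  equalities if \<open>f\<close> is the extremal profile and \<open>T = s\<close>.\<close>

lemma Bliss_pointwise:
  assumes pos: "0 < f" "0 < g" "0 < s" "0 < T"
    and m: "m = f powr q * s powr (- \<gamma>)" and T': "T' = m / mass T"
  shows "\<gamma> * f powr (\<gamma> - 1) * g * T powr (- 1 / \<alpha>) * s powr (1 + 1 / \<alpha> - \<gamma>)
       - 1 / \<alpha> * f powr \<gamma> * T powr (- 1 / \<alpha> - 1) * T' * s powr (1 + 1 / \<alpha> - \<gamma>)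
       + (1 + 1 / \<alpha> - \<gamma>) * f powr \<gamma> * T powr (- 1 / \<alpha>) * s powr (1 / \<alpha> - \<gamma>)
       + n / \<alpha> * m + 1 / \<alpha> * (m * T powr (- \<kappa>))
       \<le> \<gamma> / p * g powr p"
proof -
  \<comment> \<open>The exponents make \<open>Y powr p'\<close> equal to
    \<open>m * T powr (- \<kappa>)\<close>, the extremal energy density pulled back by the transport
    map.\<close>
  define Y where "Y = f powr (\<gamma> - 1) * T powr (- 1 / \<alpha>) * s powr (1 + 1 / \<alpha> - \<gamma>)"
  define p' where "p' = p / (p - 1)"
  have Ypos: "0 < Y" using pos by (simp add: Y_def)
  have n1: "n > 1" using p_gt_1 p_less_n by simp
  have p': "1 < p'" "1 / p + 1 / p' = 1" "(\<gamma> - 1) * p' = q" "(- 1 / \<alpha>) * p' = - \<kappa>"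
    "(1 + 1 / \<alpha> - \<gamma>) * p' = - \<gamma>"
    using p_gt_1 p_less_n
    by (auto simp: p'_def \<alpha>_def \<kappa>_def \<gamma>_def q_def divide_simps; auto simp: algebra_simps)+
  have Yp: "Y powr p' = m * T powr (- \<kappa>)"
    using pos by (simp add: Y_def m powr_mult powr_powr p'(3-5)[simplified])
  have young: "g * Y \<le> g powr p / p + m * T powr (- \<kappa>) / p'"
    using Youngs_inequality[of p p' g Y] p_gt_1 p' pos Ypos by (simp add: Yp)
  have gp': "\<gamma> / p' = \<gamma> - 1 - 1 / \<alpha>" "\<gamma> - 1 = n / \<alpha>" "\<gamma> - 1 - 1 / \<alpha> = (n - 1) / \<alpha>"
  proof -
    have "\<gamma> = (\<gamma> - 1 - 1 / \<alpha>) * p'"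
      using p'(5) by (simp add: algebra_simps)
    then show "\<gamma> / p' = \<gamma> - 1 - 1 / \<alpha>"
      using p'(1) by (metis nonzero_mult_div_cancel_right not_one_less_zero)
  qed (simp_all add: gamma_eq diff_divide_distrib)
  have T'': "T' / T = m * T powr (- \<kappa> - 1) * (1 + T powr \<kappa>) powr n"
    using pos by (simp add: T' mass_def powr_minus powr_diff field_simps)
  define A where "A = T' / T"
  define D where "D = f powr \<gamma> * T powr (- 1 / \<alpha>) * s powr (1 + 1 / \<alpha> - \<gamma>)"
  have mpos: "m > 0" using pos by (simp add: m)
  have Apos: "A > 0" 
    unfolding A_def T'' using pos mpos one_plus_powr_pos[of T \<kappa>] by (intro mult_pos_pos) auto
  have Dpos: "D > 0" using pos by (simp add: D_def)
  \<comment> \<open>With these weights the geometric mean times \<open>D\<close> collapses to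
    \<open>m * T powr (- \<kappa>) + m\<close>. For \<open>T = s\<close> both entries equal
    \<open>1 / s\<close>.\<close>
  have amgm: "A powr (1 / n) * (1 / s) powr ((n - 1) / n) \<le> 1 / n * A + (n - 1) / n * (1 / s)"
    using Apos pos n1 by (intro Youngs_inequality_0) (auto simp: field_simps)
  have e: "\<gamma> + q / n = q" "1 + 1 / \<alpha> - \<gamma> + - \<gamma> / n + - ((n - 1) / n) = - \<gamma>"
    "- 1 / \<alpha> + (- \<kappa> - 1) / n = - \<kappa>"
    using p_gt_1 p_less_n
    by (auto simp: \<alpha>_def \<kappa>_def \<gamma>_def q_def divide_simps; auto simp: algebra_simps)+
  have "D * (A powr (1 / n) * (1 / s) powr ((n - 1) / n)) =
     (f powr \<gamma> * f powr (q / n)) * (s powr (1 + 1 / \<alpha> - \<gamma>) * s powr (- \<gamma> / n) * s powr (- ((n - 1) / n)))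
     * (T powr (- 1 / \<alpha>) * T powr ((- \<kappa> - 1) / n)) * (1 + T powr \<kappa>)"
    using pos n1 unfolding A_def T'' D_def m
    by (simp add: powr_mult powr_powr one_plus_powr_pos less_imp_le powr_divide powr_minus_divide mult_ac)
  also have "\<dots> = f powr q * s powr (- \<gamma>) * T powr (- \<kappa>) * (1 + T powr \<kappa>)"
    by (simp only: powr_add[symmetric] e)
  also have "\<dots> = m * T powr (- \<kappa>) + m"
    using pos by (simp add: m powr_minus field_simps)
  finally have "m * T powr (- \<kappa>) + m \<le> D * (1 / n * A + (n - 1) / n * (1 / s))"
    using mult_left_mono[OF amgm, of D] Dpos by simp
  then have "n / \<alpha> * (m * T powr (- \<kappa>) + m) \<le> n / \<alpha> * (D * (1 / n * A + (n - 1) / n * (1 / s)))"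
    using alpha_pos n1 by (intro mult_left_mono) auto
  also have "1 / n * A + (n - 1) / n * (1 / s) = (A + (n - 1) / s) / n"
    using n1 pos by (simp add: field_simps)
  also have "n / \<alpha> * (D * ((A + (n - 1) / s) / n)) = 1 / \<alpha> * D * (A + (n - 1) / s)"
    using n1 by simp
  finally have am: "n / \<alpha> * (m * T powr (- \<kappa>) + m) \<le> 1 / \<alpha> * D * (A + (n - 1) / s)" .
  have t1: "\<gamma> * f powr (\<gamma> - 1) * g * T powr (- 1 / \<alpha>) * s powr (1 + 1 / \<alpha> - \<gamma>) = \<gamma> * (g * Y)"
    by (simp add: Y_def)
  have t2: "1 / \<alpha> * f powr \<gamma> * T powr (- 1 / \<alpha> - 1) * T' * s powr (1 + 1 / \<alpha> - \<gamma>) = 1 / \<alpha> * D * A"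
    using pos by (simp add: D_def A_def powr_diff mult_ac)
  have "s powr (1 / \<alpha> - \<gamma>) = s powr (1 + 1 / \<alpha> - \<gamma>) / s"
    using pos powr_diff[of s "1 + 1 / \<alpha> - \<gamma>" 1] by simp
  moreover have "1 + 1 / \<alpha> - \<gamma> = - ((n - 1) / \<alpha>)" using gp'(3) by simp
  ultimately have t3: "(1 + 1 / \<alpha> - \<gamma>) * f powr \<gamma> * T powr (- 1 / \<alpha>) * s powr (1 / \<alpha> - \<gamma>) = - (1 / \<alpha> * D * ((n - 1) / s))"
    by (simp add: D_def)
  have "\<gamma> * (g * Y) \<le> \<gamma> / p * g powr p + (\<gamma> - 1 - 1 / \<alpha>) * (m * T powr (- \<kappa>))"
    using mult_left_mono[OF young, of \<gamma>] gamma_gt_1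
    unfolding gp'(1)[symmetric] by (simp add: distrib_left)
  with am show ?thesis
    unfolding t1 t2 t3 unfolding gp'(2) by (simp add: algebra_simps)
qed

text \<open>\<open>T\<close> transports the density \<open>f powr q * s powr (- \<gamma>)\<close>
  onto \<open>mass\<close>. The function \<open>W\<close> starts at 0 and has derivative at most
  \<open>\<gamma> / p * g powr p\<close>, so \<open>W \<le> \<gamma> / p * G\<close>; dropping its
  nonnegative parts \<open>Z\<close> and \<open>potential\<close> leaves the multiple
  \<open>n / \<alpha> * (1 + 1 / \<alpha>)\<close> of \<open>M\<close>, and the factor
  \<open>1 + 1 / \<alpha> = \<gamma> / p\<close> cancels. The bounds \<open>near0\<close> serve to
  show that \<open>Z\<close> vanishes at 0.\<close>

lemma Bliss_transport:
  fixes f g M G \<Phi> :: "real \<Rightarrow> real"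
  assumes f: "\<And>s. 0 < s \<Longrightarrow> s < b \<Longrightarrow> (f has_real_derivative g s) (at s)"
    and fpos: "\<And>s. 0 < s \<Longrightarrow> s < b \<Longrightarrow> 0 < f s" and gpos: "\<And>s. 0 < s \<Longrightarrow> s < b \<Longrightarrow> 0 < g s"
    and M: "\<And>s. 0 < s \<Longrightarrow> s < b \<Longrightarrow> (M has_real_derivative f s powr q * s powr (- \<gamma>)) (at s)"
    and M0: "(M \<longlongrightarrow> 0) (at_right 0)"
    and G: "\<And>s. 0 < s \<Longrightarrow> s < b \<Longrightarrow> (G has_real_derivative g s powr p) (at s)"
    and G0: "(G \<longlongrightarrow> 0) (at_right 0)"
    and near0: "\<And>s. 0 < s \<Longrightarrow> s < \<delta> \<Longrightarrow> l * s \<le> f s \<and> f s \<le> L * s" "0 < l" "0 < \<delta>" "\<delta> \<le> b"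
    and \<Phi>: "\<And>y. 0 < y \<Longrightarrow> (\<Phi> has_real_derivative mass y) (at y)"
    and \<Phi>0: "(\<Phi> \<longlongrightarrow> 0) (at_right 0)"
    and onto: "\<And>s. 0 < s \<Longrightarrow> s < b \<Longrightarrow> \<exists>y>0. \<Phi> y = M s"
    and s: "0 < s" "s < b"
  shows "n / \<alpha> * M s \<le> G s"
proof -
  have \<Phi>_less: "\<Phi> x < \<Phi> y" if "0 < x" "x < y" for x y
  proof (rule DERIV_pos_imp_increasing[OF that(2)])
    show "\<exists>D. (\<Phi> has_real_derivative D) (at z) \<and> 0 < D" if "x \<le> z" for z
      using \<Phi>[of z] mass_pos[of z] that \<open>0 < x\<close> by auto
  qed
  have inj: "inj_on \<Phi> {0<..}"
    by (rule linorder_inj_onI) (use \<Phi>_less in \<open>auto simp: less_imp_neq\<close>)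
  have \<Phi>_pos: "0 < \<Phi> y" if "0 < y" for y
  proof -
    have "0 \<le> \<Phi> (y / 2)"
    proof (rule nonneg_if_deriv_nonneg_and_tendsto_0[OF \<Phi>0, where b = y])
      show "\<exists>D. (\<Phi> has_real_derivative D) (at z) \<and> 0 \<le> D" if "0 < z" for z
        using \<Phi>[OF that] mass_pos[OF that] by force
    qed (use that in auto)
    then show ?thesis
      using \<Phi>_less[of "y / 2" y] that by simp
  qed
  define I where "I = inv_into {0<..} \<Phi>"
  define T where "T s = I (M s)" for s
  define m where "m s = f s powr q * s powr (- \<gamma>)" for s
  have T: "0 < T s" "\<Phi> (T s) = M s" if sb: "0 < s" "s < b" for s
  proof -
    obtain y where y: "0 < y" "\<Phi> y = M s"
      using onto[OF sb] by blast
    have "T s = y"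
      using inv_into_f_f[OF inj, of y] y(1) unfolding T_def I_def y(2)[symmetric] by simp
    with y show "0 < T s" "\<Phi> (T s) = M s" by auto
  qed
  have I_deriv: "(I has_real_derivative inverse (mass y)) (at (\<Phi> y))" if "0 < y" for y
    unfolding has_field_derivative_def
  proof (rule has_derivative_inverse_strong[where f = \<Phi> and x = y and g = I and S = "{0<..}"])
    show "(\<Phi> has_derivative (*) (mass y)) (at y)"
      using \<Phi>[OF that] by (simp add: has_field_derivative_def)
    show "(*) (mass y) \<circ> (*) (inverse (mass y)) = id"
      using mass_pos[OF that] by (auto simp: fun_eq_iff)
    show "continuous_on {0<..} \<Phi>"
      by (rule DERIV_continuous_on) (use \<Phi> in \<open>auto intro: has_field_derivative_at_within\<close>)
    show "I (\<Phi> z) = z" if "z \<in> {0<..}" for z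
      using inv_into_f_f[OF inj that] by (simp add: I_def)
  qed (use that in auto)
  have T_deriv: "(T has_real_derivative m s / mass (T s)) (at s)" if "0 < s" "s < b" for s
  proof -
    have "((\<lambda>s. I (M s)) has_real_derivative inverse (mass (T s)) * m s) (at s)"
      using I_deriv[OF T(1)[OF that]] M[OF that] unfolding T(2)[OF that] m_def by (rule DERIV_chain2)
    then show ?thesis
      by (simp add: T_def[abs_def] field_simps)
  qed
  have powr_deriv: "((\<lambda>y. y powr (\<kappa> + 1) / (\<kappa> + 1)) has_real_derivative y powr \<kappa>) (at y)" if "0 < y" for y
    using DERIV_cdivide[OF has_real_derivative_powr[OF that, of "\<kappa> + 1"], of "\<kappa> + 1"] kappa_pos by simp
  have powr_0: "((\<lambda>y. c * (y powr (\<kappa> + 1) / (\<kappa> + 1))) \<longlongrightarrow> 0) (at_right 0)" for c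
    using kappa_pos by (auto intro!: tendsto_eq_intros eventually_at_rightI[of 0 1])
  \<comment> \<open>Together with the lower bound \<open>M_ge\<close>, this upper bound, which comes
    from \<open>mass y \<le> y powr \<kappa>\<close>, forces \<open>T\<close> to grow at least
    linearly at 0. That controls the singular factor \<open>T powr (- 1 / \<alpha>)\<close> of
    \<open>Z\<close>.\<close>
  have \<Phi>_le: "\<Phi> y \<le> y powr (\<kappa> + 1) / (\<kappa> + 1)" if "0 < y" for y
  proof -
    have "0 \<le> y powr (\<kappa> + 1) / (\<kappa> + 1) - \<Phi> y"
    proof (rule nonneg_if_deriv_nonneg_and_tendsto_0
        [where b = "y + 1" and F = "\<lambda>y. y powr (\<kappa> + 1) / (\<kappa> + 1) - \<Phi> y"])
      show "((\<lambda>y. y powr (\<kappa> + 1) / (\<kappa> + 1) - \<Phi> y) \<longlongrightarrow> 0) (at_right 0)"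
        using tendsto_diff[OF powr_0[of 1] \<Phi>0] by simp
      show "\<exists>D. ((\<lambda>y. y powr (\<kappa> + 1) / (\<kappa> + 1) - \<Phi> y) has_real_derivative D) (at z) \<and> 0 \<le> D"
        if "0 < z" for z
      proof (intro exI conjI)
        show "((\<lambda>y. y powr (\<kappa> + 1) / (\<kappa> + 1) - \<Phi> y) has_real_derivative z powr \<kappa> - mass z) (at z)"
          by (intro DERIV_diff powr_deriv \<Phi> that)
        have "(1 + z powr \<kappa>) powr (- n) \<le> 1 powr (- n)"
          using p_gt_1 p_less_n by (intro powr_mono2') auto
        then show "0 \<le> z powr \<kappa> - mass z"
          using mult_left_mono[of "(1 + z powr \<kappa>) powr (- n)" 1 "z powr \<kappa>"] by (simp add: mass_def)
      qed
    qed (use that in auto)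
    then show ?thesis by simp
  qed
  have M_ge: "l powr q * (s powr (\<kappa> + 1) / (\<kappa> + 1)) \<le> M s" if "0 < s" "s < \<delta>" for s
  proof -
    have "0 \<le> M s - l powr q * (s powr (\<kappa> + 1) / (\<kappa> + 1))"
    proof (rule nonneg_if_deriv_nonneg_and_tendsto_0
        [where b = \<delta> and F = "\<lambda>s. M s - l powr q * (s powr (\<kappa> + 1) / (\<kappa> + 1))"])
      show "((\<lambda>s. M s - l powr q * (s powr (\<kappa> + 1) / (\<kappa> + 1))) \<longlongrightarrow> 0) (at_right 0)"
        using tendsto_diff[OF M0 powr_0[of "l powr q"]] by simp
      show "\<exists>D. ((\<lambda>s. M s - l powr q * (s powr (\<kappa> + 1) / (\<kappa> + 1))) has_real_derivative D) (at z) \<and> 0 \<le> D"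
        if z: "0 < z" "z < \<delta>" for z
      proof (intro exI conjI)
        show "((\<lambda>s. M s - l powr q * (s powr (\<kappa> + 1) / (\<kappa> + 1))) has_real_derivative
            f z powr q * z powr (- \<gamma>) - l powr q * z powr \<kappa>) (at z)"
          using z near0(4) by (intro DERIV_diff DERIV_cmult powr_deriv M) auto
        have "z powr \<kappa> = z powr q * z powr (- \<gamma>)"
          by (simp add: q_eq_add powr_add[symmetric])
        then have "l powr q * z powr \<kappa> = (l * z) powr q * z powr (- \<gamma>)"
          using near0(2) z by (simp add: powr_mult)
        also have "\<dots> \<le> f z powr q * z powr (- \<gamma>)"
          using near0(1)[OF z] near0(2) z q_pos by (intro mult_right_mono powr_mono2) auto
        finally show "0 \<le> f z powr q * z powr (- \<gamma>) - l powr q * z powr \<kappa>" by simp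
      qed
    qed (use that in auto)
    then show ?thesis by simp
  qed
  \<comment> \<open>The slope obtained from \<open>l powr q * s powr (\<kappa> + 1) \<le> T s powr
    (\<kappa> + 1)\<close>.\<close>
  define l' where "l' = l powr (q / (\<kappa> + 1))"
  have l': "0 < l'" using near0(2) by (simp add: l'_def)
  have T_ge: "l' * s \<le> T s" if "0 < s" "s < \<delta>" for s
  proof (rule ccontr)
    assume "\<not> l' * s \<le> T s"
    then have "T s powr (\<kappa> + 1) < (l' * s) powr (\<kappa> + 1)"
      using T(1)[of s] that near0(4) kappa_pos by (intro powr_less_mono2) auto
    also have "\<dots> = l powr q * s powr (\<kappa> + 1)"
      using near0(2) that kappa_pos by (simp add: l'_def powr_mult powr_powr)
    finally have "T s powr (\<kappa> + 1) / (\<kappa> + 1) < l powr q * (s powr (\<kappa> + 1) / (\<kappa> + 1))"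
      using kappa_pos by (simp add: divide_strict_right_mono)
    with M_ge[OF that] \<Phi>_le[OF T(1)[of s]] T(2)[of s] that near0(4) show False
      by simp
  qed
  have T_tendsto: "(T \<longlongrightarrow> 0) (at_right 0)"
  proof (rule tendstoI)
    fix e :: real assume "0 < e"
    have "\<forall>\<^sub>F s in at_right 0. M s < \<Phi> e"
      using M0 \<Phi>_pos[OF \<open>0 < e\<close>] by (auto simp: order_tendsto_iff)
    moreover have "\<forall>\<^sub>F s in at_right 0. s \<in> {0<..<b}"
      using s by (intro eventually_at_rightI[of 0 b]) auto
    ultimately show "\<forall>\<^sub>F s in at_right 0. dist (T s) 0 < e"
    proof eventually_elim
      case (elim s)
      then have "T s < e"
        using T[of s] \<Phi>_less[of e "T s"] \<open>0 < e\<close> by (cases "T s" e rule: linorder_cases) auto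
      then show ?case
        using T(1)[of s] elim by simp
    qed
  qed
  have pot_le: "potential y \<le> y" "0 \<le> potential y" if "0 < y" for y
  proof -
    have "(1 + y powr \<kappa>) powr (1 - n) \<le> 1 powr (1 - n)"
      using p_gt_1 p_less_n by (intro powr_mono2') auto
    then show "potential y \<le> y" "0 \<le> potential y"
      using mult_left_mono[of "(1 + y powr \<kappa>) powr (1 - n)" 1 y] that by (auto simp: potential_def)
  qed
  \<comment> \<open>The boundary term of the underlying integration by parts. It is of order
    \<open>s\<close> at 0, since the exponents \<open>\<gamma>\<close>,
    \<open>- 1 / \<alpha>\<close> and \<open>1 + 1 / \<alpha> - \<gamma>\<close> add up to
    1.\<close>
  define Z where "Z s = f s powr \<gamma> * T s powr (- 1 / \<alpha>) * s powr (1 + 1 / \<alpha> - \<gamma>)" for s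
  \<comment> \<open>The coefficient of \<open>M\<close> compensates the multiple of \<open>m\<close>
    that the derivative of the potential subtracts, and leaves the \<open>n / \<alpha> * m\<close>
    of the pointwise bound.\<close>
  define W where "W s = Z s + 1 / \<alpha> * potential (T s) + n / \<alpha> * (1 + 1 / \<alpha>) * M s" for s
  have ev: "\<forall>\<^sub>F s in at_right 0. s \<in> {0<..<\<delta>}"
    using near0(3) by (intro eventually_at_rightI[of 0 \<delta>]) auto
  have "(Z \<longlongrightarrow> 0) (at_right 0)"
  proof (rule tendsto_sandwich)
    show "\<forall>\<^sub>F s in at_right 0. 0 \<le> Z s"
      by (simp add: Z_def)
    show "\<forall>\<^sub>F s in at_right 0. Z s \<le> L powr \<gamma> * l' powr (- 1 / \<alpha>) * s"
      using ev
    proof eventually_elim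
      case (elim s)
      then have s: "0 < s" "s < \<delta>" "s < b" using near0(4) by auto
      have L: "0 < L"
        using near0(1)[OF s(1,2)] near0(2) s(1) by (metis mult_pos_pos less_le_trans zero_less_mult_pos2)
      have "Z s \<le> (L * s) powr \<gamma> * (l' * s) powr (- 1 / \<alpha>) * s powr (1 + 1 / \<alpha> - \<gamma>)"
        unfolding Z_def using near0(1)[OF s(1,2)] T_ge[OF s(1,2)] l' s fpos[OF s(1,3)] gamma_gt_1 alpha_pos
        by (intro mult_right_mono mult_mono powr_mono2 powr_mono2') auto
      also have "\<dots> = L powr \<gamma> * l' powr (- 1 / \<alpha>) * (s powr \<gamma> * s powr (- 1 / \<alpha>) * s powr (1 + 1 / \<alpha> - \<gamma>))"
        using L l' s by (simp add: powr_mult)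
      also have "s powr \<gamma> * s powr (- 1 / \<alpha>) * s powr (1 + 1 / \<alpha> - \<gamma>) = s"
        using s by (simp add: powr_add[symmetric])
      finally show ?case .
    qed
    show "((\<lambda>s. L powr \<gamma> * l' powr (- 1 / \<alpha>) * s) \<longlongrightarrow> 0) (at_right 0)"
      by (auto intro!: tendsto_eq_intros)
  qed simp
  moreover have "((\<lambda>s. potential (T s)) \<longlongrightarrow> 0) (at_right 0)"
  proof (rule tendsto_sandwich[OF _ _ tendsto_const T_tendsto])
    show "\<forall>\<^sub>F s in at_right 0. 0 \<le> potential (T s)"
      using ev by eventually_elim (use T(1) pot_le near0(4) in auto)
    show "\<forall>\<^sub>F s in at_right 0. potential (T s) \<le> T s"
      using ev by eventually_elim (use T(1) pot_le near0(4) in auto)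
  qed
  ultimately have W0: "(W \<longlongrightarrow> 0 + 1 / \<alpha> * 0 + n / \<alpha> * (1 + 1 / \<alpha>) * 0) (at_right 0)"
    unfolding W_def by (intro tendsto_intros M0)
  have "0 \<le> \<gamma> / p * G s - W s"
  proof (rule nonneg_if_deriv_nonneg_and_tendsto_0
      [where b = b and F = "\<lambda>s. \<gamma> / p * G s - W s", OF _ _ s])
    show "((\<lambda>s. \<gamma> / p * G s - W s) \<longlongrightarrow> 0) (at_right 0)"
      using tendsto_diff[OF tendsto_mult[OF tendsto_const[of "\<gamma> / p"] G0] W0] by simp
  next
    fix s assume s: "0 < s" "s < b"
    define T' where "T' = m s / mass (T s)"
    have Tpos: "0 < T s" using T(1)[OF s] .
    have T'pot: "((1 + T s powr \<kappa>) powr (- n) - n / \<alpha> * mass (T s)) * T' = m s * T s powr (- \<kappa>) - n / \<alpha> * m s"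
    proof -
      have "mass (T s) * T s powr (- \<kappa>) = (1 + T s powr \<kappa>) powr (- n)"
        using Tpos by (simp add: mass_def powr_minus)
      moreover have "mass (T s) * T' = m s"
        using mass_pos[OF Tpos] by (simp add: T'_def)
      ultimately show ?thesis
        by (simp add: left_diff_distrib) (metis mult.assoc mult.commute)
    qed
    have dZ: "(Z has_real_derivative
       ((\<gamma> * f s powr (\<gamma> - of_nat 1) * g s) * T s powr (- 1 / \<alpha>)
          + (- 1 / \<alpha> * T s powr (- 1 / \<alpha> - of_nat 1) * T') * f s powr \<gamma>) * s powr (1 + 1 / \<alpha> - \<gamma>)
       + ((1 + 1 / \<alpha> - \<gamma>) * s powr (1 + 1 / \<alpha> - \<gamma> - 1)) * (f s powr \<gamma> * T s powr (- 1 / \<alpha>))) (at s)"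
      unfolding Z_def using s Tpos f[OF s] fpos[OF s] T_deriv[OF s]
      by (intro DERIV_mult DERIV_fun_powr has_real_derivative_powr) (auto simp: T'_def)
    have dpot: "((\<lambda>s. potential (T s)) has_real_derivative m s * T s powr (- \<kappa>) - n / \<alpha> * m s) (at s)"
      using DERIV_chain2[OF potential_deriv[OF Tpos] T_deriv[OF s]] T'pot by (simp add: T'_def)
    define D where "D = \<gamma> / p * g s powr p - (((\<gamma> * f s powr (\<gamma> - of_nat 1) * g s) * T s powr (- 1 / \<alpha>)
          + (- 1 / \<alpha> * T s powr (- 1 / \<alpha> - of_nat 1) * T') * f s powr \<gamma>) * s powr (1 + 1 / \<alpha> - \<gamma>)
       + ((1 + 1 / \<alpha> - \<gamma>) * s powr (1 + 1 / \<alpha> - \<gamma> - 1)) * (f s powr \<gamma> * T s powr (- 1 / \<alpha>))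
       + 1 / \<alpha> * (m s * T s powr (- \<kappa>) - n / \<alpha> * m s) + n / \<alpha> * (1 + 1 / \<alpha>) * m s)"
    have "((\<lambda>s. \<gamma> / p * G s - W s) has_real_derivative D) (at s)"
      unfolding W_def D_def using M[OF s] G[OF s]
      by (intro DERIV_diff DERIV_add DERIV_cmult dZ dpot) (auto simp: m_def)
    moreover have "0 \<le> D"
    proof -
      have e: "1 + 1 / \<alpha> - \<gamma> - 1 = 1 / \<alpha> - \<gamma>" by simp
      have r: "1 / \<alpha> * (m s * T s powr (- \<kappa>) - n / \<alpha> * m s) + n / \<alpha> * (1 + 1 / \<alpha>) * m s
         = n / \<alpha> * m s + 1 / \<alpha> * (m s * T s powr (- \<kappa>))"
        by (simp add: algebra_simps)
      have "D = \<gamma> / p * g s powr p - (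
           \<gamma> * f s powr (\<gamma> - 1) * g s * T s powr (- 1 / \<alpha>) * s powr (1 + 1 / \<alpha> - \<gamma>)
         - 1 / \<alpha> * f s powr \<gamma> * T s powr (- 1 / \<alpha> - 1) * T' * s powr (1 + 1 / \<alpha> - \<gamma>)
         + (1 + 1 / \<alpha> - \<gamma>) * f s powr \<gamma> * T s powr (- 1 / \<alpha>) * s powr (1 / \<alpha> - \<gamma>)
         + n / \<alpha> * m s + 1 / \<alpha> * (m s * T s powr (- \<kappa>)))"
        unfolding D_def e add.assoc r by (simp add: algebra_simps)
      then show ?thesis
        using Bliss_pointwise[OF fpos[OF s] gpos[OF s] s(1) Tpos, of "m s" T'] by (simp add: m_def T'_def)
    qed
    ultimately show "\<exists>D. ((\<lambda>s. \<gamma> / p * G s - W s) has_real_derivative D) (at s) \<and> 0 \<le> D"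
      by blast
  qed
  \<comment> \<open>At the right end only the signs of \<open>Z\<close> and the potential enter, so
    the argument runs on a bounded interval.\<close>
  moreover have "n / \<alpha> * (1 + 1 / \<alpha>) * M s \<le> W s"
    using pot_le(2)[OF T(1)[OF s]] alpha_pos by (simp add: W_def Z_def)
  ultimately have "(1 + 1 / \<alpha>) * (n / \<alpha> * M s) \<le> (1 + 1 / \<alpha>) * G s"
    by (simp add: gamma_div_p mult_ac)
  moreover have "0 < 1 + 1 / \<alpha>"
    using alpha_pos by (simp add: add_pos_pos)
  ultimately show ?thesis
    using mult_le_cancel_left_pos by blast
qed

end

section \<open>Mass and energy of the extremal profile, and Bliss' inequality for continuous
  data\<close>

lemma set_nn_integral_eq_set_lebesgue_integral:
  fixes f :: "'a \<Rightarrow> real"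
  assumes "set_integrable M A f" "\<And>x. x \<in> A \<Longrightarrow> 0 \<le> f x"
  shows "(\<integral>\<^sup>+x\<in>A. ennreal (f x) \<partial>M) = ennreal (LINT x:A|M. f x)"
proof -
  have "(\<integral>\<^sup>+x\<in>A. ennreal (f x) \<partial>M) = (\<integral>\<^sup>+x. ennreal (indicator A x *\<^sub>R f x) \<partial>M)"
    by (intro nn_integral_cong) (auto simp: indicator_def)
  also have "\<dots> = ennreal (LINT x:A|M. f x)"
    unfolding set_lebesgue_integral_def
    using assms by (intro nn_integral_eq_integral) (auto simp: set_integrable_def indicator_def)
  finally show ?thesis .
qed

lemma set_nn_integral_continuous:
  fixes f :: "real \<Rightarrow> real"
  assumes "continuous_on {a..b} f" "\<And>x. x \<in> {a..b} \<Longrightarrow> 0 \<le> f x"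
  shows "(\<integral>\<^sup>+x\<in>{a..b}. ennreal (f x) \<partial>lborel) = ennreal (integral {a..b} f)"
  using set_nn_integral_eq_set_lebesgue_integral[of lborel "{a..b}" f]
    borel_integrable_atLeastAtMost'[OF assms(1)] set_borel_integral_eq_integral(2) assms(2)
  by metis

lemma integral_from_0:
  fixes h :: "real \<Rightarrow> real"
  assumes "continuous_on {0..b} h" "0 < b"
  shows integral_from_0_tendsto: "((\<lambda>s. integral {0..s} h) \<longlongrightarrow> 0) (at_right 0)"
    and integral_from_0_deriv:
      "\<And>s. 0 < s \<Longrightarrow> s < b \<Longrightarrow> ((\<lambda>s. integral {0..s} h) has_real_derivative h s) (at s)"
    and integral_from_0_continuous: "continuous_on {0..b} (\<lambda>s. integral {0..s} h)"
proof -
  show cont: "continuous_on {0..b} (\<lambda>s. integral {0..s} h)"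
    by (intro indefinite_integral_continuous_1 integrable_continuous_real assms)
  have "((\<lambda>s. integral {0..s} h) \<longlongrightarrow> integral {0..0} h) (at 0 within {0..b})"
    using cont[unfolded continuous_on_def, rule_format, of 0] assms(2) by simp
  moreover have "at 0 within {0..b} = at_right 0"
    using assms(2) by (simp add: at_within_Icc_at_right)
  ultimately show "((\<lambda>s. integral {0..s} h) \<longlongrightarrow> 0) (at_right 0)"
    by simp
  show "((\<lambda>s. integral {0..s} h) has_real_derivative h s) (at s)" if "0 < s" "s < b" for s
    using integral_has_real_derivative[OF assms(1), of s] that
    by (simp add: at_within_Icc_at)
qed

context sobolev_exponents
begin

definition total_mass :: real where
  "total_mass = Beta (n / p) (n - n / p) / \<kappa>"

lemma total_mass_pos: "0 < total_mass"
  using p_gt_1 p_less_n kappa_pos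
  by (auto simp: total_mass_def Beta_def intro!: divide_pos_pos mult_pos_pos Gamma_real_pos simp: field_simps)

lemma mass_borel [measurable]: "mass \<in> borel_measurable borel"
  unfolding mass_def[abs_def] by measurable

lemma mass_continuous: "continuous_on {0..} mass"
proof -
  have c: "continuous_on {0..} (\<lambda>y::real. y powr \<kappa>)"
    using kappa_pos by (intro continuous_on_powr') (auto intro: continuous_intros)
  moreover have "1 + y powr \<kappa> \<noteq> 0" for y :: real
    using one_plus_powr_pos[of y \<kappa>] by simp
  ultimately show ?thesis
    unfolding mass_def[abs_def]
    by (intro continuous_on_mult[OF c continuous_on_powr[OF continuous_on_add[OF continuous_on_const c]
          continuous_on_const]]) auto
qed

lemma mass_nonneg: "0 \<le> mass y"
  by (simp add: mass_def)

text \<open>The substitution \<open>y = (t / (1 - t)) powr (1/\<kappa>)\<close> turns the mass integral into a Beta integral.\<close>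

lemma mass_integral:
  "set_integrable lborel {0<..} mass" "(LINT y:{0<..}|lborel. mass y) = total_mass"
proof -
  define a b where "a = n / p" and "b = n - n / p"
  have ab: "a > 0" "b > 0" "1 + 1 / \<kappa> = a" "a + b = n"
    using p_gt_1 p_less_n by (auto simp: a_def b_def \<kappa>_def field_simps)
  define g where "g t = (t / (1 - t)) powr (1 / \<kappa>)" for t :: real
  define g' where "g' t = 1 / \<kappa> * (t / (1 - t)) powr (1 / \<kappa> - 1) * (1 / (1 - t)\<^sup>2)" for t :: real
  define B where "B t = t powr (a - 1) * (1 - t) powr (b - 1)" for t :: real
  have g_deriv: "(g has_real_derivative g' t) (at t)" if "0 < t" "t < 1" for t
  proof -
    have "((\<lambda>t. t / (1 - t)) has_real_derivative 1 / (1 - t)\<^sup>2) (at t)"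
      using that by (auto intro!: derivative_eq_intros simp: field_simps power2_eq_square)
    then show ?thesis
      using DERIV_fun_powr[of "\<lambda>t. t / (1 - t)" "1 / (1 - t)\<^sup>2" t "1 / \<kappa>"] that
      by (simp add: g_def[abs_def] g'_def)
  qed
  have fg: "mass (g t) * g' t = B t / \<kappa>" if "0 < t" "t < 1" for t
  proof -
    have r: "0 < t / (1 - t)" using that by simp
    have "g t powr \<kappa> = t / (1 - t)"
      using r that kappa_pos by (simp add: g_def powr_powr)
    moreover have "1 + t / (1 - t) = 1 / (1 - t)"
      using that by (simp add: field_simps)
    ultimately have "mass (g t) * g' t =
        (t / (1 - t)) * (1 / (1 - t)) powr (- n) * (1 / \<kappa> * (t / (1 - t)) powr (1 / \<kappa> - 1) * (1 / (1 - t)\<^sup>2))"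
      by (simp add: mass_def g'_def)
    also have "\<dots> = 1 / \<kappa> * ((t / (1 - t)) powr 1 * (t / (1 - t)) powr (1 / \<kappa> - 1)) *
        ((1 / (1 - t)) powr (- n) * (1 / (1 - t)) powr 2)"
      using that by (simp add: power_one_over field_simps)
    also have "(t / (1 - t)) powr 1 * (t / (1 - t)) powr (1 / \<kappa> - 1) = (t / (1 - t)) powr (a - 1)"
      by (simp only: powr_add[symmetric]) (simp add: ab(3)[symmetric])
    also have "(1 / (1 - t)) powr (- n) * (1 / (1 - t)) powr 2 = (1 - t) powr (n - 2)"
      using powr_minus_divide[of "1 - t" "2 - n"] powr_divide[of 1 "1 - t" "2 - n"] that
      by (simp only: powr_add[symmetric]) simp
    also have "(t / (1 - t)) powr (a - 1) = t powr (a - 1) * (1 - t) powr (1 - a)"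
      using that by (simp add: powr_divide powr_diff)
    finally have "mass (g t) * g' t = 1 / \<kappa> * (t powr (a - 1) * ((1 - t) powr (1 - a) * (1 - t) powr (n - 2)))"
      by simp
    also have "(1 - t) powr (1 - a) * (1 - t) powr (n - 2) = (1 - t) powr (b - 1)"
      by (simp only: powr_add[symmetric]) (simp add: ab(4)[symmetric])
    finally show ?thesis by (simp add: B_def)
  qed
  have Bint: "(B has_integral Beta a b) {0..1}"
    using has_integral_Beta_real[OF ab(1,2)] by (simp add: B_def[abs_def])
  have "B absolutely_integrable_on {0..1}"
    using Bint by (intro nonnegative_absolutely_integrable_1) (auto simp: B_def)
  then have B_abs: "set_integrable lborel {0..1} B"
    unfolding set_integrable_def
    by (subst (asm) integrable_completion) (auto simp: B_def[abs_def])
  then have B_set: "set_integrable lborel {0<..<1} B"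
    by (rule set_integrable_subset) auto
  have B_val: "(LINT t:{0<..<1}|lborel. B t) = Beta a b"
    using Bint set_borel_integral_eq_integral(2)[OF B_set]
    by (simp add: has_integral_Icc_iff_Ioo integral_unique)
  have "einterval 0 1 = {0<..<1::real}"
    by (auto simp: einterval_def zero_ereal_def one_ereal_def)
  moreover have "set_integrable lborel {0<..<1} (\<lambda>t. mass (g t) * g' t) =
      set_integrable lborel {0<..<1} (\<lambda>t. 1 / \<kappa> * B t)"
    by (rule set_integrable_cong) (auto simp: fg)
  ultimately have cong: "set_integrable lborel (einterval 0 1) (\<lambda>t. mass (g t) * g' t)"
    using set_integrable_mult_right[OF B_set, of "1 / \<kappa>"] by simp
  have lim0: "(g \<longlongrightarrow> 0) (at_right 0)"
  proof -
    have "((\<lambda>t::real. t / (1 - t)) \<longlongrightarrow> 0 / (1 - 0)) (at_right 0)"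
      by (intro tendsto_intros) auto
    then show ?thesis
      unfolding g_def[abs_def]
      using kappa_pos
      by (auto intro!: tendsto_eq_intros eventually_at_rightI[of 0 1])
  qed
  have lim1: "filterlim g at_top (at_left 1)"
  proof -
    have "filterlim (\<lambda>t::real. t / (1 - t)) at_top (at_left 1)"
      by real_asymp
    moreover have "filterlim (\<lambda>x::real. x powr (1 / \<kappa>)) at_top at_top"
      using kappa_pos by real_asymp
    ultimately show ?thesis
      unfolding g_def[abs_def] by (rule filterlim_compose[rotated])
  qed
  have A: "((ereal \<circ> g \<circ> real_of_ereal) \<longlongrightarrow> 0) (at_right 0)"
    using lim0 by (simp add: ereal_tendsto_simps zero_ereal_def)
  have B: "((ereal \<circ> g \<circ> real_of_ereal) \<longlongrightarrow> \<infinity>) (at_left 1)"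
    using lim1 by (simp add: ereal_tendsto_simps one_ereal_def)
  have mass_cont: "isCont mass (g t)" if "0 < ereal t" "ereal t < 1" for t
  proof -
    have "0 < g t" using that by (simp add: g_def zero_ereal_def one_ereal_def)
    then show ?thesis
      using continuous_on_interior[OF mass_continuous, of "g t"] by simp
  qed
  have g'_cont: "isCont g' t" if "0 < ereal t" "ereal t < 1" for t
    using that kappa_pos unfolding g'_def[abs_def] zero_ereal_def one_ereal_def
    by (auto intro!: continuous_intros)
  have g_deriv': "(g has_real_derivative g' t) (at t)" if "0 < ereal t" "ereal t < 1" for t
    using that g_deriv by (simp add: zero_ereal_def one_ereal_def)
  have g'_nonneg: "0 \<le> g' t" for t
    using kappa_pos by (simp add: g'_def)
  note subst = interval_integral_substitution_nonneg
    [of 0 1 g g' mass, OF _ g_deriv' mass_cont g'_cont mass_nonneg g'_nonneg A B cong]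
  have "set_integrable lborel (einterval 0 \<infinity>) mass"
    "(LBINT y=0..\<infinity>. mass y) = (LBINT t=0..1. mass (g t) * g' t)"
    by (rule subst; simp)+
  moreover have "einterval 0 \<infinity> = {0<..}" "einterval 0 1 = {0<..<1::real}"
    by (auto simp: einterval_def zero_ereal_def one_ereal_def)
  moreover have "(LINT t:{0<..<1}|lborel. mass (g t) * g' t) = (LINT t:{0<..<1}|lborel. 1 / \<kappa> * B t)"
    by (rule set_lebesgue_integral_cong) (auto simp: fg)
  ultimately show "set_integrable lborel {0<..} mass" "(LINT y:{0<..}|lborel. mass y) = total_mass"
    by (auto simp: interval_lebesgue_integral_def total_mass_def B_val a_def b_def)
qed

definition mass_upto :: "real \<Rightarrow> real" where
  "mass_upto y = integral {0..y} mass"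

lemma mass_upto_deriv: "0 < y \<Longrightarrow> (mass_upto has_real_derivative mass y) (at y)"
  and mass_upto_tendsto_0: "(mass_upto \<longlongrightarrow> 0) (at_right 0)"
  using integral_from_0_deriv[of "y + 1" mass y] integral_from_0_tendsto[of "1" mass]
    continuous_on_subset[OF mass_continuous, of "{0..y + 1}"]
    continuous_on_subset[OF mass_continuous, of "{0..1}"]
  by (auto simp: mass_upto_def[abs_def])

lemma mass_upto_tendsto_at_top: "(mass_upto \<longlongrightarrow> total_mass) at_top"
proof -
  have eq: "(\<lambda>y. indicator {0..} y *\<^sub>R mass y) = (\<lambda>y. indicator {0<..} y *\<^sub>R mass y)"
    using kappa_pos by (auto simp: fun_eq_iff indicator_def mass_def)
  have int: "set_integrable lborel {0..} mass" "(LINT y:{0..}|lborel. mass y) = total_mass"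
    using mass_integral unfolding set_integrable_def set_lebesgue_integral_def eq by auto
  have "((\<lambda>b. LINT y:{0..b}|lborel. mass y) \<longlongrightarrow> total_mass) at_top"
    using tendsto_set_lebesgue_integral_at_top[OF _ int(1)] by (simp add: int(2))
  moreover have "(LINT y:{0..b}|lborel. mass y) = mass_upto b" for b
    unfolding mass_upto_def
    by (intro set_borel_integral_eq_integral(2) set_integrable_subset[OF int(1)]) auto
  ultimately show ?thesis by simp
qed

lemma nn_integral_mass: "(\<integral>\<^sup>+y\<in>{0<..}. ennreal (mass y) \<partial>lborel) = ennreal total_mass"
  using set_nn_integral_eq_set_lebesgue_integral[OF mass_integral(1)] mass_integral(2)
  by (simp add: mass_nonneg)

text \<open>By \<open>potential_deriv\<close>, \<open>potential + n / \<alpha> * mass_upto\<close>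
  is an antiderivative of the integrand. The potential tends to 0 at 0 and, being at most
  \<open>y powr (1 - \<gamma>)\<close>, also at infinity, so only the mass contributes.\<close>

lemma nn_integral_energy:
  "(\<integral>\<^sup>+y\<in>{0<..}. ennreal ((1 + y powr \<kappa>) powr (- n)) \<partial>lborel) = ennreal (n / \<alpha> * total_mass)"
proof -
  define F where "F y = potential y + n / \<alpha> * mass_upto y" for y
  define f where "f y = (1 + y powr \<kappa>) powr (- n)" for y :: real
  have F: "(F has_real_derivative f y) (at y)" if "0 < y" for y
  proof -
    have "(F has_real_derivative ((1 + y powr \<kappa>) powr (- n) - n / \<alpha> * mass y) + n / \<alpha> * mass y) (at y)"
      unfolding F_def[abs_def] by (intro DERIV_add DERIV_cmult potential_deriv mass_upto_deriv that)
    then show ?thesis by (simp add: f_def)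
  qed
  have pot0: "(potential \<longlongrightarrow> 0) (at_right 0)"
  proof -
    have "((\<lambda>y. y * (1 + y powr \<kappa>) powr (1 - n)) \<longlongrightarrow> 0 * (1 + 0) powr (1 - n)) (at_right (0::real))"
      using kappa_pos by (intro tendsto_intros) (auto intro!: tendsto_eq_intros eventually_at_rightI[of 0 1])
    then show ?thesis
      by (simp add: potential_def[abs_def])
  qed
  have pot_top: "(potential \<longlongrightarrow> 0) at_top"
  proof (rule tendsto_sandwich)
    show "\<forall>\<^sub>F y in at_top. 0 \<le> potential y"
      using eventually_gt_at_top[of 0] by eventually_elim (simp add: potential_def)
    show "\<forall>\<^sub>F y in at_top. potential y \<le> y powr (1 - \<gamma>)"
      using eventually_gt_at_top[of 0]
    proof eventually_elim
      case (elim y)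
      have "(1 + y powr \<kappa>) powr (1 - n) \<le> (y powr \<kappa>) powr (1 - n)"
        using elim p_gt_1 p_less_n by (intro powr_mono2') auto
      also have "\<dots> = y powr (- \<gamma>)"
        by (simp add: powr_powr gamma_eq_mult algebra_simps)
      finally have "potential y \<le> y * y powr (- \<gamma>)"
        using elim by (simp add: potential_def)
      also have "\<dots> = y powr (1 - \<gamma>)"
        using elim powr_add[of y 1 "- \<gamma>"] by simp
      finally show ?case .
    qed
    show "((\<lambda>y. y powr (1 - \<gamma>)) \<longlongrightarrow> 0) at_top"
      using gamma_gt_1 by real_asymp
  qed simp
  have F0: "(F \<longlongrightarrow> 0 + n / \<alpha> * 0) (at_right 0)"
    unfolding F_def[abs_def] by (intro tendsto_intros pot0 mass_upto_tendsto_0)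
  have Ftop: "(F \<longlongrightarrow> 0 + n / \<alpha> * total_mass) at_top"
    unfolding F_def[abs_def] by (intro tendsto_intros pot_top mass_upto_tendsto_at_top)
  have A: "((F \<circ> real_of_ereal) \<longlongrightarrow> 0) (at_right 0)"
    using F0 by (simp add: ereal_tendsto_simps zero_ereal_def)
  have B: "((F \<circ> real_of_ereal) \<longlongrightarrow> n / \<alpha> * total_mass) (at_left \<infinity>)"
    using Ftop by (simp add: ereal_tendsto_simps)
  have F': "(F has_real_derivative f y) (at y)" if "0 < ereal y" "ereal y < \<infinity>" for y
    using that F by (simp add: zero_ereal_def)
  have f_cont: "isCont f y" if "0 < ereal y" "ereal y < \<infinity>" for y
    using that one_plus_powr_pos[of y \<kappa>] unfolding f_def[abs_def] zero_ereal_def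
    by (intro continuous_intros) auto
  have "set_integrable lborel (einterval 0 \<infinity>) f" "(LBINT y=0..\<infinity>. f y) = n / \<alpha> * total_mass - 0"
    by (rule interval_integral_FTC_nonneg[OF _ F' f_cont _ A B]; simp add: f_def)+
  moreover have "einterval 0 \<infinity> = {0<..}"
    by (auto simp: einterval_def zero_ereal_def)
  ultimately show ?thesis
    using set_nn_integral_eq_set_lebesgue_integral[of lborel "{0<..}" f]
    by (simp add: interval_lebesgue_integral_def f_def)
qed

text \<open>Multiplying \<open>g\<close> by \<open>c\<close> gives the density on
  \<open>{0..b}\<close> the integral \<open>total_mass\<close>, so that it can be transported onto
  \<open>mass\<close>; bounds of \<open>g\<close> from both sides provide the behaviour of
  \<open>f\<close> at 0 that the transport requires. Undoing the factor \<open>c\<close> turns the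
  linear inequality between mass and energy into one with the power \<open>q / p\<close>.\<close>

lemma Bliss_continuous:
  assumes g: "continuous_on {0..b} g" and gpos: "\<And>s. s \<in> {0..b} \<Longrightarrow> 0 < g s" and b: "0 < b"
  defines "f \<equiv> \<lambda>s. integral {0..s} g"
  shows "continuous_on {0..b} (\<lambda>s. f s powr q * s powr (- \<gamma>))" (is ?cont)
    and "integral {0..b} (\<lambda>s. f s powr q * s powr (- \<gamma>))
        \<le> total_mass * (\<alpha> / n * integral {0..b} (\<lambda>s. g s powr p) / total_mass) powr (q / p)"
      (is ?ineq)
proof -
  obtain l where l: "0 < l" "\<And>s. s \<in> {0..b} \<Longrightarrow> l \<le> g s"
  proof -
    obtain x where "x \<in> {0..b}" "\<And>s. s \<in> {0..b} \<Longrightarrow> g x \<le> g s"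
      using continuous_attains_inf[OF compact_Icc _ g] b by (auto simp: Ball_def)
    with gpos show ?thesis by (intro that[of "g x"]) auto
  qed
  obtain L where L: "\<And>s. s \<in> {0..b} \<Longrightarrow> g s \<le> L"
  proof -
    obtain x where "x \<in> {0..b}" "\<And>s. s \<in> {0..b} \<Longrightarrow> g s \<le> g x"
      using continuous_attains_sup[OF compact_Icc _ g] b by (auto simp: Ball_def)
    then show ?thesis by (intro that[of "g x"]) auto
  qed
  have f_bounds: "l * s \<le> f s \<and> f s \<le> L * s" if s: "0 \<le> s" "s \<le> b" for s
  proof -
    have int: "g integrable_on {0..s}"
      by (intro integrable_continuous_real continuous_on_subset[OF g]) (use s in auto)
    have "integral {0..s} (\<lambda>_. l) \<le> f s" "f s \<le> integral {0..s} (\<lambda>_. L)"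
      unfolding f_def by (rule integral_le; use int l(2) L s in auto)+
    then show ?thesis using s by (simp add: mult.commute)
  qed
  have fpos: "0 < f s" if "0 < s" "s \<le> b" for s
    using f_bounds[of s] l(1) that by (smt (verit) mult_pos_pos)
  have f_cont: "continuous_on {0..b} f"
    unfolding f_def by (rule integral_from_0_continuous[OF g b])
  define m where "m s = f s powr q * s powr (- \<gamma>)" for s
  have m_le: "m s \<le> L powr q * s powr \<kappa>" if "0 \<le> s" "s \<le> b" for s
  proof -
    have "0 \<le> f s" using fpos[of s] that by (cases "s = 0") (auto simp: f_def)
    then have "f s powr q \<le> (L * s) powr q"
      using f_bounds[OF that] q_pos by (intro powr_mono2) auto
    also have "\<dots> = L powr q * s powr q"
      using that l b l(2)[of 0] L[of 0] by (simp add: powr_mult)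
    finally have "m s \<le> L powr q * s powr q * s powr (- \<gamma>)"
      by (auto simp: m_def intro: mult_right_mono)
    also have "\<dots> = L powr q * s powr \<kappa>"
      by (simp add: q_eq_add powr_add[symmetric] mult.assoc)
    finally show ?thesis .
  qed
  have m_cont: "continuous_on {0..b} m"
    unfolding continuous_on_def
  proof
    fix s assume s: "s \<in> {0..b}"
    show "(m \<longlongrightarrow> m s) (at s within {0..b})"
    proof (cases "s = 0")
      case True
      \<comment> \<open>\<open>m 0 = 0\<close> because \<open>0 powr a = 0\<close>, and the bound by
        \<open>L powr q * s powr \<kappa>\<close> shows that this value is the limit.\<close>
      have "(m \<longlongrightarrow> 0) (at_right 0)"
      proof (rule tendsto_sandwich)
        show "\<forall>\<^sub>F s in at_right 0. 0 \<le> m s"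
          by (simp add: m_def)
        show "\<forall>\<^sub>F s in at_right 0. m s \<le> L powr q * s powr \<kappa>"
          using b m_le by (intro eventually_at_rightI[of 0 b]) auto
        show "((\<lambda>s. L powr q * s powr \<kappa>) \<longlongrightarrow> 0) (at_right 0)"
          using kappa_pos by (auto intro!: tendsto_eq_intros eventually_at_rightI[of 0 1])
      qed simp
      then show ?thesis
        using True b by (simp add: at_within_Icc_at_right m_def)
    next
      case False
      then have "continuous (at s within {0..b}) f" "0 < f s" "0 < s"
        using f_cont s fpos[of s] by (auto simp: continuous_on_eq_continuous_within)
      then have "continuous (at s within {0..b}) m"
        unfolding m_def[abs_def] by (intro continuous_intros) auto
      then show ?thesis by (simp add: continuous_within)
    qed
  qed
  then show ?cont by (simp add: m_def[abs_def])
  define M where "M s = integral {0..s} m" for s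
  define G where "G s = integral {0..s} (\<lambda>s. g s powr p)" for s
  have gp_cont: "continuous_on {0..b} (\<lambda>s. g s powr p)"
    using gpos by (intro continuous_intros g) (auto simp: less_imp_neq[symmetric])
  have M_cont: "continuous_on {0..b} M"
    unfolding M_def by (rule integral_from_0_continuous[OF m_cont b])
  have mpos: "0 < m s" if "0 < s" "s \<le> b" for s
    using fpos[OF that] that by (simp add: m_def)
  have M_less: "M s < M t" if "0 \<le> s" "s < t" "t \<le> b" for s t
  proof (rule DERIV_pos_imp_increasing_open[OF that(2)])
    show "\<exists>D. (M has_real_derivative D) (at x) \<and> 0 < D" if x: "s < x" "x < t" for x
      using integral_from_0_deriv[OF m_cont b, of x] mpos[of x] x \<open>0 \<le> s\<close> \<open>t \<le> b\<close>
      by (auto simp: M_def[abs_def])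
    show "continuous_on {s..t} M"
      by (rule continuous_on_subset[OF M_cont]) (use that in auto)
  qed
  have M0: "M 0 = 0" by (simp add: M_def)
  have Mb: "0 < M b" using M_less[of 0 b] M0 b by simp
  define c where "c = (total_mass / M b) powr (1 / q)"
  have c: "0 < c" "c powr q = total_mass / M b"
    using Mb total_mass_pos q_pos by (auto simp: c_def powr_powr)
  have onto: "\<exists>y>0. mass_upto y = c powr q * M s" if s: "0 < s" "s < b" for s
  proof -
    have Ms: "0 < c powr q * M s" "c powr q * M s < total_mass"
      using M_less[of 0 s] M_less[of s b] M0 s b Mb total_mass_pos by (auto simp: c field_simps)
    have "\<forall>\<^sub>F y in at_right 0. 0 < y \<and> mass_upto y < c powr q * M s"
      using mass_upto_tendsto_0 Ms(1) eventually_at_right_less[of "0::real"]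
      by (auto simp: order_tendsto_iff eventually_conj)
    then obtain y1 where y1: "0 < y1" "mass_upto y1 < c powr q * M s"
      by (metis (mono_tags, lifting) eventually_happens trivial_limit_at_right_real)
    have "\<forall>\<^sub>F y in at_top. y1 < y \<and> c powr q * M s < mass_upto y"
      using mass_upto_tendsto_at_top Ms(2) eventually_gt_at_top[of y1]
      by (auto simp: order_tendsto_iff eventually_conj)
    then obtain y2 where y2: "y1 < y2" "c powr q * M s < mass_upto y2"
      by (metis (mono_tags, lifting) eventually_happens trivial_limit_at_top_linorder)
    have "\<exists>y\<ge>y1. y \<le> y2 \<and> mass_upto y = c powr q * M s"
      using y1 y2 DERIV_isCont[OF mass_upto_deriv] by (intro IVT) auto
    with y1 show ?thesis by (meson less_le_trans)
  qed
  have transport: "n / \<alpha> * (c powr q * M s) \<le> c powr p * G s" if s: "0 < s" "s < b" for s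
  proof (rule Bliss_transport[where f = "\<lambda>s. c * f s" and g = "\<lambda>s. c * g s" and b = b and \<delta> = b
        and l = "c * l" and L = "c * L" and \<Phi> = mass_upto
        and M = "\<lambda>s. c powr q * M s" and G = "\<lambda>s. c powr p * G s" and s = s])
    fix s assume s: "0 < s" "s < b"
    show "((\<lambda>s. c * f s) has_real_derivative c * g s) (at s)"
      unfolding f_def by (intro DERIV_cmult integral_from_0_deriv[OF g b] s)
    show "0 < c * f s" "0 < c * g s"
      using c fpos gpos s by auto
    show "((\<lambda>s. c powr q * M s) has_real_derivative (c * f s) powr q * s powr (- \<gamma>)) (at s)"
    proof -
      have "((\<lambda>s. c powr q * M s) has_real_derivative c powr q * m s) (at s)"
        unfolding M_def[abs_def] by (intro DERIV_cmult integral_from_0_deriv[OF m_cont b] s)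
      then show ?thesis
        using c(1) fpos[of s] s by (simp add: m_def powr_mult mult.assoc)
    qed
    show "((\<lambda>s. c powr p * G s) has_real_derivative (c * g s) powr p) (at s)"
    proof -
      have "((\<lambda>s. c powr p * G s) has_real_derivative c powr p * g s powr p) (at s)"
        unfolding G_def[abs_def] by (intro DERIV_cmult integral_from_0_deriv[OF gp_cont b] s)
      then show ?thesis
        using c(1) gpos[of s] s by (simp add: powr_mult)
    qed
    show "c * l * s \<le> c * f s \<and> c * f s \<le> c * L * s"
      using f_bounds[of s] c(1) s by (simp add: mult.assoc)
    show "\<exists>y>0. mass_upto y = c powr q * M s"
      by (rule onto[OF s])
  next
    show "((\<lambda>s. c powr q * M s) \<longlongrightarrow> 0) (at_right 0)"
      using tendsto_mult[OF tendsto_const[of "c powr q"] integral_from_0_tendsto[OF m_cont b]]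
      by (simp add: M_def)
    show "((\<lambda>s. c powr p * G s) \<longlongrightarrow> 0) (at_right 0)"
      using tendsto_mult[OF tendsto_const[of "c powr p"] integral_from_0_tendsto[OF gp_cont b]]
      by (simp add: G_def)
  qed (use s b c l mass_upto_deriv mass_upto_tendsto_0 in auto)
  have G_cont: "continuous_on {0..b} G"
    unfolding G_def by (rule integral_from_0_continuous[OF gp_cont b])
  \<comment> \<open>At \<open>b\<close> the whole of \<open>total_mass\<close> is used up and the
    transport map would be infinite, hence the passage to the limit from the left.\<close>
  have at_b: "n / \<alpha> * (c powr q * M b) \<le> c powr p * G b"
  proof (rule tendsto_le)
    show "((\<lambda>s. n / \<alpha> * (c powr q * M s)) \<longlongrightarrow> n / \<alpha> * (c powr q * M b)) (at_left b)"
      "((\<lambda>s. c powr p * G s) \<longlongrightarrow> c powr p * G b) (at_left b)"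
      using M_cont[unfolded continuous_on_def, rule_format, of b]
        G_cont[unfolded continuous_on_def, rule_format, of b] b
      by (intro tendsto_mult[OF tendsto_const]; simp add: at_within_Icc_at_left)+
    show "\<forall>\<^sub>F s in at_left b. n / \<alpha> * (c powr q * M s) \<le> c powr p * G s"
      using transport b by (intro eventually_at_leftI[of 0]) auto
  qed simp
  have npos: "0 < n" using p_gt_1 p_less_n by simp
  have "total_mass / c powr p \<le> \<alpha> / n * G b"
    using at_b Mb c npos alpha_pos by (simp add: field_simps)
  moreover have "c powr p = (total_mass / M b) powr (p / q)"
    by (simp add: c_def powr_powr)
  ultimately have "(M b / total_mass) powr (p / q) \<le> \<alpha> / n * G b / total_mass"
    using Mb total_mass_pos npos by (simp add: powr_divide field_simps)
  then have "((M b / total_mass) powr (p / q)) powr (q / p) \<le> (\<alpha> / n * G b / total_mass) powr (q / p)"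
    using q_pos p_gt_1 by (intro powr_mono2) auto
  then have "M b / total_mass \<le> (\<alpha> / n * G b / total_mass) powr (q / p)"
    using Mb total_mass_pos q_pos p_gt_1 by (simp add: powr_powr)
  then show ?ineq
    using total_mass_pos by (simp add: M_def G_def m_def[abs_def] field_simps)
qed

end

section \<open>Moments and approximation\<close>

text \<open>The p-th power of the L^p norm with values in \<open>ennreal\<close>. Leaving out the
  root and admitting infinity keeps side conditions out of the convergence statements.\<close>

definition moment :: "real \<Rightarrow> 'a measure \<Rightarrow> ('a \<Rightarrow> 'b::real_normed_vector) \<Rightarrow> ennreal" where
  "moment p M f = (\<integral>\<^sup>+x. ennreal (norm (f x) powr p) \<partial>M)"

lemma moment_cong_AE:
  "(AE x in M. norm (f x) = norm (g x)) \<Longrightarrow> moment p M f = moment p M g"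
  unfolding moment_def by (intro nn_integral_cong_AE) auto

lemma moment_mono_AE:
  assumes "0 \<le> p" "AE x in M. norm (f x) \<le> norm (g x)"
  shows "moment p M f \<le> moment p M g"
  unfolding moment_def using assms
  by (intro nn_integral_mono_AE) (auto intro!: ennreal_leI powr_mono2)

text \<open>Convexity of \<open>powr p\<close> at
  \<open>(1 - t) * (x / (1 - t)) + t * (y / t)\<close>. The free weight \<open>t\<close> does the
  work of Minkowski's inequality: as it tends to 0 the coefficient of \<open>x powr p\<close> tends
  to 1, so sharp constants survive limits.\<close>

lemma powr_add_le:
  fixes x y t p :: real
  assumes "0 \<le> x" "0 \<le> y" "0 < t" "t < 1" "1 \<le> p"
  shows "(x + y) powr p \<le> (1 - t) powr (1 - p) * x powr p + t powr (1 - p) * y powr p"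
proof -
  have scale: "c * (z / c) powr p = c powr (1 - p) * z powr p" if "0 < c" "0 \<le> z" for c z :: real
    using that by (simp add: powr_divide powr_diff)
  have one_le: "1 \<le> c powr (1 - p)" if "0 < c" "c < 1" for c :: real
    using powr_mono_both'[of "p - 1" 0 c 1] that assms(5) powr_mono2'[of "1 - p" c 1] by simp
  consider "x = 0" | "y = 0" | "0 < x" "0 < y"
    using assms by linarith
  then show ?thesis
  proof cases
    case 1
    then show ?thesis
      using one_le[of t] assms mult_right_mono[of 1 "t powr (1 - p)" "y powr p"] by simp
  next
    case 2
    then show ?thesis
      using one_le[of "1 - t"] assms mult_right_mono[of 1 "(1 - t) powr (1 - p)" "x powr p"] by simp
  next
    case 3
    have "((1 - t) * (x / (1 - t)) + t * (y / t)) powr p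
        \<le> (1 - t) * (x / (1 - t)) powr p + t * (y / t) powr p"
      using convex_onD[OF powr_convex[OF assms(5)], of t "x / (1 - t)" "y / t"] 3 assms by simp
    then show ?thesis
      using assms 3 by (simp add: scale)
  qed
qed

lemma moment_add:
  assumes [measurable]: "f \<in> borel_measurable M" "g \<in> borel_measurable M"
    and "0 < t" "t < 1" "1 \<le> p"
  shows "moment p M (\<lambda>x. f x + g x :: 'b :: {second_countable_topology, real_normed_vector})
    \<le> ennreal ((1 - t) powr (1 - p)) * moment p M f + ennreal (t powr (1 - p)) * moment p M g"
proof -
  have "norm (f x + g x) powr p \<le> (1 - t) powr (1 - p) * norm (f x) powr p + t powr (1 - p) * norm (g x) powr p" for x
    using powr_mono2[of p "norm (f x + g x)" "norm (f x) + norm (g x)"] assms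
      powr_add_le[of "norm (f x)" "norm (g x)" t p] norm_triangle_ineq[of "f x" "g x"]
    by fastforce
  then have "moment p M (\<lambda>x. f x + g x)
     \<le> (\<integral>\<^sup>+x. ennreal ((1 - t) powr (1 - p)) * ennreal (norm (f x) powr p)
            + ennreal (t powr (1 - p)) * ennreal (norm (g x) powr p) \<partial>M)"
    unfolding moment_def
    by (intro nn_integral_mono) (simp add: ennreal_mult[symmetric] ennreal_plus[symmetric] del: ennreal_plus)
  also have "\<dots> = ennreal ((1 - t) powr (1 - p)) * moment p M f + ennreal (t powr (1 - p)) * moment p M g"
    unfolding moment_def by (subst nn_integral_add) (auto simp: nn_integral_cmult)
  finally show ?thesis .
qed

lemma moment_add_le:
  assumes "f \<in> borel_measurable M" "g \<in> borel_measurable M" "1 \<le> p"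
  shows "moment p M (\<lambda>x. f x + g x :: 'b :: {second_countable_topology, real_normed_vector})
    \<le> ennreal (2 powr (p - 1)) * (moment p M f + moment p M g)"
proof -
  have "(1 / 2) powr (1 - p) = 2 powr (p - 1)"
    using powr_minus_divide[of 2 "1 - p"] by (simp add: powr_divide)
  then show ?thesis
    using moment_add[OF assms(1,2), of "1/2" p] assms(3) by (simp add: distrib_left)
qed

lemma moment_uminus: "moment p M (\<lambda>x. - f x) = moment p M f"
  by (simp add: moment_def)

lemma moment_triangle_tendsto_0:
  fixes f g :: "nat \<Rightarrow> 'a \<Rightarrow> 'b :: {second_countable_topology, real_normed_vector}"
  assumes "\<And>k. f k \<in> borel_measurable M" "\<And>k. g k \<in> borel_measurable M" "1 \<le> p"
    and "(\<lambda>k. moment p M (f k)) \<longlonglongrightarrow> 0" "(\<lambda>k. moment p M (g k)) \<longlonglongrightarrow> 0"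
  shows "(\<lambda>k. moment p M (\<lambda>x. f k x + g k x)) \<longlonglongrightarrow> 0"
proof (rule tendsto_sandwich[OF _ _ tendsto_const])
  show "\<forall>\<^sub>F k in sequentially. moment p M (\<lambda>x. f k x + g k x)
      \<le> ennreal (2 powr (p - 1)) * (moment p M (f k) + moment p M (g k))"
    using assms by (intro always_eventually allI moment_add_le)
  have "(\<lambda>k. ennreal (2 powr (p - 1)) * (moment p M (f k) + moment p M (g k)))
      \<longlonglongrightarrow> ennreal (2 powr (p - 1)) * (0 + 0)"
    using assms(4,5) by (intro ennreal_tendsto_cmult tendsto_add) auto
  then show "(\<lambda>k. ennreal (2 powr (p - 1)) * (moment p M (f k) + moment p M (g k))) \<longlonglongrightarrow> 0"
    by simp
qed simp

text \<open>Hoelder's inequality on a finite measure space, obtained by integrating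
  \<open>y \<le> a powr (1 - p) / p * y powr p + a * (1 - 1 / p)\<close>; the choice
  \<open>a = (E / m) powr (1 / p)\<close> minimises the resulting bound.\<close>

lemma nn_integral_le_moment:
  assumes [measurable]: "f \<in> borel_measurable M"
    and "emeasure M (space M) \<le> ennreal m" "moment p M f \<le> ennreal E" "0 < m" "0 < E" "1 < p"
  shows "(\<integral>\<^sup>+x. ennreal (norm (f x)) \<partial>M) \<le> ennreal (E powr (1 / p) * m powr (1 - 1 / p))"
proof -
  define a where "a = (E / m) powr (1 / p)"
  have a: "0 < a" using assms by (simp add: a_def)
  have young: "y \<le> a powr (1 - p) / p * y powr p + a * (1 - 1 / p)" if "0 \<le> y" for y
  proof (cases "y = 0")
    case False
    have "(a powr (1 - p) * y powr p) powr (1 / p) * a powr (1 - 1 / p)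
        \<le> 1 / p * (a powr (1 - p) * y powr p) + (1 - 1 / p) * a"
      using a False that assms by (intro Youngs_inequality_0) auto
    also have "(a powr (1 - p) * y powr p) powr (1 / p) * a powr (1 - 1 / p)
        = (a powr ((1 - p) * (1 / p)) * a powr (1 - 1 / p)) * y"
      using that assms by (simp add: powr_mult powr_powr)
    also have "a powr ((1 - p) * (1 / p)) * a powr (1 - 1 / p) = 1"
      using a assms by (simp add: powr_add[symmetric] field_simps)
    finally show ?thesis by (simp add: mult.commute)
  qed (use a assms in \<open>auto simp: field_simps\<close>)
  have "(\<integral>\<^sup>+x. ennreal (norm (f x)) \<partial>M)
     \<le> (\<integral>\<^sup>+x. ennreal (a powr (1 - p) / p) * ennreal (norm (f x) powr p) + ennreal (a * (1 - 1 / p)) \<partial>M)"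
    using young a assms
    by (intro nn_integral_mono) (auto simp: ennreal_mult[symmetric] ennreal_plus[symmetric] simp del: ennreal_plus)
  also have "\<dots> = ennreal (a powr (1 - p) / p) * moment p M f + ennreal (a * (1 - 1 / p)) * emeasure M (space M)"
    unfolding moment_def by (subst nn_integral_add) (auto simp: nn_integral_cmult)
  also have "\<dots> \<le> ennreal (a powr (1 - p) / p) * ennreal E + ennreal (a * (1 - 1 / p)) * ennreal m"
    by (intro add_mono mult_left_mono assms) auto
  also have "\<dots> = ennreal (a powr (1 - p) / p * E + a * (1 - 1 / p) * m)"
    using a assms by (simp add: ennreal_mult[symmetric] ennreal_plus[symmetric] field_simps del: ennreal_plus)
  also have "a powr (1 - p) / p * E + a * (1 - 1 / p) * m = E powr (1 / p) * m powr (1 - 1 / p)"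
  proof -
    have "a powr p = E / m"
      using assms by (simp add: a_def powr_powr)
    then have "a powr (1 - p) * E = a * m"
      using a assms by (simp add: powr_diff field_simps)
    moreover have "a * m = E powr (1 / p) * m powr (1 - 1 / p)"
      using assms by (simp add: a_def powr_divide powr_diff)
    ultimately show ?thesis
      by (simp add: algebra_simps)
  qed
  finally show ?thesis .
qed

lemma moment_tendsto_imp_nn_integral_tendsto:
  assumes "\<And>k. f k \<in> borel_measurable M" "emeasure M (space M) < \<infinity>" "1 < p"
    and lim: "(\<lambda>k. moment p M (f k)) \<longlonglongrightarrow> 0"
  shows "(\<lambda>k. \<integral>\<^sup>+x. ennreal (norm (f k x)) \<partial>M) \<longlonglongrightarrow> 0"
proof (rule order_tendstoI)
  fix a :: ennreal assume a: "0 < a"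
  obtain m where m: "0 < m" "emeasure M (space M) \<le> ennreal m"
  proof (cases "emeasure M (space M)")
    case (real r)
    show ?thesis by (rule that[of "r + 1"]) (use real in \<open>auto intro: ennreal_leI\<close>)
  qed (use assms(2) in auto)
  define C where "C = m powr (1 - 1 / p)"
  have C: "0 < C" using m by (simp add: C_def)
  obtain e where e: "0 < e" "ennreal e < a"
  proof (cases a)
    case (real r)
    then show ?thesis
      using a by (intro that[of "r / 2"]) (auto simp: ennreal_less_iff)
  qed (use that[of 1] in auto)
  define E where "E = (e / C) powr p"
  have E: "0 < E" using e C by (simp add: E_def)
  have "\<forall>\<^sub>F k in sequentially. moment p M (f k) < ennreal E"
    using lim E by (simp add: order_tendsto_iff)
  then show "\<forall>\<^sub>F k in sequentially. (\<integral>\<^sup>+x. ennreal (norm (f k x)) \<partial>M) < a"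
  proof eventually_elim
    case (elim k)
    have "(\<integral>\<^sup>+x. ennreal (norm (f k x)) \<partial>M) \<le> ennreal (E powr (1 / p) * m powr (1 - 1 / p))"
      using assms m E elim by (intro nn_integral_le_moment) auto
    also have "E powr (1 / p) * m powr (1 - 1 / p) = e"
      using e C assms(3) by (simp add: E_def powr_powr C_def[symmetric])
    finally show ?case using e(2) by simp
  qed
qed auto

text \<open>Continuous functions converging almost everywhere are clipped to the range of
  \<open>f\<close> and replaced on \<open>K\<close> by polynomials within
  \<open>1 / real (Suc k)\<close>. Clipping yields the uniform bound for dominated convergence,
  polynomials yield smoothness.\<close>

lemma bounded_measurable_polynomial_approx:
  fixes f :: "'a::euclidean_space \<Rightarrow> real"
  assumes [measurable]: "f \<in> borel_measurable borel" and bound: "\<And>x. \<bar>f x\<bar> \<le> B" and K: "compact K"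
  obtains q where "\<And>k. real_polynomial_function (q k)" "\<And>k x. x \<in> K \<Longrightarrow> \<bar>q k x\<bar> \<le> B + 1"
    "AE x in lborel. x \<in> K \<longrightarrow> (\<lambda>k::nat. q k x) \<longlonglongrightarrow> f x"
proof -
  have "f measurable_on UNIV"
    by (intro lebesgue_measurable_imp_measurable_on) (auto intro: measurable_completion)
  then obtain N h where N: "negligible N" and h: "\<And>k. continuous_on UNIV (h k)"
    and lim: "\<And>x. x \<notin> N \<Longrightarrow> (\<lambda>k. h k x) \<longlonglongrightarrow> f x"
    unfolding measurable_on_def by auto
  define c where "c k x = max (- B) (min B (h k x))" for k x
  have "\<exists>q. real_polynomial_function q \<and> (\<forall>x\<in>K. \<bar>c k x - q x\<bar> < 1 / real (Suc k))" for k
  proof -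
    have cont: "continuous_on K (c k)"
      unfolding c_def using h continuous_on_subset by (intro continuous_intros) blast
    obtain r where "real_polynomial_function r" "\<And>x. x \<in> K \<Longrightarrow> \<bar>c k x - r x\<bar> < 1 / real (Suc k)"
      by (rule Stone_Weierstrass_real_polynomial_function[OF K cont, of "1 / real (Suc k)"]) simp_all
    then show ?thesis by blast
  qed
  then obtain q where q: "\<And>k. real_polynomial_function (q k)"
    "\<And>k x. x \<in> K \<Longrightarrow> \<bar>c k x - q k x\<bar> < 1 / real (Suc k)"
    by metis
  have B: "0 \<le> B" using bound[of undefined] by linarith
  show ?thesis
  proof
    show "real_polynomial_function (q k)" for k by (rule q)
    show "\<bar>q k x\<bar> \<le> B + 1" if "x \<in> K" for k x
    proof -
      have "\<bar>c k x\<bar> \<le> B" using B by (auto simp: c_def)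
      moreover have "1 / real (Suc k) \<le> 1" by simp
      ultimately show ?thesis using q(2)[OF that, of k] by linarith
    qed
    have conv: "(\<lambda>k. q k x) \<longlonglongrightarrow> f x" if "x \<in> K" "x \<notin> N" for x
    proof -
      have "(\<lambda>k. c k x) \<longlonglongrightarrow> max (- B) (min B (f x))"
        unfolding c_def by (intro tendsto_intros lim that)
      also have "max (- B) (min B (f x)) = f x"
        using bound[of x] by linarith
      finally have c: "(\<lambda>k. c k x) \<longlonglongrightarrow> f x" .
      have "(\<lambda>k. c k x - q k x) \<longlonglongrightarrow> 0"
        using q(2)[OF that(1)]
        by (intro Lim_null_comparison[OF always_eventually LIMSEQ_inverse_real_of_nat[unfolded inverse_eq_divide]])
           (auto intro: less_imp_le)
      from tendsto_diff[OF c this] show ?thesis by simp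
    qed
    have "AE x in lebesgue. x \<in> K \<longrightarrow> (\<lambda>k. q k x) \<longlonglongrightarrow> f x"
      using N conv by (intro AE_I'[of N]) (auto simp: negligible_iff_null_sets)
    then show "AE x in lborel. x \<in> K \<longrightarrow> (\<lambda>k. q k x) \<longlonglongrightarrow> f x"
      by (simp add: AE_completion_iff)
  qed
qed

section \<open>Approximation by smooth compactly supported functions on the half line\<close>

definition half_line :: "real measure" where
  "half_line = restrict_space lborel {0<..}"

lemma space_half_line [simp]: "space half_line = {0<..}"
  by (simp add: half_line_def space_restrict_space)

lemma half_line_borel [intro, simp]: "f \<in> borel_measurable borel \<Longrightarrow> f \<in> borel_measurable half_line"
  by (simp add: half_line_def measurable_restrict_space1)

lemma nn_integral_half_line: "integral\<^sup>N half_line f = (\<integral>\<^sup>+s\<in>{0<..}. f s \<partial>lborel)"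
  by (simp add: half_line_def nn_integral_restrict_space)

lemma AE_half_line: "(AE s in half_line. P s) \<longleftrightarrow> (AE s in lborel. 0 < s \<longrightarrow> P s)"
  unfolding half_line_def by (subst AE_restrict_space_iff) auto

definition test_half_line :: "(real \<Rightarrow> real) set" where
  "test_half_line = {g. smooth g \<and> (\<exists>a b. 0 < a \<and> a \<le> b \<and> (\<forall>s. g s \<noteq> 0 \<longrightarrow> a \<le> s \<and> s \<le> b))}"

lemma test_half_line_borel: "g \<in> test_half_line \<Longrightarrow> g \<in> borel_measurable borel"
  by (auto simp: test_half_line_def intro!: borel_measurable_continuous_onI smooth_continuous_on)

text \<open>Polynomials converge to \<open>g\<close> almost everywhere on \<open>{0..T}\<close>.
  Cutoffs vanishing near both ends give compact support in the open interval and tend to 1 inside,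
  and the common bound \<open>2 * B + 1\<close> allows dominated convergence.\<close>

lemma test_half_line_approx_bounded:
  fixes g :: "real \<Rightarrow> real"
  assumes g [measurable]: "g \<in> borel_measurable borel" and bound: "\<And>s. \<bar>g s\<bar> \<le> B"
    and supp: "\<And>s. s \<notin> {0<..<T} \<Longrightarrow> g s = 0" and T: "0 < T" and p: "0 < p"
  obtains G where "\<And>k. G k \<in> test_half_line" "(\<lambda>k. moment p half_line (\<lambda>s. G k s - g s)) \<longlonglongrightarrow> 0"
proof -
  obtain Q where Q: "\<And>k. real_polynomial_function (Q k)" "\<And>k x. x \<in> {0..T} \<Longrightarrow> \<bar>Q k x\<bar> \<le> B + 1"
    "AE x in lborel. x \<in> {0..T} \<longrightarrow> (\<lambda>k. Q k x) \<longlonglongrightarrow> g x"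
    by (rule bounded_measurable_polynomial_approx[OF g bound compact_Icc[of 0 T]]) auto
  define \<psi> where "\<psi> k s = exp_recip (real k * s - 1) * exp_recip (real k * (T - s) - 1)" for k s
  define G where "G k s = \<psi> k s * Q k s" for k s
  have \<psi>: "0 \<le> \<psi> k s" "\<psi> k s \<le> 1" for k s
    using exp_recip_bounds by (auto simp: \<psi>_def intro: mult_le_one)
  \<comment> \<open>\<open>Suc k\<close> keeps the left bound positive for \<open>k = 0\<close>,
    where the cutoff is identically 0.\<close>
  have \<psi>_supp: "1 / real (Suc k) \<le> s \<and> s \<le> T" if "\<psi> k s \<noteq> 0" for k s
  proof -
    have *: "1 < real k * s" "1 < real k * (T - s)"
      using that exp_recip_eq_0[of "real k * s - 1"] exp_recip_eq_0[of "real k * (T - s) - 1"]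
      by (force simp: \<psi>_def)+
    then have k: "0 < k" by (cases k) auto
    with * have "0 < T - s" "0 < s"
      by (smt (verit) of_nat_0_less_iff zero_less_mult_iff)+
    with * k show ?thesis by (simp add: field_simps)
  qed
  have \<psi>_smooth: "smooth (\<psi> k)" for k
  proof -
    have "smooth (\<lambda>s::real. s)" by (intro smooth_bounded_linear bounded_linear_ident)
    then show ?thesis
      unfolding \<psi>_def[abs_def]
      by (intro smooth_mult smooth_compose[OF smooth_exp_recip] smooth_diff smooth_const)
  qed
  have test: "G k \<in> test_half_line" for k
    unfolding test_half_line_def
  proof (intro CollectI conjI exI)
    show "smooth (G k)"
      unfolding G_def[abs_def] by (intro smooth_mult \<psi>_smooth smooth_real_polynomial_function Q)
    \<comment> \<open>The right bound \<open>T + 1\<close> is at least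
      \<open>1 / real (Suc k)\<close> for every \<open>k\<close>, however small \<open>T\<close>
      is.\<close>
    show "\<forall>s. G k s \<noteq> 0 \<longrightarrow> 1 / real (Suc k) \<le> s \<and> s \<le> T + 1"
      using \<psi>_supp by (fastforce simp: G_def)
    have "1 / real (Suc k) \<le> 1" by simp
    then show "1 / real (Suc k) \<le> T + 1" using T by linarith
  qed simp
  have [measurable]: "G k \<in> borel_measurable borel" for k
    by (rule test_half_line_borel[OF test])
  have B: "0 \<le> B" using bound[of 0] by linarith
  have "(\<lambda>k. \<integral>\<^sup>+s. ennreal (norm (G k s - g s) powr p) * indicator {0<..} s \<partial>lborel)
      \<longlonglongrightarrow> (\<integral>\<^sup>+(s::real). (0::ennreal) \<partial>lborel)"
  proof (rule nn_integral_dominated_convergence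
      [where w = "\<lambda>s. ennreal ((2 * B + 1) powr p) * indicator {0..T} s"])
    show "AE s in lborel. ennreal (norm (G k s - g s) powr p) * indicator {0<..} s
        \<le> ennreal ((2 * B + 1) powr p) * indicator {0..T} s" for k
    proof (rule AE_I2)
      fix s
      show "ennreal (norm (G k s - g s) powr p) * indicator {0<..} s
        \<le> ennreal ((2 * B + 1) powr p) * indicator {0..T} s"
      proof (cases "s \<in> {0..T}")
        case True
        have "\<bar>G k s\<bar> \<le> 1 * (B + 1)"
          unfolding G_def abs_mult using \<psi>[of k s] Q(2)[OF True, of k] by (intro mult_mono) auto
        then have "norm (G k s - g s) \<le> 2 * B + 1"
          using bound[of s] by simp
        then have "norm (G k s - g s) powr p \<le> (2 * B + 1) powr p"
          using p by (intro powr_mono2) auto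
        then show ?thesis using True by (auto simp: indicator_def intro: ennreal_leI)
      next
        case False
        then have "G k s = 0 \<or> s \<le> 0"
          using \<psi>_supp[of k s] by (auto simp: G_def)
        moreover have "g s = 0" using False by (intro supp) auto
        ultimately show ?thesis using p by (auto simp: indicator_def)
      qed
    qed
    show "AE s in lborel. (\<lambda>k. ennreal (norm (G k s - g s) powr p) * indicator {0<..} s) \<longlonglongrightarrow> 0"
      using Q(3)
    proof eventually_elim
      case (elim s)
      show ?case
      proof (cases "0 < s \<and> s < T")
        case True
        have "(\<lambda>k. \<psi> k s) \<longlonglongrightarrow> 1 * 1"
          unfolding \<psi>_def by (intro tendsto_mult exp_recip_tendsto_1) (use True in auto)
        then have "(\<lambda>k. G k s) \<longlonglongrightarrow> 1 * g s"
          unfolding G_def using elim True by (intro tendsto_mult) auto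
        then have "(\<lambda>k. norm (G k s - g s)) \<longlonglongrightarrow> 0"
          by (intro tendsto_norm_zero) (simp add: LIM_zero)
        from tendsto_powr'[OF this tendsto_const[of p]]
        have "(\<lambda>k. norm (G k s - g s) powr p) \<longlonglongrightarrow> 0"
          using p by simp
        then have "(\<lambda>k. ennreal (norm (G k s - g s) powr p)) \<longlonglongrightarrow> ennreal 0"
          by (rule tendsto_ennrealI)
        then show ?thesis using True by simp
      next
        case False
        then have "G k s = 0 \<or> s \<le> 0" for k
        proof -
          have "\<psi> k s = 0" if "0 < s"
            using that False exp_recip_eq_0[of "real k * (T - s) - 1"] 
            by (auto simp: \<psi>_def mult_nonneg_nonpos order_trans[of _ 0])
          then show ?thesis by (auto simp: G_def)
        qed
        moreover have "g s = 0" using False by (intro supp) auto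
        ultimately have "ennreal (norm (G k s - g s) powr p) * indicator {0<..} s = 0" for k
          using p by (auto simp: indicator_def)
        then show ?thesis by (simp only: tendsto_const)
      qed
    qed
    show "(\<integral>\<^sup>+s. ennreal ((2 * B + 1) powr p) * indicator {0..T} s \<partial>lborel) < \<infinity>"
      using T by (simp add: nn_integral_cmult ennreal_mult_less_top)
  qed auto
  then have "(\<lambda>k. moment p half_line (\<lambda>s. G k s - g s)) \<longlonglongrightarrow> 0"
    by (simp add: moment_def nn_integral_half_line)
  with test show ?thesis by (rule that)
qed

text \<open>Truncating \<open>g\<close> in value and in range reduces to the bounded case; choosing
  for each truncation an approximation with error below \<open>1 / real (Suc k)\<close> merges the
  two limits.\<close>

lemma test_half_line_approx:
  fixes g :: "real \<Rightarrow> real"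
  assumes g [measurable]: "g \<in> borel_measurable borel" and fin: "moment p half_line g < \<infinity>" and p: "1 \<le> p"
  obtains G where "\<And>k. G k \<in> test_half_line" "(\<lambda>k. moment p half_line (\<lambda>s. G k s - g s)) \<longlonglongrightarrow> 0"
proof -
  define t where "t k s = (if s \<in> {0<..<real (Suc k)} then max (- real k) (min (real k) (g s)) else 0)"
    for k :: nat and s
  have [measurable]: "t k \<in> borel_measurable borel" for k
    unfolding t_def[abs_def] by measurable
  have t_le: "norm (t k s - g s) \<le> norm (g s)" for k s
    by (auto simp: t_def)
  have "(\<lambda>k. \<integral>\<^sup>+s. ennreal (norm (t k s - g s) powr p) \<partial>half_line) \<longlonglongrightarrow> (\<integral>\<^sup>+s. (0::ennreal) \<partial>half_line)"
  proof (rule nn_integral_dominated_convergence[where w = "\<lambda>s. ennreal (norm (g s) powr p)"])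
    show "AE s in half_line. ennreal (norm (t k s - g s) powr p) \<le> ennreal (norm (g s) powr p)" for k
      using t_le p by (auto intro!: AE_I2 ennreal_leI powr_mono2)
    show "AE s in half_line. (\<lambda>k. ennreal (norm (t k s - g s) powr p)) \<longlonglongrightarrow> 0"
    proof (rule AE_I2)
      fix s assume "s \<in> space half_line"
      then have s: "0 < s" by simp
      obtain k0 :: nat where k0: "max s \<bar>g s\<bar> < real k0"
        using reals_Archimedean2 by blast
      have "\<forall>\<^sub>F k in sequentially. ennreal (norm (t k s - g s) powr p) = 0"
        using eventually_ge_at_top[of k0]
      proof eventually_elim
        case (elim k)
        then have "t k s = g s" using k0 s by (auto simp: t_def)
        then show ?case by simp
      qed
      then show "(\<lambda>k. ennreal (norm (t k s - g s) powr p)) \<longlonglongrightarrow> 0"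
        by (rule tendsto_eventually)
    qed
    show "(\<integral>\<^sup>+s. ennreal (norm (g s) powr p) \<partial>half_line) < \<infinity>"
      using fin by (simp add: moment_def)
  qed auto
  then have t_lim: "(\<lambda>k. moment p half_line (\<lambda>s. t k s - g s)) \<longlonglongrightarrow> 0"
    by (simp add: moment_def)
  have "\<exists>G\<in>test_half_line. moment p half_line (\<lambda>s. G s - t k s) < ennreal (1 / real (Suc k))" for k
  proof -
    obtain G where G: "\<And>j. G j \<in> test_half_line" "(\<lambda>j. moment p half_line (\<lambda>s. G j s - t k s)) \<longlonglongrightarrow> 0"
      by (rule test_half_line_approx_bounded[of "t k" "real k" "real (Suc k)" p]) (use p in \<open>auto simp: t_def\<close>)
    have "\<forall>\<^sub>F j in sequentially. moment p half_line (\<lambda>s. G j s - t k s) < ennreal (1 / real (Suc k))"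
      using G(2) by (rule order_tendstoD) simp
    then show ?thesis
      using G(1) eventually_happens by fastforce
  qed
  then obtain G where G: "\<And>k. G k \<in> test_half_line"
    "\<And>k. moment p half_line (\<lambda>s. G k s - t k s) < ennreal (1 / real (Suc k))"
    by metis
  have [measurable]: "G k \<in> borel_measurable borel" for k
    by (rule test_half_line_borel[OF G(1)])
  have "(\<lambda>k. moment p half_line (\<lambda>s. G k s - t k s)) \<longlonglongrightarrow> 0"
  proof (rule tendsto_sandwich[OF _ _ tendsto_const])
    show "(\<lambda>k. ennreal (1 / real (Suc k))) \<longlonglongrightarrow> 0"
      using tendsto_ennrealI[OF LIMSEQ_inverse_real_of_nat] by (simp add: inverse_eq_divide)
    show "\<forall>\<^sub>F k in sequentially. moment p half_line (\<lambda>s. G k s - t k s) \<le> ennreal (1 / real (Suc k))"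
      using G(2) by (simp add: less_imp_le)
  qed simp
  from moment_triangle_tendsto_0[OF _ _ p this t_lim]
  have "(\<lambda>k. moment p half_line (\<lambda>s. G k s - g s)) \<longlonglongrightarrow> 0"
    by simp
  with G(1) show ?thesis by (rule that)
qed

section \<open>Primitives, and Bliss' inequality for general data\<close>

definition primitive :: "(real \<Rightarrow> real) \<Rightarrow> real \<Rightarrow> real" where
  "primitive g s = (LINT t:{0<..s}|lborel. g t)"

lemma moment_restrict_le_half_line:
  assumes [measurable]: "g \<in> borel_measurable borel"
  shows "moment p (restrict_space lborel {0<..s}) g \<le> moment p half_line g"
  unfolding moment_def nn_integral_half_line
  by (subst nn_integral_restrict_space) (auto intro!: nn_integral_mono simp: indicator_def)

text \<open>If \<open>g\<close> is not integrable on the interval, \<open>primitive\<close> takes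
  the default value 0 of the Lebesgue integral and the bound is trivial.\<close>

lemma abs_primitive_le:
  "ennreal \<bar>primitive g s\<bar> \<le> (\<integral>\<^sup>+t\<in>{0<..s}. ennreal \<bar>g t\<bar> \<partial>lborel)"
proof (cases "set_integrable lborel {0<..s} g")
  case True
  have "ennreal (norm (primitive g s)) \<le> (\<integral>\<^sup>+t. ennreal (norm (indicator {0<..s} t *\<^sub>R g t)) \<partial>lborel)"
    unfolding primitive_def set_lebesgue_integral_def
    by (rule integral_norm_bound_ennreal) (use True in \<open>simp add: set_integrable_def\<close>)
  also have "\<dots> = (\<integral>\<^sup>+t\<in>{0<..s}. ennreal \<bar>g t\<bar> \<partial>lborel)"
    by (intro nn_integral_cong) (auto simp: indicator_def)
  finally show ?thesis by simp
next
  case False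
  then have "primitive g s = 0"
    by (simp add: primitive_def set_lebesgue_integral_def set_integrable_def not_integrable_integral_eq)
  then show ?thesis by simp
qed

text \<open>Small multiples of \<open>exp (- s)\<close> are added below to make approximations
  strictly positive; this bound makes their contribution vanish in the limit.\<close>

lemma moment_half_line_exp_finite:
  assumes "1 \<le> p"
  shows "moment p half_line (\<lambda>s. exp (- s)) \<le> 1"
proof -
  have "moment p half_line (\<lambda>s. exp (- s)) \<le> (\<integral>\<^sup>+s. ennreal (exp (- s)) * indicator {0..} s \<partial>lborel)"
    unfolding moment_def nn_integral_half_line
  proof (intro nn_integral_mono)
    fix s :: real
    have "exp (- s) powr p \<le> exp (- s)" if "0 < s"
      using powr_le_one_le[of "exp (- s)" p] that assms by simp
    then show "ennreal (norm (exp (- s)) powr p) * indicator {0<..} s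
        \<le> ennreal (exp (- s)) * indicator {0..} s"
      by (auto simp: indicator_def intro: ennreal_leI)
  qed
  also have "\<dots> = ennreal (0 - (- exp (- 0)))"
  proof (rule nn_integral_FTC_atLeast)
    show "((\<lambda>s. - exp (- s)) \<longlongrightarrow> 0) (at_top :: real filter)"
      by real_asymp
  qed (auto intro!: derivative_eq_intros)
  finally show ?thesis by simp
qed

lemma moment_cmult:
  assumes [measurable]: "f \<in> borel_measurable M"
  shows "moment p M (\<lambda>x. c * f x :: real) = ennreal (\<bar>c\<bar> powr p) * moment p M f"
  unfolding moment_def
  by (simp add: abs_mult powr_mult ennreal_mult nn_integral_cmult)

text \<open>Fix \<open>t\<close> so small that \<open>(1 - t) powr (1 - p) * E\<close> is below
  \<open>E + \<delta> / 2\<close>. The difference term, despite its large coefficient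
  \<open>t powr (1 - p)\<close>, still tends to 0.\<close>

lemma eventually_moment_le:
  fixes f :: "nat \<Rightarrow> 'a \<Rightarrow> 'b :: {second_countable_topology, real_normed_vector}"
  assumes [measurable]: "\<And>k. f k \<in> borel_measurable M" "g \<in> borel_measurable M"
    and p: "1 \<le> p" and E: "moment p M g \<le> ennreal E" "0 \<le> E" and d: "0 < \<delta>"
    and lim: "(\<lambda>k. moment p M (\<lambda>x. f k x - g x)) \<longlonglongrightarrow> 0"
  shows "\<forall>\<^sub>F k in sequentially. moment p M (f k) \<le> ennreal (E + \<delta>)"
proof -
  have "((\<lambda>t. (1 - t) powr (1 - p) * E) \<longlongrightarrow> (1 - 0) powr (1 - p) * E) (at_right 0)"
    by (intro tendsto_intros) auto
  then have "\<forall>\<^sub>F t in at_right 0. (1 - t) powr (1 - p) * E < E + \<delta> / 2"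
    using d by (intro order_tendstoD) auto
  moreover have "\<forall>\<^sub>F t in at_right (0::real). t \<in> {0<..<1}"
    by (intro eventually_at_rightI) auto
  ultimately have "\<forall>\<^sub>F t in at_right 0. (1 - t) powr (1 - p) * E < E + \<delta> / 2 \<and> t \<in> {0<..<1}"
    by (rule eventually_conj)
  from eventually_happens[OF this] obtain t where t: "(1 - t) powr (1 - p) * E < E + \<delta> / 2" "0 < t" "t < 1"
    by auto
  have "(\<lambda>k. ennreal (t powr (1 - p)) * moment p M (\<lambda>x. f k x - g x)) \<longlonglongrightarrow> ennreal (t powr (1 - p)) * 0"
    by (intro ennreal_tendsto_cmult lim) auto
  then have "\<forall>\<^sub>F k in sequentially. ennreal (t powr (1 - p)) * moment p M (\<lambda>x. f k x - g x) < ennreal (\<delta> / 2)"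
    using d by (intro order_tendstoD) auto
  then show ?thesis
  proof eventually_elim
    case (elim k)
    have "moment p M (\<lambda>x. g x + (f k x - g x))
       \<le> ennreal ((1 - t) powr (1 - p)) * moment p M g + ennreal (t powr (1 - p)) * moment p M (\<lambda>x. f k x - g x)"
      using t p by (intro moment_add) auto
    also have "\<dots> \<le> ennreal ((1 - t) powr (1 - p)) * ennreal E + ennreal (\<delta> / 2)"
      using less_imp_le[OF elim] E by (intro add_mono mult_left_mono) auto
    also have "\<dots> = ennreal ((1 - t) powr (1 - p) * E + \<delta> / 2)"
      using E d by (simp add: ennreal_mult[symmetric] ennreal_plus[symmetric] del: ennreal_plus)
    also have "\<dots> \<le> ennreal (E + \<delta>)"
      using t by (intro ennreal_leI) auto
    finally show ?case by simp
  qed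
qed

context sobolev_exponents
begin

text \<open>The primitive of \<open>\<bar>g\<bar>\<close> dominates that of \<open>g\<close>, so
  positive profiles suffice. The approximations \<open>h k\<close> are continuous and strictly
  positive, as \<open>Bliss_continuous\<close> demands, and are used on the growing intervals
  \<open>{0..real (Suc k)}\<close>. Fatou's lemma gives the bound with energy
  \<open>E + \<delta>\<close>, and \<open>\<delta>\<close> tends to 0 at the end.\<close>

theorem Bliss:
  assumes g [measurable]: "g \<in> borel_measurable borel"
    and E: "moment p half_line g \<le> ennreal E" "0 \<le> E"
  shows "(\<integral>\<^sup>+s. ennreal (\<bar>primitive g s\<bar> powr q * s powr (- \<gamma>)) \<partial>half_line)
    \<le> ennreal (total_mass * (\<alpha> / n * E / total_mass) powr (q / p))"
proof -
  have p1: "1 \<le> p" using p_gt_1 by simp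
  have npos: "0 < n" using p_gt_1 p_less_n by simp
  have abs_g: "moment p half_line (\<lambda>s. \<bar>g s\<bar>) = moment p half_line g"
    by (simp add: moment_def)
  obtain G where G: "\<And>k. G k \<in> test_half_line"
    and G_lim: "(\<lambda>k. moment p half_line (\<lambda>s. G k s - \<bar>g s\<bar>)) \<longlonglongrightarrow> 0"
  proof (rule test_half_line_approx[of "\<lambda>s. \<bar>g s\<bar>" p])
    show "moment p half_line (\<lambda>s. \<bar>g s\<bar>) < \<infinity>"
      unfolding abs_g using E(1) by (rule le_less_trans) simp
  qed (use p1 in auto)
  have G_smooth: "smooth (G k)" for k using G by (simp add: test_half_line_def)
  have [measurable]: "G k \<in> borel_measurable borel" for k
    by (rule test_half_line_borel[OF G])
  define h where "h k s = \<bar>G k s\<bar> + 1 / real (Suc k) * exp (- s)" for k s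
  have h_cont: "continuous_on A (h k)" for A k
    unfolding h_def[abs_def] by (intro continuous_intros smooth_continuous_on G_smooth)
  have h_pos: "0 < h k s" for k s
    by (simp add: h_def add_nonneg_pos)
  have [measurable]: "h k \<in> borel_measurable borel" for k
    unfolding h_def[abs_def] by measurable
  have h_lim: "(\<lambda>k. moment p half_line (\<lambda>s. h k s - \<bar>g s\<bar>)) \<longlonglongrightarrow> 0"
  proof -
    have 1: "(\<lambda>k. moment p half_line (\<lambda>s. \<bar>G k s\<bar> - \<bar>g s\<bar>)) \<longlonglongrightarrow> 0"
    proof (rule tendsto_sandwich[OF _ _ tendsto_const G_lim])
      show "\<forall>\<^sub>F k in sequentially. moment p half_line (\<lambda>s. \<bar>G k s\<bar> - \<bar>g s\<bar>)
          \<le> moment p half_line (\<lambda>s. G k s - \<bar>g s\<bar>)"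
        using p1 by (intro always_eventually allI moment_mono_AE AE_I2) auto
    qed simp
    have 2: "(\<lambda>k. moment p half_line (\<lambda>s. 1 / real (Suc k) * exp (- s))) \<longlonglongrightarrow> 0"
    proof (rule tendsto_sandwich[OF _ _ tendsto_const])
      have "(\<lambda>k. 1 / real (Suc k)) \<longlonglongrightarrow> 0"
        using LIMSEQ_inverse_real_of_nat by (simp add: inverse_eq_divide)
      from tendsto_powr'[OF this tendsto_const[of p]]
      have "(\<lambda>k. (1 / real (Suc k)) powr p) \<longlonglongrightarrow> 0"
        using p1 by simp
      then show "(\<lambda>k. ennreal ((1 / real (Suc k)) powr p)) \<longlonglongrightarrow> 0"
        using tendsto_ennrealI by fastforce
      have "moment p half_line (\<lambda>s. 1 / real (Suc k) * exp (- s)) \<le> ennreal ((1 / real (Suc k)) powr p)" for k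
      proof -
        have "moment p half_line (\<lambda>s. 1 / real (Suc k) * exp (- s))
            = ennreal (\<bar>1 / real (Suc k)\<bar> powr p) * moment p half_line (\<lambda>s. exp (- s))"
          by (rule moment_cmult) simp
        also have "\<dots> \<le> ennreal (\<bar>1 / real (Suc k)\<bar> powr p) * 1"
          by (intro mult_left_mono moment_half_line_exp_finite p1) simp
        finally show ?thesis by simp
      qed
      then show "\<forall>\<^sub>F k in sequentially. moment p half_line (\<lambda>s. 1 / real (Suc k) * exp (- s))
          \<le> ennreal ((1 / real (Suc k)) powr p)"
        by (intro always_eventually allI)
    qed simp
    have "(\<lambda>k. moment p half_line (\<lambda>s. (\<bar>G k s\<bar> - \<bar>g s\<bar>) + 1 / real (Suc k) * exp (- s))) \<longlonglongrightarrow> 0"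
      by (rule moment_triangle_tendsto_0[OF _ _ p1 1 2]) auto
    then show ?thesis
      by (simp add: h_def add_diff_eq diff_add_eq)
  qed
  define f where "f k s = integral {0..s} (h k)" for k s
  have f_nn: "ennreal (f k s) = (\<integral>\<^sup>+t\<in>{0..s}. ennreal (h k t) \<partial>lborel)" for k s
    unfolding f_def using h_cont h_pos
    by (intro set_nn_integral_continuous[symmetric]) (auto intro: less_imp_le)
  have f_nonneg: "0 \<le> f k s" for k s
    unfolding f_def using h_pos by (intro integral_nonneg integrable_continuous_real h_cont) (auto intro: less_imp_le)
  \<comment> \<open>Convergence in the p-th moment implies L^1 convergence of \<open>h k\<close> to
    \<open>\<bar>g\<bar>\<close> on the bounded interval \<open>{0<..s}\<close>, so
    \<open>\<bar>primitive g s\<bar>\<close> exceeds \<open>f k s\<close> by at most an error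
    tending to 0.\<close>
  have pointwise: "ennreal (\<bar>primitive g s\<bar> powr q * s powr (- \<gamma>))
      \<le> liminf (\<lambda>k. ennreal (f k s powr q * s powr (- \<gamma>)) * indicator {0..real (Suc k)} s)"
    if s: "0 < s" for s
  proof -
    define M where "M = restrict_space lborel {0<..s}"
    define r where "r k = (\<integral>\<^sup>+t. ennreal (norm (h k t - \<bar>g t\<bar>)) \<partial>M)" for k
    have r_lim: "r \<longlonglongrightarrow> 0"
      unfolding r_def
    proof (rule moment_tendsto_imp_nn_integral_tendsto[OF _ _ p_gt_1])
      show "emeasure M (space M) < \<infinity>"
        using s by (simp add: M_def space_restrict_space emeasure_restrict_space)
      show "(\<lambda>t. h k t - \<bar>g t\<bar>) \<in> borel_measurable M" for k
        unfolding M_def by (intro measurable_restrict_space1) measurable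
      show "(\<lambda>k. moment p M (\<lambda>t. h k t - \<bar>g t\<bar>)) \<longlonglongrightarrow> 0"
        by (rule tendsto_sandwich[OF _ _ tendsto_const h_lim])
           (auto simp: M_def intro!: always_eventually moment_restrict_le_half_line)
    qed
    have le: "ennreal \<bar>primitive g s\<bar> \<le> ennreal (f k s) + r k" for k
    proof -
      have "ennreal \<bar>primitive g s\<bar> \<le> (\<integral>\<^sup>+t\<in>{0<..s}. ennreal \<bar>g t\<bar> \<partial>lborel)"
        by (rule abs_primitive_le)
      also have "\<dots> \<le> (\<integral>\<^sup>+t. ennreal (h k t) * indicator {0..s} t
          + ennreal (norm (h k t - \<bar>g t\<bar>)) * indicator {0<..s} t \<partial>lborel)"
        using h_pos[THEN less_imp_le]
        by (intro nn_integral_mono)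
           (auto simp: indicator_def ennreal_plus[symmetric] simp del: ennreal_plus intro!: ennreal_leI)
      also have "\<dots> = ennreal (f k s) + r k"
        unfolding f_nn r_def M_def
        by (subst nn_integral_add) (auto simp: nn_integral_restrict_space)
      finally show ?thesis .
    qed
    define \<rho> where "\<rho> k = enn2real (r k)" for k
    have \<rho>: "\<rho> \<longlonglongrightarrow> 0"
      unfolding \<rho>_def using tendsto_enn2real[of r 0] r_lim by (simp add: zero_ennreal_def[symmetric])
    have fin: "\<forall>\<^sub>F k in sequentially. r k < top"
      using r_lim by (rule order_tendstoD) simp
    have "(\<lambda>k. max 0 (\<bar>primitive g s\<bar> - \<rho> k) powr q * s powr (- \<gamma>))
        \<longlonglongrightarrow> max 0 (\<bar>primitive g s\<bar> - 0) powr q * s powr (- \<gamma>)"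
      using q_pos by (intro tendsto_intros \<rho> tendsto_powr') auto
    then have "(\<lambda>k. ennreal (max 0 (\<bar>primitive g s\<bar> - \<rho> k) powr q * s powr (- \<gamma>)))
        \<longlonglongrightarrow> ennreal (\<bar>primitive g s\<bar> powr q * s powr (- \<gamma>))"
      by (intro tendsto_ennrealI) simp
    then have "ennreal (\<bar>primitive g s\<bar> powr q * s powr (- \<gamma>)) =
        liminf (\<lambda>k. ennreal (max 0 (\<bar>primitive g s\<bar> - \<rho> k) powr q * s powr (- \<gamma>)))"
      by (intro lim_imp_Liminf[symmetric]) auto
    also have "\<dots> \<le> liminf (\<lambda>k. ennreal (f k s powr q * s powr (- \<gamma>)) * indicator {0..real (Suc k)} s)"
    proof (rule Liminf_mono)
      obtain k0 :: nat where k0: "s < real k0"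
        using reals_Archimedean2 by blast
      show "\<forall>\<^sub>F k in sequentially. ennreal (max 0 (\<bar>primitive g s\<bar> - \<rho> k) powr q * s powr (- \<gamma>))
          \<le> ennreal (f k s powr q * s powr (- \<gamma>)) * indicator {0..real (Suc k)} s"
        using fin eventually_ge_at_top[of k0]
      proof eventually_elim
        case (elim k)
        then have "r k = ennreal (\<rho> k)" by (simp add: \<rho>_def)
        then have "ennreal \<bar>primitive g s\<bar> \<le> ennreal (f k s + \<rho> k)"
          using le[of k] f_nonneg by (simp add: \<rho>_def)
        then have "\<bar>primitive g s\<bar> \<le> f k s + \<rho> k"
          using f_nonneg[of k s] by (subst (asm) ennreal_le_iff) (auto simp: \<rho>_def)
        then have "max 0 (\<bar>primitive g s\<bar> - \<rho> k) powr q \<le> f k s powr q"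
          using f_nonneg[of k s] q_pos by (intro powr_mono2) auto
        moreover have "s \<in> {0..real (Suc k)}" using elim k0 s by simp
        ultimately show ?case
          by (simp add: ennreal_leI mult_right_mono)
      qed
    qed
    finally show ?thesis .
  qed
  have bound: "(\<integral>\<^sup>+s. ennreal (\<bar>primitive g s\<bar> powr q * s powr (- \<gamma>)) \<partial>half_line)
      \<le> ennreal (total_mass * (\<alpha> / n * (E + \<delta>) / total_mass) powr (q / p))" if \<delta>: "0 < \<delta>" for \<delta>
  proof -
    have [measurable]: "f k \<in> borel_measurable borel" for k
    proof -
      have "mono (f k)"
      proof (rule monoI)
        fix s t :: real assume "s \<le> t"
        then have "ennreal (f k s) \<le> ennreal (f k t)"
          unfolding f_nn by (intro nn_integral_mono) (auto simp: indicator_def)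
        then show "f k s \<le> f k t"
          using f_nonneg by simp
      qed
      then show ?thesis by (rule borel_measurable_mono)
    qed
    have "(\<integral>\<^sup>+s. ennreal (\<bar>primitive g s\<bar> powr q * s powr (- \<gamma>)) \<partial>half_line)
       \<le> (\<integral>\<^sup>+s. liminf (\<lambda>k. ennreal (f k s powr q * s powr (- \<gamma>)) * indicator {0..real (Suc k)} s) \<partial>half_line)"
      using pointwise by (intro nn_integral_mono) auto
    also have "\<dots> \<le> liminf (\<lambda>k. \<integral>\<^sup>+s. ennreal (f k s powr q * s powr (- \<gamma>)) * indicator {0..real (Suc k)} s \<partial>half_line)"
      by (intro nn_integral_liminf) auto
    also have "\<dots> \<le> limsup (\<lambda>k. \<integral>\<^sup>+s. ennreal (f k s powr q * s powr (- \<gamma>)) * indicator {0..real (Suc k)} s \<partial>half_line)"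
      by (rule Liminf_le_Limsup) simp
    also have "\<dots> \<le> ennreal (total_mass * (\<alpha> / n * (E + \<delta>) / total_mass) powr (q / p))"
    proof (rule Limsup_bounded)
      have "\<forall>\<^sub>F k in sequentially. moment p half_line (h k) \<le> ennreal (E + \<delta>)"
        by (rule eventually_moment_le[OF _ _ p1 _ E(2) \<delta> h_lim]) (auto simp: abs_g E)
      then show "\<forall>\<^sub>F k in sequentially.
          (\<integral>\<^sup>+s. ennreal (f k s powr q * s powr (- \<gamma>)) * indicator {0..real (Suc k)} s \<partial>half_line)
          \<le> ennreal (total_mass * (\<alpha> / n * (E + \<delta>) / total_mass) powr (q / p))"
      proof eventually_elim
        case (elim k)
        let ?b = "real (Suc k)"
        have hp_cont: "continuous_on {0..?b} (\<lambda>s. h k s powr p)"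
          using h_pos by (intro continuous_intros h_cont) (auto simp: less_imp_neq[symmetric])
        have "ennreal (integral {0..?b} (\<lambda>s. h k s powr p))
            = (\<integral>\<^sup>+s\<in>{0..?b}. ennreal (h k s powr p) \<partial>lborel)"
          by (intro set_nn_integral_continuous[symmetric] hp_cont) auto
        also have "\<dots> \<le> moment p half_line (h k)"
          unfolding moment_def nn_integral_half_line using h_pos[THEN less_imp_le]
          by (intro nn_integral_mono_AE, use AE_lborel_singleton[of 0] in eventually_elim)
             (auto simp: indicator_def)
        finally have "integral {0..?b} (\<lambda>s. h k s powr p) \<le> E + \<delta>"
          using elim E(2) \<delta> by (meson add_nonneg_pos ennreal_le_iff less_imp_le order_trans)
        moreover have "0 \<le> integral {0..?b} (\<lambda>s. h k s powr p)"
          by (intro integral_nonneg integrable_continuous_real hp_cont) auto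
        ultimately have "(\<alpha> / n * integral {0..?b} (\<lambda>s. h k s powr p) / total_mass) powr (q / p)
            \<le> (\<alpha> / n * (E + \<delta>) / total_mass) powr (q / p)"
          using alpha_pos npos total_mass_pos q_pos p1
          by (intro powr_mono2 divide_right_mono mult_left_mono) auto
        then have "total_mass * (\<alpha> / n * integral {0..?b} (\<lambda>s. h k s powr p) / total_mass) powr (q / p)
            \<le> total_mass * (\<alpha> / n * (E + \<delta>) / total_mass) powr (q / p)"
          using total_mass_pos by (intro mult_left_mono) auto
        note bl = order_trans[OF Bliss_continuous(2)[OF h_cont h_pos, of ?b k, folded f_def] this]
        have "(\<integral>\<^sup>+s. ennreal (f k s powr q * s powr (- \<gamma>)) * indicator {0..?b} s \<partial>half_line)
           \<le> (\<integral>\<^sup>+s\<in>{0..?b}. ennreal (f k s powr q * s powr (- \<gamma>)) \<partial>lborel)"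
          unfolding nn_integral_half_line by (intro nn_integral_mono) (auto simp: indicator_def)
        also have "\<dots> = ennreal (integral {0..?b} (\<lambda>s. f k s powr q * s powr (- \<gamma>)))"
          using Bliss_continuous(1)[OF h_cont h_pos, of ?b k, folded f_def]
          by (intro set_nn_integral_continuous) auto
        also have "\<dots> \<le> ennreal (total_mass * (\<alpha> / n * (E + \<delta>) / total_mass) powr (q / p))"
          using bl by (intro ennreal_leI) simp
        finally show ?case .
      qed
    qed
    finally show ?thesis .
  qed
  have "((\<lambda>\<delta>. total_mass * (\<alpha> / n * (E + \<delta>) / total_mass) powr (q / p))
      \<longlongrightarrow> total_mass * (\<alpha> / n * (E + 0) / total_mass) powr (q / p)) (at_right 0)"
    using total_mass_pos alpha_pos npos q_pos p1 E(2)
    by (intro tendsto_intros tendsto_powr') (auto intro!: eventually_at_rightI[of 0 1])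
  then have "((\<lambda>\<delta>. ennreal (total_mass * (\<alpha> / n * (E + \<delta>) / total_mass) powr (q / p)))
      \<longlongrightarrow> ennreal (total_mass * (\<alpha> / n * E / total_mass) powr (q / p))) (at_right 0)"
    by (intro tendsto_ennrealI) simp
  then show ?thesis
    by (rule tendsto_lowerbound) (use bound in \<open>auto intro!: eventually_at_rightI[of 0 1]\<close>)
qed

end

section \<open>Weak gradients\<close>

lemma frechet_derivative_eq_0_outside:
  assumes "closed K" "\<And>x. x \<notin> K \<Longrightarrow> \<phi> x = 0" "x \<notin> K"
  shows "frechet_derivative \<phi> (at x) = (\<lambda>_. 0)"
proof -
  have "(\<phi> has_derivative (\<lambda>_. 0)) (at x)"
    by (rule has_derivative_transform_within_open[where f = "\<lambda>_. 0" and s = "- K"])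
       (use assms in \<open>auto simp: open_Compl\<close>)
  then show ?thesis by (metis frechet_derivative_at)
qed

lemma smooth_line_derivative:
  fixes \<phi> :: "'a::euclidean_space \<Rightarrow> real"
  assumes "smooth \<phi>"
  shows "((\<lambda>t. \<phi> (x + t *\<^sub>R v)) has_real_derivative frechet_derivative \<phi> (at (x + t *\<^sub>R v)) v) (at t)"
proof -
  have "((\<lambda>t. x + t *\<^sub>R v) has_derivative (\<lambda>h. h *\<^sub>R v)) (at t)"
    by (auto intro!: derivative_eq_intros)
  then have "((\<lambda>t. \<phi> (x + t *\<^sub>R v)) has_derivative
      (\<lambda>h. frechet_derivative \<phi> (at (x + t *\<^sub>R v)) (h *\<^sub>R v))) (at t)"
    by (rule has_derivative_compose) (rule smooth_has_derivative[OF assms])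
  moreover have "linear (frechet_derivative \<phi> (at (x + t *\<^sub>R v)))"
    using smooth_has_derivative[OF assms] has_derivative_linear by blast
  ultimately show ?thesis
    by (simp add: has_field_derivative_def linear_scale mult_commute_abs)
qed

text \<open>Translation invariance of Lebesgue measure makes the integral of every difference
  quotient vanish. The mean value theorem dominates the quotients by a constant on a ball, so the
  integral of the derivative vanishes too.\<close>

lemma integral_derivative_compact_support:
  fixes \<phi> :: "'a::euclidean_space \<Rightarrow> real"
  assumes \<phi>: "smooth \<phi>" and K: "compact K" and supp: "\<And>x. x \<notin> K \<Longrightarrow> \<phi> x = 0"
  shows "integrable lborel (\<lambda>x. frechet_derivative \<phi> (at x) v)" (is ?int)
    and "(LINT x|lborel. frechet_derivative \<phi> (at x) v) = 0" (is ?eq)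
proof -
  define D where "D x = frechet_derivative \<phi> (at x) v" for x
  have D_cont: "continuous_on A D" for A
    unfolding D_def[abs_def] by (intro smooth_continuous_on smooth_frechet_derivative \<phi>)
  have D_supp: "D x = 0" if "x \<notin> K" for x
    using frechet_derivative_eq_0_outside[OF compact_imp_closed[OF K] supp that] by (simp add: D_def)
  obtain C where C: "\<And>x. \<bar>D x\<bar> \<le> C" "0 \<le> C"
  proof -
    have "bounded (D ` K)"
      using D_cont K by (intro compact_imp_bounded compact_continuous_image)
    then obtain C where C: "\<And>x. x \<in> K \<Longrightarrow> \<bar>D x\<bar> \<le> C"
      by (auto simp: bounded_iff)
    have "\<bar>D x\<bar> \<le> max C 0" for x
      using C[of x] D_supp[of x] by (cases "x \<in> K") auto
    then show ?thesis by (rule that) simp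
  qed
  obtain r where r: "\<And>x. x \<in> K \<Longrightarrow> norm x \<le> r"
    using compact_imp_bounded[OF K] by (auto simp: bounded_iff)
  \<comment> \<open>A quotient at \<open>x\<close> equals the derivative at a point within
    \<open>norm v\<close> of \<open>x\<close>, so it vanishes outside the ball enlarged by
    \<open>norm v\<close>.\<close>
  define W where "W x = C * indicator (cball 0 (r + norm v)) x" for x :: 'a
  have [measurable]: "\<phi> \<in> borel_measurable borel" "D \<in> borel_measurable borel"
    using smooth_continuous_on[OF \<phi>] D_cont by (auto intro: borel_measurable_continuous_onI)
  define Q where "Q k x = real (Suc k) * (\<phi> (x + (1 / real (Suc k)) *\<^sub>R v) - \<phi> x)" for k x
  have Q_MVT: "\<exists>t. 0 < t \<and> t < 1 \<and> Q k x = D (x + t *\<^sub>R v)" for k x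
  proof -
    have "\<exists>z::real. z > 0 \<and> z < 1 / real (Suc k) \<and>
        \<phi> (x + (1 / real (Suc k)) *\<^sub>R v) - \<phi> (x + 0 *\<^sub>R v) = (1 / real (Suc k) - 0) * D (x + z *\<^sub>R v)"
      unfolding D_def by (intro MVT2[of 0 _ "\<lambda>t. \<phi> (x + t *\<^sub>R v)"] smooth_line_derivative \<phi>) simp
    then obtain z where z: "0 < z" "z < 1 / real (Suc k)"
      "\<phi> (x + (1 / real (Suc k)) *\<^sub>R v) - \<phi> x = 1 / real (Suc k) * D (x + z *\<^sub>R v)"
      by auto
    have "1 / real (Suc k) \<le> 1" by simp
    with z(2) have "z < 1" by linarith
    with z show ?thesis by (intro exI[of _ z]) (simp add: Q_def del: of_nat_Suc)
  qed
  have Q_bound: "norm (Q k x) \<le> W x" for k x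
  proof (cases "norm x \<le> r + norm v")
    case True
    then show ?thesis using Q_MVT[of k x] C by (auto simp: W_def)
  next
    case False
    obtain t where t: "0 < t" "t < 1" "Q k x = D (x + t *\<^sub>R v)"
      using Q_MVT by blast
    have "norm x \<le> norm (x + t *\<^sub>R v) + t * norm v"
      using norm_triangle_ineq4[of "x + t *\<^sub>R v" "t *\<^sub>R v"] t by simp
    moreover have "t * norm v \<le> norm v"
      using t by (simp add: mult_left_le_one_le)
    ultimately have "x + t *\<^sub>R v \<notin> K"
      using r[of "x + t *\<^sub>R v"] False by auto
    then show ?thesis using t D_supp C(2) by (simp add: W_def)
  qed
  have W_int: "integrable lborel W"
    unfolding W_def[abs_def]
    by (intro integrable_mult_right integrable_real_indicator) (auto intro: emeasure_bounded_finite[unfolded infinity_ennreal_def])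
  have Q_lim: "(\<lambda>k. Q k x) \<longlonglongrightarrow> D x" for x
  proof -
    have "((\<lambda>h. (\<phi> (x + (0 + h) *\<^sub>R v) - \<phi> (x + 0 *\<^sub>R v)) / h) \<longlongrightarrow> D x) (at 0)"
      using smooth_line_derivative[OF \<phi>, of x v 0] unfolding DERIV_def D_def by simp
    moreover have "filterlim (\<lambda>k. 1 / real (Suc k)) (at 0) sequentially"
      using LIMSEQ_inverse_real_of_nat by (simp add: filterlim_at inverse_eq_divide)
    ultimately have "(\<lambda>k. (\<phi> (x + (0 + 1 / real (Suc k)) *\<^sub>R v) - \<phi> (x + 0 *\<^sub>R v)) / (1 / real (Suc k))) \<longlonglongrightarrow> D x"
      by (rule filterlim_compose)
    then show ?thesis by (simp add: Q_def mult.commute)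
  qed
  have [measurable]: "Q k \<in> borel_measurable borel" for k
    unfolding Q_def[abs_def] by measurable
  have dom: "integrable lborel D" "(\<lambda>k. LINT x|lborel. Q k x) \<longlonglongrightarrow> (LINT x|lborel. D x)"
    by (rule integrable_dominated_convergence[where w = W and s = Q]
        integral_dominated_convergence[where w = W]; use Q_lim Q_bound W_int in simp)+
  have \<phi>_int: "integrable lborel \<phi>"
  proof -
    have "integrable lborel (\<lambda>x. indicator K x *\<^sub>R \<phi> x)"
      using borel_integrable_compact[OF K smooth_continuous_on[OF \<phi>]] .
    moreover have "(\<lambda>x. indicator K x *\<^sub>R \<phi> x) = \<phi>"
      using supp by (auto simp: fun_eq_iff indicator_def)
    ultimately show ?thesis by simp
  qed
  have shift: "integrable lborel (\<lambda>x. \<phi> (x + c))" "(LINT x|lborel. \<phi> (x + c)) = (LINT x|lborel. \<phi> x)" for c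
  proof -
    have "integrable (distr lborel borel ((+) c)) \<phi>"
      using \<phi>_int by (simp add: lborel_distr_plus)
    then show "integrable lborel (\<lambda>x. \<phi> (x + c))"
      by (subst (asm) integrable_distr_eq) (auto simp: add.commute)
    have "(LINT x|distr lborel borel ((+) c). \<phi> x) = (LINT x|lborel. \<phi> (c + x))"
      by (rule integral_distr) auto
    then show "(LINT x|lborel. \<phi> (x + c)) = (LINT x|lborel. \<phi> x)"
      by (simp add: lborel_distr_plus add.commute)
  qed
  have "(LINT x|lborel. Q k x) = 0" for k
    unfolding Q_def using shift \<phi>_int by (simp del: of_nat_Suc)
  with dom have "(\<lambda>k. 0) \<longlonglongrightarrow> (LINT x|lborel. D x)" by simp
  then have "(LINT x|lborel. D x) = 0"
    using LIMSEQ_unique tendsto_const by blast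
  with dom(1) show ?int ?eq by (auto simp: D_def[abs_def])
qed

section \<open>Test functions and classical gradients\<close>

lemma test_functions_iff:
  "\<phi> \<in> test_functions \<Omega> \<longleftrightarrow> smooth \<phi> \<and> compact (closure {x. \<phi> x \<noteq> 0}) \<and> closure {x. \<phi> x \<noteq> 0} \<subseteq> \<Omega>"
  by (simp add: test_functions_def smooth_def Ck_eq_smooth_upto)

lemma test_functionsI:
  assumes "smooth \<phi>" "compact K" "K \<subseteq> \<Omega>" "\<And>x. x \<notin> K \<Longrightarrow> \<phi> x = 0"
  shows "\<phi> \<in> test_functions \<Omega>"
proof -
  have "closure {x. \<phi> x \<noteq> 0} \<subseteq> K"
    using assms by (intro closure_minimal compact_imp_closed) auto
  moreover from this have "compact (closure {x. \<phi> x \<noteq> 0})"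
    using assms(2) compact_Int_closed[of K "closure {x. \<phi> x \<noteq> 0}"] by (simp add: Int_absorb1)
  ultimately show ?thesis using assms by (auto simp: test_functions_iff)
qed

lemma test_functionsE:
  assumes "\<phi> \<in> test_functions \<Omega>"
  obtains K where "smooth \<phi>" "compact K" "K \<subseteq> \<Omega>" "\<And>x. x \<notin> K \<Longrightarrow> \<phi> x = 0"
  using assms closure_subset[of "{x. \<phi> x \<noteq> 0}"]
  by (intro that[of "closure {x. \<phi> x \<noteq> 0}"]) (auto simp: test_functions_iff)

definition gradient :: "(real^'n \<Rightarrow> real) \<Rightarrow> real^'n \<Rightarrow> real^'n" where
  "gradient \<phi> x = (\<chi> i. frechet_derivative \<phi> (at x) (axis i 1))"

lemma gradient_inner:
  fixes \<phi> :: "real^'n \<Rightarrow> real"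
  assumes "smooth \<phi>"
  shows "gradient \<phi> x \<bullet> v = frechet_derivative \<phi> (at x) v"
proof -
  have lin: "linear (frechet_derivative \<phi> (at x))"
    using smooth_has_derivative[OF assms] has_derivative_linear by blast
  have "v = (\<Sum>i\<in>UNIV. (v $ i) *\<^sub>R axis i 1)"
    using basis_expansion[of v] by (simp add: scalar_mult_eq_scaleR)
  then have "frechet_derivative \<phi> (at x) v = frechet_derivative \<phi> (at x) (\<Sum>i\<in>UNIV. (v $ i) *\<^sub>R axis i 1)"
    by simp
  also have "\<dots> = (\<Sum>i\<in>UNIV. v $ i * frechet_derivative \<phi> (at x) (axis i 1))"
    using lin by (simp add: linear_sum linear_scale)
  finally show ?thesis
    by (simp add: gradient_def inner_vec_def mult.commute)
qed

lemma gradient_continuous_on: "smooth \<phi> \<Longrightarrow> continuous_on A (gradient \<phi>)"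
  unfolding gradient_def[abs_def]
  by (intro continuous_on_vec_lambda smooth_continuous_on smooth_frechet_derivative)

lemma borel_imp_lebesgue_on: "f \<in> borel_measurable borel \<Longrightarrow> f \<in> borel_measurable (lebesgue_on S)"
  by (intro measurable_restrict_space1 measurable_completion) simp

lemma integral_lebesgue_on_supported:
  fixes f :: "'a::euclidean_space \<Rightarrow> real"
  assumes [measurable]: "f \<in> borel_measurable borel" and "S \<in> sets lebesgue" "\<And>x. x \<notin> S \<Longrightarrow> f x = 0"
  shows "(LINT x|lebesgue_on S. f x) = (LINT x|lborel. f x)"
    and "integrable (lebesgue_on S) f \<longleftrightarrow> integrable lborel f"
proof -
  have eq: "(\<lambda>x. indicator S x *\<^sub>R f x) = f"
    using assms(3) by (auto simp: fun_eq_iff indicator_def)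
  show "(LINT x|lebesgue_on S. f x) = (LINT x|lborel. f x)"
    using assms(2) by (simp add: integral_restrict_space eq[simplified] integral_completion)
  show "integrable (lebesgue_on S) f \<longleftrightarrow> integrable lborel f"
    using assms(2) by (simp add: integrable_restrict_space eq[simplified] integrable_completion)
qed

lemma integrable_continuous_compact_support:
  fixes f :: "'a::euclidean_space \<Rightarrow> real"
  assumes "continuous_on UNIV f" "compact K" "\<And>x. x \<notin> K \<Longrightarrow> f x = 0"
  shows "integrable lborel f"
proof -
  have "integrable lborel (\<lambda>x. indicator K x *\<^sub>R f x)"
    using borel_integrable_compact[OF assms(2)] continuous_on_subset[OF assms(1)] by blast
  moreover have "(\<lambda>x. indicator K x *\<^sub>R f x) = f"
    using assms(3) by (auto simp: fun_eq_iff indicator_def)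
  ultimately show ?thesis by simp
qed

lemma continuous_on_compact_imp_integrable:
  fixes f :: "'a::euclidean_space \<Rightarrow> 'b::euclidean_space"
  assumes "compact K" "continuous_on K f"
  shows "integrable (lebesgue_on K) f"
  using borel_integrable_compact[OF assms] borel_compact[OF assms(1)]
  by (simp add: integrable_restrict_space integrable_completion)

text \<open>Integration by parts: the product with a test function has compact support, so the
  integral of its derivative is 0.\<close>

lemma smooth_is_weak_gradient:
  fixes \<phi> :: "real^'n \<Rightarrow> real"
  assumes \<phi>: "smooth \<phi>" and \<Omega>: "\<Omega> \<in> sets lebesgue"
  shows "is_weak_gradient \<Omega> \<phi> (gradient \<phi>)"
  unfolding is_weak_gradient_def locally_integrable_def
proof (intro conjI allI impI ballI)
  fix K :: "(real^'n) set" assume "compact K \<and> K \<subseteq> \<Omega>"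
  then show "integrable (lebesgue_on K) \<phi>" "integrable (lebesgue_on K) (gradient \<phi>)"
    using \<phi> by (auto intro!: continuous_on_compact_imp_integrable smooth_continuous_on gradient_continuous_on)
next
  fix \<psi> :: "real^'n \<Rightarrow> real" and i :: 'n assume "\<psi> \<in> test_functions \<Omega>"
  then obtain K where \<psi>: "smooth \<psi>" "compact K" "K \<subseteq> \<Omega>" "\<And>x. x \<notin> K \<Longrightarrow> \<psi> x = 0"
    by (rule test_functionsE) blast
  let ?e = "axis i (1::real)"
  define A where "A x = \<phi> x * frechet_derivative \<psi> (at x) ?e" for x
  define B where "B x = gradient \<phi> x $ i * \<psi> x" for x
  have A0: "A x = 0" if "x \<notin> K" for x
    using frechet_derivative_eq_0_outside[OF compact_imp_closed[OF \<psi>(2)] \<psi>(4) that] by (simp add: A_def)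
  have B0: "B x = 0" if "x \<notin> K" for x
    using \<psi>(4)[OF that] by (simp add: B_def)
  have A_cont: "continuous_on UNIV A"
    unfolding A_def[abs_def] by (intro continuous_intros smooth_continuous_on smooth_frechet_derivative \<phi> \<psi>(1))
  have B_cont: "continuous_on UNIV B"
    unfolding B_def[abs_def] by (intro continuous_intros gradient_continuous_on smooth_continuous_on \<phi> \<psi>(1))
  have prod: "smooth (\<lambda>x. \<phi> x * \<psi> x)" using \<phi> \<psi>(1) by (rule smooth_mult)
  have "frechet_derivative (\<lambda>x. \<phi> x * \<psi> x) (at x) ?e = A x + B x" for x
  proof -
    have "((\<lambda>x. \<phi> x * \<psi> x) has_derivative
      (\<lambda>v. \<phi> x * frechet_derivative \<psi> (at x) v + frechet_derivative \<phi> (at x) v * \<psi> x)) (at x)"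
      by (intro has_derivative_mult smooth_has_derivative \<phi> \<psi>(1))
    from frechet_derivative_at[OF this, symmetric] show ?thesis
      by (simp add: A_def B_def gradient_def)
  qed
  then have "(LINT x|lborel. A x + B x) = 0"
    using integral_derivative_compact_support(2)[OF prod \<psi>(2), of ?e] \<psi>(4) by simp
  moreover have "integrable lborel A" "integrable lborel B"
    using integrable_continuous_compact_support[OF A_cont \<psi>(2) A0]
      integrable_continuous_compact_support[OF B_cont \<psi>(2) B0] by auto
  ultimately have "(LINT x|lborel. A x) = - (LINT x|lborel. B x)" by simp
  moreover have "(LINT x|lebesgue_on \<Omega>. A x) = (LINT x|lborel. A x)" "(LINT x|lebesgue_on \<Omega>. B x) = (LINT x|lborel. B x)"
    by (intro integral_lebesgue_on_supported borel_measurable_continuous_onI A_cont B_cont \<Omega>;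
        use A0 B0 \<psi>(3) in blast)+
  ultimately show "(LINT x|lebesgue_on \<Omega>. \<phi> x * frechet_derivative \<psi> (at x) ?e)
      = - (LINT x|lebesgue_on \<Omega>. gradient \<phi> x $ i * \<psi> x)"
    by (simp add: A_def B_def)
qed

lemma locally_integrable_mult_test:
  fixes u :: "real^'n \<Rightarrow> 'b::euclidean_space" and \<psi> :: "real^'n \<Rightarrow> real"
  assumes u: "locally_integrable \<Omega> u" and \<Omega>: "\<Omega> \<in> sets lebesgue"
    and \<psi>: "continuous_on UNIV \<psi>" and K: "compact K" "K \<subseteq> \<Omega>" and supp: "\<And>x. x \<notin> K \<Longrightarrow> \<psi> x = 0"
  shows "integrable (lebesgue_on \<Omega>) (\<lambda>x. \<psi> x *\<^sub>R u x)"
proof -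
  have K_leb: "K \<in> sets lebesgue"
    using borel_compact[OF K(1)] by simp
  have int: "integrable lebesgue (\<lambda>x. indicator K x *\<^sub>R u x)"
    using u K K_leb by (auto simp: locally_integrable_def integrable_restrict_space)
  have "bounded (\<psi> ` K)"
    using \<psi> K(1) by (intro compact_imp_bounded compact_continuous_image) (auto intro: continuous_on_subset)
  then obtain C where C: "\<And>x. x \<in> K \<Longrightarrow> \<bar>\<psi> x\<bar> \<le> C"
    by (auto simp: bounded_iff)
  have \<psi>_meas: "\<psi> \<in> borel_measurable lebesgue"
    using \<psi> by (intro measurable_completion) (simp add: borel_measurable_continuous_onI)
  have "integrable lebesgue (\<lambda>x. \<psi> x *\<^sub>R (indicator K x *\<^sub>R u x))"
  proof (rule Bochner_Integration.integrable_bound)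
    show "integrable lebesgue (\<lambda>x. C *\<^sub>R (indicator K x *\<^sub>R u x))"
      using int by (rule integrable_scaleR_right)
    show "(\<lambda>x. \<psi> x *\<^sub>R indicat_real K x *\<^sub>R u x) \<in> borel_measurable lebesgue"
      by (rule borel_measurable_scaleR[OF \<psi>_meas borel_measurable_integrable[OF int]])
    show "AE x in lebesgue. norm (\<psi> x *\<^sub>R indicat_real K x *\<^sub>R u x) \<le> norm (C *\<^sub>R indicat_real K x *\<^sub>R u x)"
      using C by (intro AE_I2) (force simp: indicator_def intro: mult_right_mono)
  qed
  moreover have "\<psi> x *\<^sub>R (indicator K x *\<^sub>R u x) = indicator \<Omega> x *\<^sub>R (\<psi> x *\<^sub>R u x)" for x
    using supp[of x] K(2) by (auto simp: indicator_def)
  ultimately have "integrable lebesgue (\<lambda>x. indicator \<Omega> x *\<^sub>R (\<psi> x *\<^sub>R u x))"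
    by (simp only:)
  then show ?thesis
    using \<Omega> by (simp add: integrable_restrict_space)
qed

section \<open>Linearity, uniqueness and limits of weak gradients\<close>

lemma locally_integrable_component:
  "locally_integrable \<Omega> (g :: real^'n \<Rightarrow> real^'m) \<Longrightarrow> locally_integrable \<Omega> (\<lambda>x. g x $ i)"
  by (auto simp: locally_integrable_def intro!: integrable_bounded_linear[OF bounded_linear_vec_nth])

lemma is_weak_gradient_diff:
  assumes u: "is_weak_gradient \<Omega> u g" and v: "is_weak_gradient \<Omega> v h" and \<Omega>: "\<Omega> \<in> sets lebesgue"
  shows "is_weak_gradient \<Omega> (\<lambda>x. u x - v x) (\<lambda>x. g x - h x)"
  unfolding is_weak_gradient_def
proof (intro conjI ballI allI)
  show "locally_integrable \<Omega> (\<lambda>x. u x - v x)" "locally_integrable \<Omega> (\<lambda>x. g x - h x)"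
    using u v by (auto simp: is_weak_gradient_def locally_integrable_def)
  fix \<psi> :: "real^'a \<Rightarrow> real" and i assume \<psi>: "\<psi> \<in> test_functions \<Omega>"
  then obtain K where K: "smooth \<psi>" "compact K" "K \<subseteq> \<Omega>" "\<And>x. x \<notin> K \<Longrightarrow> \<psi> x = 0"
    by (rule test_functionsE) blast
  define d where "d x = frechet_derivative \<psi> (at x) (axis i 1)" for x
  have d: "continuous_on UNIV d" "\<And>x. x \<notin> K \<Longrightarrow> d x = 0"
    using frechet_derivative_eq_0_outside[OF compact_imp_closed[OF K(2)] K(4)]
    by (auto simp: d_def[abs_def] intro!: smooth_continuous_on smooth_frechet_derivative K)
  have int: "integrable (lebesgue_on \<Omega>) (\<lambda>x. w x * d x)" "integrable (lebesgue_on \<Omega>) (\<lambda>x. k x $ i * \<psi> x)"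
    if "is_weak_gradient \<Omega> w k" for w k
    using locally_integrable_mult_test[OF _ \<Omega> d(1) K(2,3) d(2), of w]
      locally_integrable_mult_test[OF _ \<Omega> smooth_continuous_on[OF K(1)] K(2-4), of "\<lambda>x. k x $ i"] that
    by (auto simp: is_weak_gradient_def locally_integrable_component mult.commute)
  have "(LINT x|lebesgue_on \<Omega>. w x * d x) = - (LINT x|lebesgue_on \<Omega>. k x $ i * \<psi> x)"
    if "is_weak_gradient \<Omega> w k" for w k
    using that \<psi> by (auto simp: is_weak_gradient_def d_def)
  with int u v show "(LINT x|lebesgue_on \<Omega>. (u x - v x) * frechet_derivative \<psi> (at x) (axis i 1)) =
      - (LINT x|lebesgue_on \<Omega>. (g x - h x) $ i * \<psi> x)"
    by (simp add: d_def[symmetric] left_diff_distrib)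
qed

text \<open>The test functions are \<open>c m * Q k\<close>, where the cutoffs \<open>c m\<close>
  exhaust the ball and the polynomials \<open>Q k\<close> tend to the sign of
  \<open>c m * h\<close>. Dominated convergence turns the vanishing integrals into the integral of
  \<open>\<bar>c m * h\<bar>\<close>.\<close>

lemma fundamental_lemma_ball:
  fixes h :: "real^'n \<Rightarrow> real"
  assumes h: "locally_integrable (ball 0 R) h" and R: "0 < R"
    and zero: "\<And>\<psi>. \<psi> \<in> test_functions (ball 0 R) \<Longrightarrow> (LINT x|lebesgue_on (ball 0 R). h x * \<psi> x) = 0"
  shows "AE x in lebesgue_on (ball 0 R). h x = 0"
proof -
  define c where "c m x = exp_recip (real m * (R\<^sup>2 - (norm x)\<^sup>2) - 1)" for m and x :: "real^'n"
  define K where "K m = {x :: real^'n. (norm x)\<^sup>2 \<le> R\<^sup>2 - 1 / real (Suc m)}" for m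
  have c_smooth: "smooth (c m)" for m
    unfolding c_def[abs_def]
    by (intro smooth_compose[OF smooth_exp_recip] smooth_diff smooth_cmult smooth_const smooth_norm_square)
  have K_ball: "K m \<subseteq> ball 0 R" for m
  proof
    fix x assume "x \<in> K m"
    moreover have "0 < 1 / real (Suc m)" by simp
    ultimately have "(norm x)\<^sup>2 < R\<^sup>2"
      unfolding K_def mem_Collect_eq by linarith
    then show "x \<in> ball 0 R" using R by (simp add: power_less_imp_less_base)
  qed
  have K_compact: "compact (K m)" for m
  proof -
    have "closed (K m)"
      unfolding K_def by (intro closed_Collect_le continuous_intros)
    moreover have "bounded (K m)"
      using K_ball bounded_ball bounded_subset by blast
    ultimately show ?thesis by (simp add: compact_eq_bounded_closed)
  qed
  have c_supp: "c m x = 0" if "x \<notin> K m" for m x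
  proof -
    have "real m * (R\<^sup>2 - (norm x)\<^sup>2) \<le> 1"
    proof (cases "R\<^sup>2 - (norm x)\<^sup>2 \<le> 0")
      case True
      then have "real m * (R\<^sup>2 - (norm x)\<^sup>2) \<le> 0" by (intro mult_nonneg_nonpos) auto
      then show ?thesis by simp
    next
      case False
      have "R\<^sup>2 - (norm x)\<^sup>2 < 1 / real (Suc m)" using that by (simp add: K_def)
      then have "real (Suc m) * (R\<^sup>2 - (norm x)\<^sup>2) < 1" by (simp add: field_simps)
      moreover have "real m * (R\<^sup>2 - (norm x)\<^sup>2) \<le> real (Suc m) * (R\<^sup>2 - (norm x)\<^sup>2)"
        using False by (intro mult_right_mono) auto
      ultimately show ?thesis by linarith
    qed
    then show ?thesis by (simp add: c_def exp_recip_eq_0)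
  qed
  have B_leb: "ball 0 R \<in> sets lebesgue" by simp
  have "AE x in lebesgue_on (ball 0 R). c m x * h x = 0" for m
  proof -
    define H where "H x = indicator (ball 0 R) x * (c m x * h x)" for x
    have H_int: "integrable lebesgue H"
      using locally_integrable_mult_test[OF h B_leb smooth_continuous_on[OF c_smooth] K_compact K_ball c_supp]
      by (simp add: H_def[abs_def] integrable_restrict_space)
    have H_supp: "H x = 0" if "x \<notin> K m" for x
      using c_supp[OF that] by (simp add: H_def)
    \<comment> \<open>The polynomial approximation is available for Borel functions, while
      \<open>H\<close> is only Lebesgue measurable.\<close>
    obtain H' where H' [measurable]: "H' \<in> borel_measurable lborel" and eq: "AE x in lborel. H x = H' x"
      using completion_ex_borel_measurable_real[OF borel_measurable_integrable[OF H_int]] by blast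
    obtain Q where Q: "\<And>k. real_polynomial_function (Q k)" "\<And>k x. x \<in> K m \<Longrightarrow> \<bar>Q k x\<bar> \<le> 1 + 1"
      "AE x in lborel. x \<in> K m \<longrightarrow> (\<lambda>k::nat. Q k x) \<longlonglongrightarrow> sgn (H' x)"
      by (rule bounded_measurable_polynomial_approx[of "\<lambda>x. sgn (H' x)" 1 "K m"])
         (use H' K_compact in \<open>auto simp: abs_sgn_eq\<close>)
    have int0: "(LINT x|lebesgue. H x * Q k x) = 0" for k
    proof -
      have "(\<lambda>x. c m x * Q k x) \<in> test_functions (ball 0 R)"
        by (rule test_functionsI[OF smooth_mult[OF c_smooth smooth_real_polynomial_function[OF Q(1)]]
              K_compact[of m] K_ball[of m]])
           (simp add: c_supp)
      from zero[OF this] have "(LINT x|lebesgue. indicator (ball 0 R) x *\<^sub>R (h x * (c m x * Q k x))) = 0"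
        by (simp add: integral_restrict_space)
      then show ?thesis by (simp add: H_def mult_ac)
    qed
    have [measurable]: "H \<in> borel_measurable lebesgue"
      using H_int by (rule borel_measurable_integrable)
    have [measurable]: "Q k \<in> borel_measurable lebesgue" for k
      using Q(1) by (intro measurable_completion)
        (simp add: borel_measurable_continuous_onI smooth_continuous_on smooth_real_polynomial_function)
    have lim: "(\<lambda>k. LINT x|lebesgue. H x * Q k x) \<longlonglongrightarrow> (LINT x|lebesgue. \<bar>H x\<bar>)"
    proof (rule integral_dominated_convergence[where w = "\<lambda>x. 2 * \<bar>H x\<bar>"])
      show "AE x in lebesgue. norm (H x * Q k x) \<le> 2 * \<bar>H x\<bar>" for k
      proof (rule AE_I2)
        fix x show "norm (H x * Q k x) \<le> 2 * \<bar>H x\<bar>"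
          using Q(2)[of x k] H_supp[of x] mult_left_mono[of "\<bar>Q k x\<bar>" 2 "\<bar>H x\<bar>"]
          by (cases "x \<in> K m") (auto simp: abs_mult)
      qed
      show "AE x in lebesgue. (\<lambda>k. H x * Q k x) \<longlonglongrightarrow> \<bar>H x\<bar>"
      proof (rule AE_completion, use Q(3) eq in eventually_elim)
        case (elim x)
        show ?case
        proof (cases "x \<in> K m")
          case True
          with elim have "(\<lambda>k. H x * Q k x) \<longlonglongrightarrow> H x * sgn (H' x)"
            by (intro tendsto_mult tendsto_const) auto
          moreover have "H x * sgn (H' x) = \<bar>H x\<bar>"
            using elim abs_sgn[of "H x"] by simp
          ultimately show ?thesis by (simp only:)
        qed (simp add: H_supp)
      qed
    qed (use H_int in auto)
    then have "(LINT x|lebesgue. \<bar>H x\<bar>) = 0"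
      unfolding int0 using LIMSEQ_unique tendsto_const by blast
    then have "AE x in lebesgue. H x = 0"
      using integral_nonneg_eq_0_iff_AE[of lebesgue "\<lambda>x. \<bar>H x\<bar>"] H_int by simp
    then show ?thesis
      by (subst AE_restrict_space_iff) (auto simp: H_def elim: eventually_mono)
  qed
  then have "AE x in lebesgue_on (ball 0 R). \<forall>m. c m x * h x = 0"
    unfolding AE_all_countable by blast
  then show ?thesis
  proof (rule AE_mp, intro AE_I2 impI)
    fix x assume x: "x \<in> space (lebesgue_on (ball 0 R))" and z: "\<forall>m. c m x * h x = 0"
    have "0 < R\<^sup>2 - (norm x)\<^sup>2"
      using x R by (simp add: space_restrict_space power_strict_mono)
    then have "(\<lambda>m. c m x) \<longlonglongrightarrow> 1"
      unfolding c_def by (rule exp_recip_tendsto_1)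
    then have "\<forall>\<^sub>F m in sequentially. c m x > 0"
      by (rule order_tendstoD) simp
    then obtain m where "c m x > 0"
      by (auto dest!: eventually_happens)
    with z show "h x = 0" by (metis less_irrefl mult_eq_0_iff)
  qed
qed

text \<open>The difference is a weak gradient of the zero function. This is what allows the norm of
  the chosen \<open>weak_gradient\<close> to be computed from any weak gradient.\<close>

lemma weak_gradient_unique:
  fixes u :: "real^'n \<Rightarrow> real"
  assumes "is_weak_gradient (ball 0 R) u g" "is_weak_gradient (ball 0 R) u h" "0 < R"
  shows "AE x in lebesgue_on (ball 0 R). g x = h x"
proof -
  have B: "ball 0 R \<in> sets lebesgue" for R and z :: "real^'n" by simp
  have diff: "is_weak_gradient (ball 0 R) (\<lambda>x. u x - u x) (\<lambda>x. g x - h x)"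
    using assms by (intro is_weak_gradient_diff) auto
  have "AE x in lebesgue_on (ball 0 R). (g x - h x) $ i = 0" for i
  proof (rule fundamental_lemma_ball[OF _ assms(3)])
    show "locally_integrable (ball 0 R) (\<lambda>x. (g x - h x) $ i)"
      using diff locally_integrable_component[of _ "\<lambda>x. g x - h x"]
      unfolding is_weak_gradient_def by blast
    show "(LINT x|lebesgue_on (ball 0 R). (g x - h x) $ i * \<psi> x) = 0" if "\<psi> \<in> test_functions (ball 0 R)" for \<psi>
      using diff that unfolding is_weak_gradient_def by auto
  qed
  then have "AE x in lebesgue_on (ball 0 R). \<forall>i. (g x - h x) $ i = 0"
    unfolding AE_all_countable by blast
  then show ?thesis
    by (rule eventually_mono) (auto simp: vec_eq_iff)
qed

lemma weak_gradient_is_weak_gradient: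
  "is_weak_gradient \<Omega> u g \<Longrightarrow> is_weak_gradient \<Omega> u (weak_gradient \<Omega> u)"
  unfolding weak_gradient_def by (rule someI[where P = "is_weak_gradient \<Omega> u"])

text \<open>L^1 convergence suffices, because a test function and its derivatives are
  bounded.\<close>

lemma is_weak_gradient_limit:
  fixes u :: "real^'n \<Rightarrow> real"
  assumes \<Omega>: "\<Omega> \<in> sets lebesgue"
    and \<phi>: "\<And>k::nat. is_weak_gradient \<Omega> (\<phi> k) (G k)"
    and u: "locally_integrable \<Omega> u" and g: "locally_integrable \<Omega> g"
    and meas: "\<And>k. \<phi> k \<in> borel_measurable (lebesgue_on \<Omega>)" "\<And>k. G k \<in> borel_measurable (lebesgue_on \<Omega>)"
      "u \<in> borel_measurable (lebesgue_on \<Omega>)" "g \<in> borel_measurable (lebesgue_on \<Omega>)"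
    and u_lim: "(\<lambda>k. \<integral>\<^sup>+x. ennreal (norm (\<phi> k x - u x)) \<partial>lebesgue_on \<Omega>) \<longlonglongrightarrow> 0"
    and g_lim: "(\<lambda>k. \<integral>\<^sup>+x. ennreal (norm (G k x - g x)) \<partial>lebesgue_on \<Omega>) \<longlonglongrightarrow> 0"
  shows "is_weak_gradient \<Omega> u g"
  unfolding is_weak_gradient_def
proof (intro conjI ballI allI u g)
  fix \<psi> :: "real^'n \<Rightarrow> real" and i assume \<psi>: "\<psi> \<in> test_functions \<Omega>"
  then obtain K where K: "smooth \<psi>" "compact K" "K \<subseteq> \<Omega>" "\<And>x. x \<notin> K \<Longrightarrow> \<psi> x = 0"
    by (rule test_functionsE) blast
  define d where "d x = frechet_derivative \<psi> (at x) (axis i 1)" for x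
  have d: "continuous_on UNIV d" "\<And>x. x \<notin> K \<Longrightarrow> d x = 0"
    using frechet_derivative_eq_0_outside[OF compact_imp_closed[OF K(2)] K(4)]
    by (auto simp: d_def[abs_def] intro!: smooth_continuous_on smooth_frechet_derivative K)
  have conv: "(\<lambda>k. LINT x|lebesgue_on \<Omega>. \<eta> x * w k x) \<longlonglongrightarrow> (LINT x|lebesgue_on \<Omega>. \<eta> x * v x)"
    if \<eta>: "continuous_on UNIV \<eta>" "\<And>x. x \<notin> K \<Longrightarrow> \<eta> x = 0"
      and w: "\<And>k. locally_integrable \<Omega> (w k)" "locally_integrable \<Omega> v"
      and [measurable]: "\<And>k. w k \<in> borel_measurable (lebesgue_on \<Omega>)" "v \<in> borel_measurable (lebesgue_on \<Omega>)"
      and wv: "(\<lambda>k. \<integral>\<^sup>+x. ennreal \<bar>w k x - v x\<bar> \<partial>lebesgue_on \<Omega>) \<longlonglongrightarrow> 0"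
    for \<eta> v :: "real^'n \<Rightarrow> real" and w :: "nat \<Rightarrow> real^'n \<Rightarrow> real"
  proof -
    have "bounded (\<eta> ` K)"
      using \<eta>(1) K(2) by (intro compact_imp_bounded compact_continuous_image) (auto intro: continuous_on_subset)
    then obtain C where C: "\<And>x. x \<in> K \<Longrightarrow> \<bar>\<eta> x\<bar> \<le> C"
      by (auto simp: bounded_iff)
    have C': "\<bar>\<eta> x\<bar> \<le> max C 0" for x
      using C[of x] \<eta>(2)[of x] by (cases "x \<in> K") auto
    have int: "integrable (lebesgue_on \<Omega>) (\<lambda>x. \<eta> x * f x)" if "locally_integrable \<Omega> f" for f :: "real^'n \<Rightarrow> real"
      using locally_integrable_mult_test[OF that \<Omega> \<eta>(1) K(2,3) \<eta>(2)] by simp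
    have diff: "(LINT x|lebesgue_on \<Omega>. \<eta> x * w k x) - (LINT x|lebesgue_on \<Omega>. \<eta> x * v x)
        = (LINT x|lebesgue_on \<Omega>. \<eta> x * w k x - \<eta> x * v x)" for k
      using int w by simp
    have bound: "ennreal \<bar>(LINT x|lebesgue_on \<Omega>. \<eta> x * w k x) - (LINT x|lebesgue_on \<Omega>. \<eta> x * v x)\<bar>
        \<le> ennreal (max C 0) * (\<integral>\<^sup>+x. ennreal \<bar>w k x - v x\<bar> \<partial>lebesgue_on \<Omega>)" for k
    proof -
      have "ennreal (norm (LINT x|lebesgue_on \<Omega>. \<eta> x * w k x - \<eta> x * v x))
          \<le> (\<integral>\<^sup>+x. ennreal (norm (\<eta> x * w k x - \<eta> x * v x)) \<partial>lebesgue_on \<Omega>)"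
        using int w by (intro integral_norm_bound_ennreal) auto
      also have "\<dots> \<le> (\<integral>\<^sup>+x. ennreal (max C 0) * ennreal \<bar>w k x - v x\<bar> \<partial>lebesgue_on \<Omega>)"
      proof (intro nn_integral_mono)
        fix x
        have "\<bar>\<eta> x * w k x - \<eta> x * v x\<bar> \<le> max C 0 * \<bar>w k x - v x\<bar>"
          using mult_right_mono[OF C'[of x], of "\<bar>w k x - v x\<bar>"]
          by (simp add: abs_mult[symmetric] right_diff_distrib)
        then show "ennreal (norm (\<eta> x * w k x - \<eta> x * v x)) \<le> ennreal (max C 0) * ennreal \<bar>w k x - v x\<bar>"
          by (simp add: ennreal_mult[symmetric] ennreal_leI)
      qed
      also have "\<dots> \<le> ennreal (max C 0) * (\<integral>\<^sup>+x. ennreal \<bar>w k x - v x\<bar> \<partial>lebesgue_on \<Omega>)"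
        by (subst nn_integral_cmult) auto
      finally show ?thesis by (simp add: diff)
    qed
    have "(\<lambda>k. ennreal (max C 0) * (\<integral>\<^sup>+x. ennreal \<bar>w k x - v x\<bar> \<partial>lebesgue_on \<Omega>)) \<longlonglongrightarrow> ennreal (max C 0) * 0"
      by (intro ennreal_tendsto_cmult wv) simp
    then have lim: "(\<lambda>k. ennreal (max C 0) * (\<integral>\<^sup>+x. ennreal \<bar>w k x - v x\<bar> \<partial>lebesgue_on \<Omega>)) \<longlonglongrightarrow> 0"
      by simp
    have "(\<lambda>k. ennreal \<bar>(LINT x|lebesgue_on \<Omega>. \<eta> x * w k x) - (LINT x|lebesgue_on \<Omega>. \<eta> x * v x)\<bar>) \<longlonglongrightarrow> ennreal 0"
      unfolding ennreal_0
      by (rule tendsto_sandwich[OF _ always_eventually[OF allI[OF bound]] tendsto_const lim]) simp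
    then have "(\<lambda>k. \<bar>(LINT x|lebesgue_on \<Omega>. \<eta> x * w k x) - (LINT x|lebesgue_on \<Omega>. \<eta> x * v x)\<bar>) \<longlonglongrightarrow> 0"
      by (subst (asm) tendsto_ennreal_iff) auto
    then show ?thesis
      by (simp add: tendsto_rabs_zero_iff LIM_zero_iff)
  qed
  have A: "(\<lambda>k. LINT x|lebesgue_on \<Omega>. d x * \<phi> k x) \<longlonglongrightarrow> (LINT x|lebesgue_on \<Omega>. d x * u x)"
    using \<phi> u_lim meas by (intro conv d u) (auto simp: is_weak_gradient_def)
  have B: "(\<lambda>k. LINT x|lebesgue_on \<Omega>. \<psi> x * (G k x $ i)) \<longlonglongrightarrow> (LINT x|lebesgue_on \<Omega>. \<psi> x * (g x $ i))"
  proof (intro conv smooth_continuous_on K locally_integrable_component g)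
    show "locally_integrable \<Omega> (G k)" for k using \<phi>[of k] by (simp add: is_weak_gradient_def)
    show "(\<lambda>x. G k x $ i) \<in> borel_measurable (lebesgue_on \<Omega>)" for k
      using meas(2)[of k] by (rule measurable_compose) (simp add: borel_measurable_continuous_onI continuous_on_component)
    show "(\<lambda>x. g x $ i) \<in> borel_measurable (lebesgue_on \<Omega>)"
      using meas(4) by (rule measurable_compose) (simp add: borel_measurable_continuous_onI continuous_on_component)
    show "(\<lambda>k. \<integral>\<^sup>+x. ennreal \<bar>G k x $ i - g x $ i\<bar> \<partial>lebesgue_on \<Omega>) \<longlonglongrightarrow> 0"
    proof (rule tendsto_sandwich[OF _ _ tendsto_const g_lim])
      have "\<bar>G k x $ i - g x $ i\<bar> \<le> norm (G k x - g x)" for k x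
        using component_le_norm_cart[of "G k x - g x" i] by simp
      then show "\<forall>\<^sub>F k in sequentially. (\<integral>\<^sup>+x. ennreal \<bar>G k x $ i - g x $ i\<bar> \<partial>lebesgue_on \<Omega>)
          \<le> (\<integral>\<^sup>+x. ennreal (norm (G k x - g x)) \<partial>lebesgue_on \<Omega>)"
        by (intro always_eventually allI nn_integral_mono ennreal_leI)
    qed simp
  qed
  have "(LINT x|lebesgue_on \<Omega>. d x * \<phi> k x) = - (LINT x|lebesgue_on \<Omega>. \<psi> x * (G k x $ i))" for k
    using \<phi>[of k] \<psi> by (simp add: is_weak_gradient_def d_def mult.commute)
  with A have "(\<lambda>k. - (LINT x|lebesgue_on \<Omega>. \<psi> x * (G k x $ i))) \<longlonglongrightarrow> (LINT x|lebesgue_on \<Omega>. d x * u x)"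
    by simp
  from LIMSEQ_unique[OF this tendsto_minus[OF B]]
  show "(LINT x|lebesgue_on \<Omega>. u x * frechet_derivative \<psi> (at x) (axis i 1)) = - (LINT x|lebesgue_on \<Omega>. g x $ i * \<psi> x)"
    by (simp add: d_def mult.commute)
qed

section \<open>Lebesgue and Sobolev norms in terms of moments\<close>

lemma Lp_space_iff_moment:
  "f \<in> Lp_space p \<Omega> \<longleftrightarrow> f \<in> borel_measurable (lebesgue_on \<Omega>) \<and> moment p (lebesgue_on \<Omega>) f < \<infinity>"
  by (auto simp: Lp_space_def moment_def integrable_iff_bounded)

lemma Lp_norm_powr:
  assumes "f \<in> Lp_space p \<Omega>" "0 < p"
  shows "ennreal (Lp_norm p \<Omega> f powr p) = moment p (lebesgue_on \<Omega>) f"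
proof -
  have "integrable (lebesgue_on \<Omega>) (\<lambda>x. norm (f x) powr p)"
    using assms(1) by (simp add: Lp_space_def)
  then have "moment p (lebesgue_on \<Omega>) f = ennreal (LINT x|lebesgue_on \<Omega>. norm (f x) powr p)"
    unfolding moment_def by (intro nn_integral_eq_integral) auto
  then show ?thesis
    using assms(2) by (simp add: Lp_norm_def powr_powr)
qed

lemma emeasure_lebesgue_on_ball:
  "emeasure (lebesgue_on (ball (0::'a::euclidean_space) R)) (space (lebesgue_on (ball 0 R))) < \<infinity>"
  using emeasure_bounded_finite[of "ball (0::'a) R"] by (simp add: space_restrict_space emeasure_restrict_space)

lemma Lp_space_ball_integrable:
  fixes f :: "real^'n \<Rightarrow> 'b::euclidean_space"
  assumes "f \<in> Lp_space p (ball 0 R)" "1 < p"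
  shows "integrable (lebesgue_on (ball 0 R)) f"
proof (rule integrableI_bounded)
  let ?M = "lebesgue_on (ball (0::real^'n) R)"
  have f: "f \<in> borel_measurable ?M" "moment p ?M f < \<infinity>"
    using assms(1) by (auto simp: Lp_space_iff_moment)
  obtain E where E: "moment p ?M f = ennreal E" "0 \<le> E"
    using f(2) by (cases "moment p ?M f") auto
  obtain m where m: "emeasure ?M (space ?M) = ennreal m" "0 \<le> m"
    using emeasure_lebesgue_on_ball[where 'a = "real^'n", of R] by (cases "emeasure ?M (space ?M)") auto
  have "(\<integral>\<^sup>+x. ennreal (norm (f x)) \<partial>?M) \<le> ennreal ((E + 1) powr (1 / p) * (m + 1) powr (1 - 1 / p))"
    using E m assms(2) f(1) by (intro nn_integral_le_moment) (auto intro: ennreal_leI)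
  then show "(\<integral>\<^sup>+x. ennreal (norm (f x)) \<partial>?M) < \<infinity>"
    by (rule le_less_trans) simp
qed (use assms in \<open>simp add: Lp_space_def\<close>)

lemma integrable_imp_locally_integrable:
  fixes f :: "real^'n \<Rightarrow> 'b::euclidean_space"
  assumes "integrable (lebesgue_on \<Omega>) f" "\<Omega> \<in> sets lebesgue"
  shows "locally_integrable \<Omega> f"
  unfolding locally_integrable_def
proof (intro allI impI)
  fix K :: "(real^'n) set" assume K: "compact K \<and> K \<subseteq> \<Omega>"
  then have K_leb: "K \<in> sets lebesgue" using fmeasurableD[OF lmeasurable_compact] by auto
  have "integrable lebesgue (\<lambda>x. indicator K x *\<^sub>R (indicator \<Omega> x *\<^sub>R f x))"
    by (rule integrable_mult_indicator[OF K_leb]) (use assms in \<open>simp add: integrable_restrict_space\<close>)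
  moreover have "indicator K x *\<^sub>R (indicator \<Omega> x *\<^sub>R f x) = indicator K x *\<^sub>R f x" for x
    using K by (auto simp: indicator_def)
  ultimately have "integrable lebesgue (\<lambda>x. indicator K x *\<^sub>R f x)"
    by (simp only:)
  then show "integrable (lebesgue_on K) f"
    using K_leb by (simp add: integrable_restrict_space)
qed

lemma borel_measurable_lebesgue_on_AE:
  fixes f g :: "'a::euclidean_space \<Rightarrow> 'b::euclidean_space"
  assumes f: "f \<in> borel_measurable (lebesgue_on S)" and S: "S \<in> sets lebesgue"
    and eq: "AE x in lebesgue_on S. f x = g x"
  shows "g \<in> borel_measurable (lebesgue_on S)"
proof -
  have "(\<lambda>x. if x \<in> S then f x else 0) \<in> borel_measurable lebesgue"
    using f S by (simp add: borel_measurable_if)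
  moreover have "AE x in lebesgue. (if x \<in> S then f x else 0) = (if x \<in> S then g x else 0)"
    using eq S by (subst (asm) AE_restrict_space_iff) (auto elim: eventually_mono)
  ultimately have "(\<lambda>x. if x \<in> S then g x else 0) \<in> borel_measurable lebesgue"
    by (rule borel_measurable_AE)
  then show ?thesis
    using S by (simp add: borel_measurable_if)
qed

lemma Lp_space_cong_AE:
  fixes f g :: "real^'n \<Rightarrow> 'b::euclidean_space"
  assumes f: "f \<in> Lp_space p S" and S: "S \<in> sets lebesgue" and eq: "AE x in lebesgue_on S. f x = g x"
  shows "g \<in> Lp_space p S"
proof -
  have "moment p (lebesgue_on S) f = moment p (lebesgue_on S) g"
    using eq by (intro moment_cong_AE) (auto elim: eventually_mono)
  then show ?thesis
    using f borel_measurable_lebesgue_on_AE[OF _ S eq] by (auto simp: Lp_space_iff_moment)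
qed

lemma bounded_continuous_Lp_space_ball:
  fixes f :: "real^'n \<Rightarrow> 'b::euclidean_space"
  assumes f: "continuous_on UNIV f" and p: "0 < p"
  shows "f \<in> Lp_space p (ball 0 R)"
proof -
  let ?M = "lebesgue_on (ball (0::real^'n) R)"
  have "compact (f ` cball 0 R)"
    using f by (intro compact_continuous_image) (auto intro: continuous_on_subset)
  then obtain C where "\<forall>x\<in>cball 0 R. norm (f x) \<le> C"
    by (auto simp: bounded_iff dest!: compact_imp_bounded)
  then have C: "norm (f x) \<le> C" if "norm x \<le> R" for x
    using that by simp
  have "moment p ?M f \<le> (\<integral>\<^sup>+x. ennreal (C powr p) \<partial>?M)"
    unfolding moment_def using C p
    by (intro nn_integral_mono ennreal_leI powr_mono2) (auto simp: space_restrict_space)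
  also have "\<dots> < \<infinity>"
    using emeasure_lebesgue_on_ball[where 'a = "real^'n", of R] by (simp add: ennreal_mult_less_top)
  finally show ?thesis
    using f by (auto simp: Lp_space_iff_moment intro!: borel_imp_lebesgue_on borel_measurable_continuous_onI)
qed

lemma Lp_space_diff:
  fixes f g :: "real^'n \<Rightarrow> 'b::euclidean_space"
  assumes "f \<in> Lp_space p \<Omega>" "g \<in> Lp_space p \<Omega>" "1 \<le> p"
  shows "(\<lambda>x. f x - g x) \<in> Lp_space p \<Omega>"
proof -
  have "moment p (lebesgue_on \<Omega>) (\<lambda>x. f x + - g x)
      \<le> ennreal (2 powr (p - 1)) * (moment p (lebesgue_on \<Omega>) f + moment p (lebesgue_on \<Omega>) (\<lambda>x. - g x))"
    using assms by (intro moment_add_le) (auto simp: Lp_space_iff_moment)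
  also have "\<dots> < \<infinity>"
    using assms by (simp add: moment_uminus Lp_space_iff_moment ennreal_mult_less_top)
  finally show ?thesis
    using assms by (auto simp: Lp_space_iff_moment)
qed

lemma weak_gradient_ball:
  fixes u :: "real^'n \<Rightarrow> real"
  assumes "is_weak_gradient (ball 0 R) u g" "g \<in> Lp_space p (ball 0 R)" "0 < R"
  shows "weak_gradient (ball 0 R) u \<in> Lp_space p (ball 0 R)"
    and "moment p (lebesgue_on (ball 0 R)) (weak_gradient (ball 0 R) u) = moment p (lebesgue_on (ball 0 R)) g"
proof -
  have eq: "AE x in lebesgue_on (ball 0 R). g x = weak_gradient (ball 0 R) u x"
    by (rule weak_gradient_unique[OF assms(1) weak_gradient_is_weak_gradient[OF assms(1)] assms(3)])
  show "weak_gradient (ball 0 R) u \<in> Lp_space p (ball 0 R)"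
    by (rule Lp_space_cong_AE[OF assms(2) _ eq]) simp
  show "moment p (lebesgue_on (ball 0 R)) (weak_gradient (ball 0 R) u) = moment p (lebesgue_on (ball 0 R)) g"
    using eq by (intro moment_cong_AE) (auto elim: eventually_mono)
qed

lemma sobolev_norm_powr:
  fixes u :: "real^'n \<Rightarrow> real"
  assumes "is_weak_gradient (ball 0 R) u g" "u \<in> Lp_space p (ball 0 R)" "g \<in> Lp_space p (ball 0 R)"
    and "0 < R" "0 < p"
  shows "ennreal (sobolev_norm p (ball 0 R) u powr p)
    = moment p (lebesgue_on (ball 0 R)) u + moment p (lebesgue_on (ball 0 R)) g"
  using Lp_norm_powr[OF assms(2,5)] Lp_norm_powr[OF weak_gradient_ball(1)[OF assms(1,3,4)] assms(5)]
    weak_gradient_ball(2)[OF assms(1,3,4)] assms(5)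
  by (simp add: sobolev_norm_def powr_powr)

lemma tendsto_ennreal_powr_0_iff:
  assumes "0 < p" "\<And>k. 0 \<le> x k"
  shows "(\<lambda>k. ennreal (x k powr p)) \<longlonglongrightarrow> 0 \<longleftrightarrow> x \<longlonglongrightarrow> (0::real)"
proof -
  have "(\<lambda>k. ennreal (x k powr p)) \<longlonglongrightarrow> 0 \<longleftrightarrow> (\<lambda>k. x k powr p) \<longlonglongrightarrow> 0"
    using tendsto_ennreal_iff[of "\<lambda>k. x k powr p" sequentially 0] by simp
  also have "\<dots> \<longleftrightarrow> x \<longlonglongrightarrow> 0"
  proof
    assume *: "(\<lambda>k. x k powr p) \<longlonglongrightarrow> 0"
    from tendsto_powr'[OF * tendsto_const[of "1 / p"]]
    have "(\<lambda>k. (x k powr p) powr (1 / p)) \<longlonglongrightarrow> 0" using assms(1) by simp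
    then show "x \<longlonglongrightarrow> 0" using assms by (simp add: powr_powr)
  next
    assume "x \<longlonglongrightarrow> 0"
    from tendsto_powr'[OF this tendsto_const[of p]]
    show "(\<lambda>k. x k powr p) \<longlonglongrightarrow> 0" using assms by simp
  qed
  finally show ?thesis .
qed

lemma tendsto_add_0_iff_ennreal:
  fixes a b :: "nat \<Rightarrow> ennreal"
  shows "(\<lambda>k. a k + b k) \<longlonglongrightarrow> 0 \<longleftrightarrow> a \<longlonglongrightarrow> 0 \<and> b \<longlonglongrightarrow> 0"
proof
  assume *: "(\<lambda>k. a k + b k) \<longlonglongrightarrow> 0"
  show "a \<longlonglongrightarrow> 0 \<and> b \<longlonglongrightarrow> 0"
    by (intro conjI; rule tendsto_sandwich[OF _ _ tendsto_const *]) (auto intro!: always_eventually)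
next
  assume "a \<longlonglongrightarrow> 0 \<and> b \<longlonglongrightarrow> 0"
  then show "(\<lambda>k. a k + b k) \<longlonglongrightarrow> 0"
    using tendsto_add[of a 0 sequentially b 0] by simp
qed

text \<open>Removes the chosen weak gradients from the Sobolev norm: by uniqueness they may be
  replaced by the classical gradients of the \<open>\<phi> k\<close> and one fixed weak gradient of
  \<open>u\<close>, after which convergence of the norm splits into convergence of two
  moments.\<close>

lemma sobolev_space0_iff:
  fixes u :: "real^'n \<Rightarrow> real"
  assumes R: "0 < R" and p: "1 < p"
  shows "u \<in> sobolev_space0 p (ball 0 R) \<longleftrightarrow>
    (\<exists>g \<phi>. u \<in> Lp_space p (ball 0 R) \<and> g \<in> Lp_space p (ball 0 R) \<and> is_weak_gradient (ball 0 R) u g \<and>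
       (\<forall>k. \<phi> k \<in> test_functions (ball 0 R)) \<and>
       (\<lambda>k::nat. moment p (lebesgue_on (ball 0 R)) (\<lambda>x. \<phi> k x - u x)) \<longlonglongrightarrow> 0 \<and>
       (\<lambda>k. moment p (lebesgue_on (ball 0 R)) (\<lambda>x. gradient (\<phi> k) x - g x)) \<longlonglongrightarrow> 0)"
proof -
  have conv: "(\<lambda>k. sobolev_norm p (ball 0 R) (\<lambda>x. \<phi> k x - u x)) \<longlonglongrightarrow> 0 \<longleftrightarrow>
      (\<lambda>k. moment p (lebesgue_on (ball 0 R)) (\<lambda>x. \<phi> k x - u x)) \<longlonglongrightarrow> 0 \<and>
      (\<lambda>k. moment p (lebesgue_on (ball 0 R)) (\<lambda>x. gradient (\<phi> k) x - g x)) \<longlonglongrightarrow> 0"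
    if u: "u \<in> Lp_space p (ball 0 R)" "g \<in> Lp_space p (ball 0 R)" "is_weak_gradient (ball 0 R) u g"
      and \<phi>: "\<And>k::nat. \<phi> k \<in> test_functions (ball 0 R)" for g \<phi>
  proof -
    have smooth: "smooth (\<phi> k)" for k using \<phi>[of k] by (simp add: test_functions_iff)
    have "ennreal (sobolev_norm p (ball 0 R) (\<lambda>x. \<phi> k x - u x) powr p) =
      moment p (lebesgue_on (ball 0 R)) (\<lambda>x. \<phi> k x - u x) +
      moment p (lebesgue_on (ball 0 R)) (\<lambda>x. gradient (\<phi> k) x - g x)" for k
    proof (rule sobolev_norm_powr[OF _ _ _ R])
      show "is_weak_gradient (ball 0 R) (\<lambda>x. \<phi> k x - u x) (\<lambda>x. gradient (\<phi> k) x - g x)"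
        by (intro is_weak_gradient_diff smooth_is_weak_gradient smooth u) auto
      show "(\<lambda>x. \<phi> k x - u x) \<in> Lp_space p (ball 0 R)"
        "(\<lambda>x. gradient (\<phi> k) x - g x) \<in> Lp_space p (ball 0 R)"
        using p by (intro Lp_space_diff bounded_continuous_Lp_space_ball smooth_continuous_on
            gradient_continuous_on smooth u; simp)+
    qed (use p in simp)
    then show ?thesis
      using tendsto_ennreal_powr_0_iff[of p "\<lambda>k. sobolev_norm p (ball 0 R) (\<lambda>x. \<phi> k x - u x)"] p
      by (simp add: tendsto_add_0_iff_ennreal sobolev_norm_def)
  qed
  show ?thesis
    unfolding sobolev_space0_def sobolev_space_def using conv by blast
qed

section \<open>Radial coordinates on the ball\<close>

definition direction :: "'a::real_normed_vector \<Rightarrow> 'a" where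
  "direction x = x /\<^sub>R norm x"

text \<open>The surface measure of the unit sphere divided by the dimension. With this normalisation
  the total mass is the volume of the unit ball, and the radial density is the derivative of
  \<open>r ^ DIM('a)\<close>.\<close>

definition sphere_measure :: "'a::euclidean_space measure" where
  "sphere_measure = distr (restrict_space lborel (ball 0 1 - {0})) borel direction"

lemma direction_borel [measurable]: "direction \<in> borel_measurable (borel :: 'a::euclidean_space measure)"
  unfolding direction_def[abs_def] by measurable

lemma sets_sphere_measure [simp, measurable_cong]: "sets sphere_measure = sets borel"
  and space_sphere_measure [simp]: "space sphere_measure = UNIV"
  by (simp_all add: sphere_measure_def)

lemma norm_direction: "x \<noteq> 0 \<Longrightarrow> norm (direction x) = 1"
  by (simp add: direction_def)

lemma direction_scaleR: "0 < r \<Longrightarrow> direction (r *\<^sub>R x) = direction x"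
  by (simp add: direction_def)

lemma AE_sphere_measure_norm: "AE \<theta> in (sphere_measure :: 'a::euclidean_space measure). norm \<theta> = 1"
  unfolding sphere_measure_def
  by (subst AE_distr_iff)
     (auto simp: AE_restrict_space_iff norm_direction measurable_restrict_space1)

lemma emeasure_sphere_measure:
  fixes C :: "'a::euclidean_space set"
  assumes [measurable]: "C \<in> sets borel"
  shows "emeasure sphere_measure C = emeasure lborel {x \<in> ball 0 1 - {0}. direction x \<in> C}"
proof -
  have "emeasure sphere_measure C
      = emeasure (restrict_space lborel (ball 0 1 - {0})) (direction -` C \<inter> (ball 0 1 - {0}))"
    unfolding sphere_measure_def
    by (subst emeasure_distr) (auto simp: space_restrict_space intro: measurable_restrict_space1)
  also have "\<dots> = emeasure lborel (direction -` C \<inter> (ball 0 1 - {0}))"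
    by (subst emeasure_restrict_space) auto
  also have "direction -` C \<inter> (ball 0 1 - {0}) = {x \<in> ball 0 1 - {0}. direction x \<in> C}"
    by auto
  finally show ?thesis .
qed

text \<open>Homogeneity of Lebesgue measure under dilations. This is the only geometric input to
  polar coordinates; no Jacobian is computed.\<close>

lemma emeasure_lborel_sector:
  fixes C :: "'a::euclidean_space set"
  assumes [measurable]: "C \<in> sets borel" and r: "0 < r"
  shows "emeasure lborel {x \<in> ball 0 r - {0}. direction x \<in> C} = ennreal (r ^ DIM('a)) * emeasure sphere_measure C"
proof -
  have eq: "{x \<in> ball 0 r - {0}. direction x \<in> C} = (\<lambda>x. r *\<^sub>R x + 0) ` {x \<in> ball 0 1 - {0}. direction x \<in> C}"
    (is "?L = ?f ` ?S")
  proof (intro equalityI subsetI)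
    fix x assume x: "x \<in> ?L"
    then have "x = ?f (x /\<^sub>R r)" "x /\<^sub>R r \<in> ?S"
      using r direction_scaleR[of "inverse r" x] by (auto simp: field_simps)
    then show "x \<in> ?f ` ?S" by (rule image_eqI)
  qed (use r in \<open>auto simp: direction_scaleR\<close>)
  have S: "?S \<in> sets borel" "?L \<in> sets borel" by measurable
  then have "emeasure lborel ?L = emeasure lebesgue (?f ` ?S)"
    unfolding eq[symmetric] by simp
  also have "\<dots> = \<bar>r\<bar> ^ DIM('a) * emeasure lebesgue ?S"
    by (rule emeasure_lebesgue_affine)
  finally show ?thesis
    using S r by (simp add: emeasure_sphere_measure)
qed

lemma emeasure_sphere_measure_UNIV:
  "emeasure (sphere_measure :: 'a::euclidean_space measure) UNIV = ennreal (unit_ball_vol (DIM('a)))"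
proof -
  have "emeasure lborel (ball (0::'a) 1 - {0}) = emeasure lborel (ball (0::'a) 1)"
    by (intro emeasure_Diff_null_set) auto
  then show ?thesis
    by (simp add: emeasure_sphere_measure emeasure_ball Collect_conj_eq[symmetric] set_diff_eq)
qed

lemma finite_sphere_measure: "finite_measure (sphere_measure :: 'a::euclidean_space measure)"
  by (rule finite_measureI) (simp add: emeasure_sphere_measure_UNIV)

section \<open>The level coordinate and integration along rays\<close>

locale radial_ball = sobolev_exponents n p for n p :: real +
  fixes R :: real and B :: "(real^'n) set"
  assumes n_card: "n = real CARD('n)" and R_pos: "0 < R" and B_eq: "B = ball 0 R"
begin

text \<open>In the coordinate \<open>level\<close>, which runs over the half line, the ball disappears from the
  inequality: it becomes Bliss' inequality.\<close>

definition c :: real where "c = R powr (- \<alpha>)"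

definition level :: "real^'n \<Rightarrow> real" where
  "level x = norm x powr (- \<alpha>) - c"

definition radius :: "real \<Rightarrow> real" where
  "radius s = (s + c) powr (- 1 / \<alpha>)"

text \<open>Minus the derivative of \<open>radius s powr n\<close>, since
  \<open>n / \<alpha> + 1 = \<gamma>\<close>: the density of the volume of centred balls in the
  coordinate \<open>s\<close>, relative to the unit ball.\<close>

definition weight :: "real \<Rightarrow> real" where
  "weight s = n / \<alpha> * (s + c) powr (- \<gamma>)"

lemma n_pos: "0 < n"
  using p_gt_1 p_less_n by simp

lemma c_pos: "0 < c"
  using R_pos by (simp add: c_def)

lemma radius_pos: "0 \<le> s \<Longrightarrow> 0 < radius s"
  using c_pos by (simp add: radius_def)

lemma radius_powr: "0 \<le> s \<Longrightarrow> radius s powr (- \<alpha>) = s + c"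
  using c_pos alpha_pos by (simp add: radius_def powr_powr)

lemma radius_0: "radius 0 = R"
  using R_pos alpha_pos by (simp add: radius_def c_def powr_powr)

lemma radius_less_iff: "0 \<le> s \<Longrightarrow> 0 < r \<Longrightarrow> r < radius s \<longleftrightarrow> s < r powr (- \<alpha>) - c"
proof -
  assume s: "0 \<le> s" and r: "0 < r"
  have "r < radius s \<longleftrightarrow> radius s powr (- \<alpha>) < r powr (- \<alpha>)"
    using powr_less_mono2_neg[of "- \<alpha>" r "radius s"] powr_mono2'[of "- \<alpha>" "radius s" r]
      alpha_pos r radius_pos[OF s] by (cases "r < radius s") auto
  then show ?thesis
    using radius_powr[OF s] by auto
qed

lemma level_pos: "x \<in> B \<Longrightarrow> x \<noteq> 0 \<Longrightarrow> 0 < level x"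
  using radius_less_iff[of 0 "norm x"] by (simp add: radius_0 level_def B_eq)

lemma radius_level: "x \<in> B \<Longrightarrow> x \<noteq> 0 \<Longrightarrow> radius (level x) = norm x"
  using alpha_pos by (simp add: radius_def level_def powr_powr)

lemma radius_less_R: "0 < s \<Longrightarrow> radius s < R"
proof -
  assume "0 < s"
  then have "radius s < radius 0"
    using powr_less_mono2_neg[of "- 1 / \<alpha>" c "s + c"] c_pos alpha_pos
    by (simp add: radius_def)
  then show ?thesis by (simp only: radius_0)
qed

lemma level_radius: "0 < s \<Longrightarrow> norm \<theta> = 1 \<Longrightarrow> level (radius s *\<^sub>R \<theta>) = s"
  using radius_powr[of s] radius_pos[of s] by (simp add: level_def)

lemma B_sets [measurable]: "B \<in> sets borel"
  by (simp add: B_eq)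

lemma level_borel [measurable]: "level \<in> borel_measurable borel"
  unfolding level_def[abs_def] by measurable

lemma radius_borel [measurable]: "radius \<in> borel_measurable borel"
  unfolding radius_def[abs_def] by measurable

lemma weight_borel [measurable]: "weight \<in> borel_measurable borel"
  unfolding weight_def[abs_def] by measurable

lemma weight_pos: "0 \<le> s \<Longrightarrow> 0 < weight s"
  using c_pos alpha_pos n_pos by (simp add: weight_def)

definition level_measure :: "real measure" where
  "level_measure = density lborel (\<lambda>s. ennreal (weight s) * indicator {0<..} s)"

lemma sets_level_measure [simp, measurable_cong]: "sets level_measure = sets borel"
  and space_level_measure [simp]: "space level_measure = UNIV"
  by (simp_all add: level_measure_def)

lemma nn_integral_level_measure:
  "f \<in> borel_measurable borel \<Longrightarrow> integral\<^sup>N level_measure f = (\<integral>\<^sup>+s. ennreal (weight s) * f s \<partial>half_line)"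
  unfolding level_measure_def nn_integral_half_line
  by (subst nn_integral_density) (auto intro!: nn_integral_cong simp: indicator_def)

text \<open>The half lines \<open>{t<..}\<close> correspond to centred balls; a negative
  \<open>t\<close> gives the whole ball, whence the maximum.\<close>

lemma emeasure_level_measure:
  "emeasure level_measure {t<..} = ennreal (radius (max 0 t) ^ CARD('n))"
proof -
  define t' where "t' = max 0 t"
  have "emeasure level_measure {t<..} = (\<integral>\<^sup>+s. ennreal (weight s) * indicator {0<..} s * indicator {t<..} s \<partial>lborel)"
    unfolding level_measure_def by (subst emeasure_density) auto
  also have "\<dots> = (\<integral>\<^sup>+s. ennreal (weight s) * indicator {t'..} s \<partial>lborel)"
    by (intro nn_integral_cong_AE, use AE_lborel_singleton[of t'] in eventually_elim)
       (auto simp: indicator_def t'_def)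
  also have "\<dots> = ennreal (0 - (- ((t' + c) powr (- (n / \<alpha>)))))"
  proof (rule nn_integral_FTC_atLeast)
    show "((\<lambda>s. - ((s + c) powr (- (n / \<alpha>)))) \<longlongrightarrow> 0) at_top"
      using n_pos alpha_pos by real_asymp
    fix s assume s: "t' \<le> s"
    then have "0 < s + c" using c_pos by (simp add: t'_def)
    then have "((\<lambda>s. - ((s + c) powr (- (n / \<alpha>)))) has_real_derivative
        - (- (n / \<alpha>) * (s + c) powr (- (n / \<alpha>) - of_nat 1) * (1 + 0))) (at s)"
      by (intro DERIV_minus DERIV_fun_powr DERIV_add DERIV_ident DERIV_const)
    then show "((\<lambda>s. - ((s + c) powr (- (n / \<alpha>)))) has_real_derivative weight s) (at s)"
      by (simp add: weight_def gamma_eq)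
    show "0 \<le> weight s"
      using weight_pos[of s] s by (simp add: t'_def)
  qed simp
  also have "0 - (- ((t' + c) powr (- (n / \<alpha>)))) = radius t' powr n"
    by (simp add: radius_def powr_powr)
  also have "\<dots> = radius t' ^ CARD('n)"
    using radius_pos[of t'] by (simp add: n_card powr_realpow t'_def)
  finally show ?thesis by (simp add: t'_def)
qed

lemma sigma_finite_level_measure: "sigma_finite_measure level_measure"
proof -
  have "level_measure = density lborel (\<lambda>s. ennreal (weight s * indicator {0<..} s))"
    unfolding level_measure_def by (intro arg_cong2[where f = density]) (auto simp: indicator_def)
  then show ?thesis
    using sigma_finite_measure.sigma_finite_iff_density_finite[OF lborel.sigma_finite_measure_axioms,
        of "\<lambda>s. ennreal (weight s * indicator {0<..} s)"] by simp
qed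

text \<open>A product measure is determined by its values on rectangles \<open>A \<times> C\<close>.
  For fixed \<open>C\<close> both sides are measures in \<open>A\<close> that agree and are finite
  on every \<open>{t<..}\<close>, by the sector formula, and so coincide.\<close>

lemma distr_polar:
  "level_measure \<Otimes>\<^sub>M sphere_measure
    = distr (restrict_space lborel (B - {0})) (borel \<Otimes>\<^sub>M borel) (\<lambda>x. (level x, direction x))"
proof (rule pair_measure_eqI)
  show "sigma_finite_measure level_measure" by (rule sigma_finite_level_measure)
  show "sigma_finite_measure (sphere_measure :: (real^'n) measure)"
    using finite_sphere_measure by (rule finite_measure.axioms)
  show "sets (level_measure \<Otimes>\<^sub>M sphere_measure)
      = sets (distr (restrict_space lborel (B - {0})) (borel \<Otimes>\<^sub>M borel) (\<lambda>x. (level x, direction x)))"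
    by (simp cong: sets_pair_measure_cong)
  fix A :: "real set" and C :: "(real^'n) set"
  assume "A \<in> sets level_measure" "C \<in> sets sphere_measure"
  then have A: "A \<in> sets borel" and C [measurable]: "C \<in> sets borel" by auto
  define S where "S = {x \<in> B - {0}. direction x \<in> C}"
  have S [measurable]: "S \<in> sets borel" unfolding S_def by measurable
  define N where "N = distr (restrict_space lborel S) borel level"
  have N: "emeasure N A = emeasure lborel {x \<in> S. level x \<in> A}" if [measurable]: "A \<in> sets borel" for A
  proof -
    have "emeasure N A = emeasure (restrict_space lborel S) (level -` A \<inter> S)"
      unfolding N_def by (subst emeasure_distr) (auto simp: space_restrict_space intro: measurable_restrict_space1)
    also have "\<dots> = emeasure lborel (level -` A \<inter> S)"
      by (subst emeasure_restrict_space) auto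
    also have "level -` A \<inter> S = {x \<in> S. level x \<in> A}" by auto
    finally show ?thesis .
  qed
  have N_greater: "emeasure N {t<..} = ennreal (radius (max 0 t) ^ CARD('n)) * emeasure sphere_measure C" for t
  proof -
    have "{x \<in> S. level x \<in> {t<..}} = {x \<in> ball 0 (radius (max 0 t)) - {0}. direction x \<in> C}"
    proof (intro equalityI subsetI)
      fix x assume "x \<in> {x \<in> S. level x \<in> {t<..}}"
      then have x: "x \<in> B" "x \<noteq> 0" "direction x \<in> C" "t < level x"
        by (auto simp: S_def)
      then have "max 0 t < norm x powr (- \<alpha>) - c"
        using level_pos[of x] by (auto simp: level_def)
      with x show "x \<in> {x \<in> ball 0 (radius (max 0 t)) - {0}. direction x \<in> C}"
        using radius_less_iff[of "max 0 t" "norm x"] by simp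
    next
      fix x assume "x \<in> {x \<in> ball 0 (radius (max 0 t)) - {0}. direction x \<in> C}"
      then have x: "norm x < radius (max 0 t)" "x \<noteq> 0" "direction x \<in> C" by auto
      then have "max 0 t < level x"
        using radius_less_iff[of "max 0 t" "norm x"] by (simp add: level_def)
      moreover have "radius (max 0 t) \<le> R"
        using radius_less_R[of t] radius_0 by (cases "0 < t") (auto simp: max_def)
      ultimately show "x \<in> {x \<in> S. level x \<in> {t<..}}"
        using x by (auto simp: S_def B_eq)
    qed
    then show ?thesis
      using emeasure_lborel_sector[OF C, of "radius (max 0 t)"] by (simp add: N radius_pos)
  qed
  have "N = scale_measure (emeasure sphere_measure C) level_measure"
  proof (rule measure_eqI_lessThan)
    show "sets N = sets borel" "sets (scale_measure (emeasure sphere_measure C) level_measure) = sets borel"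
      by (auto simp: N_def)
    interpret finite_measure "sphere_measure :: (real^'n) measure" by (rule finite_sphere_measure)
    show "emeasure N {t<..} < \<infinity>" for t
    proof -
      have "emeasure sphere_measure C < top"
        using emeasure_finite[of C] by (metis infinity_ennreal_def top.not_eq_extremum)
      then show ?thesis
        by (simp add: N_greater ennreal_mult_less_top)
    qed
    show "emeasure N {t<..} = emeasure (scale_measure (emeasure sphere_measure C) level_measure) {t<..}" for t
      by (simp add: N_greater emeasure_level_measure mult.commute)
  qed
  then have "emeasure level_measure A * emeasure sphere_measure C = emeasure N A"
    by (simp add: mult.commute)
  also have "\<dots> = emeasure lborel ((\<lambda>x. (level x, direction x)) -` (A \<times> C) \<inter> (B - {0}))"
    unfolding N[OF A] by (rule arg_cong[where f = "emeasure lborel"]) (auto simp: S_def)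
  also have "\<dots> = emeasure (restrict_space lborel (B - {0})) ((\<lambda>x. (level x, direction x)) -` (A \<times> C) \<inter> (B - {0}))"
    by (subst emeasure_restrict_space) auto
  also have "\<dots> = emeasure (distr (restrict_space lborel (B - {0})) (borel \<Otimes>\<^sub>M borel) (\<lambda>x. (level x, direction x))) (A \<times> C)"
    using A by (subst emeasure_distr) (auto simp: space_restrict_space intro!: measurable_restrict_space1)
  finally show "emeasure level_measure A * emeasure sphere_measure C
      = emeasure (distr (restrict_space lborel (B - {0})) (borel \<Otimes>\<^sub>M borel) (\<lambda>x. (level x, direction x))) (A \<times> C)" .
qed

lemma polar_nn_integral:
  assumes [measurable]: "F \<in> borel_measurable borel"
  shows "(\<integral>\<^sup>+x\<in>B. F x \<partial>lborel)
    = (\<integral>\<^sup>+\<theta>. \<integral>\<^sup>+s. ennreal (weight s) * F (radius s *\<^sub>R \<theta>) \<partial>half_line \<partial>sphere_measure)"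
proof -
  interpret S: finite_measure "sphere_measure :: (real^'n) measure" by (rule finite_sphere_measure)
  interpret L: sigma_finite_measure level_measure by (rule sigma_finite_level_measure)
  interpret pair_sigma_finite level_measure "sphere_measure :: (real^'n) measure" ..
  have "(\<integral>\<^sup>+x\<in>B. F x \<partial>lborel) = (\<integral>\<^sup>+x\<in>B - {0}. F (radius (level x) *\<^sub>R direction x) \<partial>lborel)"
    by (intro nn_integral_cong_AE, use AE_lborel_singleton[of "0::real^'n"] in eventually_elim)
       (auto simp: indicator_def radius_level direction_def)
  also have "\<dots> = (\<integral>\<^sup>+x. F (radius (level x) *\<^sub>R direction x) \<partial>restrict_space lborel (B - {0}))"
    by (subst nn_integral_restrict_space) auto
  also have "\<dots> = (\<integral>\<^sup>+z. F (radius (fst z) *\<^sub>R snd z) \<partial>(level_measure \<Otimes>\<^sub>M sphere_measure))"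
    unfolding distr_polar by (subst nn_integral_distr) (auto intro!: measurable_restrict_space1)
  also have "\<dots> = (\<integral>\<^sup>+\<theta>. \<integral>\<^sup>+s. F (radius s *\<^sub>R \<theta>) \<partial>level_measure \<partial>sphere_measure)"
    by (subst nn_integral_snd[symmetric]) (auto simp: split_beta)
  finally show ?thesis
    by (simp add: nn_integral_level_measure)
qed

lemma radial_nn_integral:
  assumes [measurable]: "h \<in> borel_measurable borel"
  shows "(\<integral>\<^sup>+x\<in>B. h (level x) \<partial>lborel)
    = ennreal (unit_ball_vol n) * (\<integral>\<^sup>+s. ennreal (weight s) * h s \<partial>half_line)"
proof -
  have "(\<integral>\<^sup>+x\<in>B. h (level x) \<partial>lborel)
      = (\<integral>\<^sup>+\<theta>. \<integral>\<^sup>+s. ennreal (weight s) * h (level (radius s *\<^sub>R \<theta>)) \<partial>half_line \<partial>sphere_measure)"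
    by (rule polar_nn_integral) measurable
  also have "\<dots> = (\<integral>\<^sup>+\<theta>. (\<integral>\<^sup>+s. ennreal (weight s) * h s \<partial>half_line) \<partial>(sphere_measure :: (real^'n) measure))"
  proof (intro nn_integral_cong_AE, use AE_sphere_measure_norm in eventually_elim)
    case (elim \<theta>)
    then show ?case
      by (intro nn_integral_cong) (simp add: level_radius)
  qed
  finally show ?thesis
    by (simp add: emeasure_sphere_measure_UNIV n_card mult.commute)
qed

text \<open>Fubini's theorem for null sets. As \<open>P\<close> may be non-measurable, the argument
  is run on a Borel null set containing its exceptions; positivity of \<open>weight\<close> removes
  the density on each ray.\<close>

lemma AE_polar:
  assumes "AE x in lborel. x \<in> B \<longrightarrow> P x"
  shows "AE \<theta> in sphere_measure. AE s in half_line. P (radius s *\<^sub>R \<theta>)"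
proof -
  obtain N where N: "{x. \<not> (x \<in> B \<longrightarrow> P x)} \<subseteq> N" "emeasure lborel N = 0" "N \<in> sets borel"
    using assms by (auto elim!: AE_E)
  note [measurable] = N(3)
  have "(\<integral>\<^sup>+x\<in>B. indicator N x \<partial>lborel) \<le> (\<integral>\<^sup>+x. indicator N x \<partial>lborel)"
    by (intro nn_integral_mono) (auto simp: indicator_def)
  then have "(\<integral>\<^sup>+\<theta>. \<integral>\<^sup>+s. ennreal (weight s) * indicator N (radius s *\<^sub>R \<theta>) \<partial>half_line \<partial>sphere_measure) = 0"
    using N(2,3) by (simp add: polar_nn_integral)
  moreover have "(\<lambda>\<theta>. \<integral>\<^sup>+s. ennreal (weight s) * indicator N (radius s *\<^sub>R \<theta>) \<partial>half_line) \<in> borel_measurable borel"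
    unfolding nn_integral_half_line by measurable
  ultimately have "AE \<theta> in sphere_measure. (\<integral>\<^sup>+s. ennreal (weight s) * indicator N (radius s *\<^sub>R \<theta>) \<partial>half_line) = 0"
    by (subst (asm) nn_integral_0_iff_AE) (auto cong: measurable_cong_sets)
  with AE_sphere_measure_norm show ?thesis
  proof eventually_elim
    case (elim \<theta>)
    have "(\<lambda>s. ennreal (weight s) * indicator N (radius s *\<^sub>R \<theta>)) \<in> borel_measurable half_line"
      by (intro half_line_borel) measurable
    with elim have "AE s in half_line. ennreal (weight s) * indicator N (radius s *\<^sub>R \<theta>) = 0"
      by (subst (asm) nn_integral_0_iff_AE) auto
    then show ?case
    proof (rule AE_mp, intro AE_I2 impI)
      fix s assume s: "s \<in> space half_line" and z: "ennreal (weight s) * indicator N (radius s *\<^sub>R \<theta>) = 0"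
      then have "radius s *\<^sub>R \<theta> \<notin> N"
        using weight_pos[of s] by (auto simp: indicator_def split: if_splits)
      moreover have "radius s *\<^sub>R \<theta> \<in> B"
        using s elim(1) radius_less_R[of s] radius_pos[of s] by (simp add: B_eq)
      ultimately show "P (radius s *\<^sub>R \<theta>)" using N(1) by blast
    qed
  qed
qed

text \<open>The passage back from the half line: a null set of levels corresponds to a null set of
  points of the ball.\<close>

lemma AE_level:
  assumes "AE s in half_line. P s"
  shows "AE x in lborel. x \<in> B \<longrightarrow> P (level x)"
proof -
  have "AE s in lborel. 0 < s \<longrightarrow> P s" using assms by (simp add: AE_half_line)
  then obtain N where N: "{s. \<not> (0 < s \<longrightarrow> P s)} \<subseteq> N" "emeasure lborel N = 0" "N \<in> sets borel"
    by (auto elim!: AE_E)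
  note [measurable] = N(3)
  have "AE s in lborel. s \<notin> N"
    using N by (intro AE_not_in) auto
  then have "(\<integral>\<^sup>+s. ennreal (weight s) * indicator N s \<partial>half_line) = (\<integral>\<^sup>+s. 0 \<partial>half_line)"
    by (intro nn_integral_cong_AE) (auto simp: AE_half_line elim: eventually_mono)
  then have "(\<integral>\<^sup>+x\<in>B. indicator N (level x) \<partial>lborel) = 0"
    by (simp add: radial_nn_integral)
  then have "AE x in lborel. indicator N (level x) * indicator B x = (0::ennreal)"
    by (subst (asm) nn_integral_0_iff_AE) auto
  with AE_lborel_singleton[of "0::real^'n"] show ?thesis
    by eventually_elim (use N(1) level_pos in \<open>auto simp: indicator_def split: if_splits\<close>)
qed

end

section \<open>Derivatives and primitives of half-line test functions\<close>

lemma test_half_line_deriv: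
  assumes "g \<in> test_half_line"
  obtains g' where "g' \<in> test_half_line" "\<And>s. (g has_real_derivative g' s) (at s)"
proof -
  obtain a b where g: "smooth g" "0 < a" "a \<le> b" "\<And>s. g s \<noteq> 0 \<Longrightarrow> a \<le> s \<and> s \<le> b"
    using assms by (auto simp: test_half_line_def)
  obtain g' where g': "smooth g'" "\<And>s. (g has_real_derivative g' s) (at s)"
    using smooth_has_real_derivative[OF g(1)] by blast
  have "g' s = 0" if "s \<notin> {a..b}" for s
  proof -
    have "(g has_real_derivative 0) (at s)"
      by (rule has_field_derivative_transform_within_open[of "\<lambda>_. 0" _ _ "- {a..b}"])
         (use that g(4) in \<open>force intro: open_Compl\<close>)+
    then show ?thesis using g'(2) DERIV_unique by blast
  qed
  then have "g' \<in> test_half_line"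
    using g g'(1) unfolding test_half_line_def by fastforce
  then show ?thesis using g'(2) by (rule that)
qed

lemma primitive_test_half_line:
  assumes "g \<in> test_half_line"
  obtains a b where "0 < a" "a \<le> b" "\<And>s. s \<le> a \<Longrightarrow> primitive g s = 0"
    "\<And>s. b \<le> s \<Longrightarrow> primitive g s = primitive g b" "\<And>s. (primitive g has_real_derivative g s) (at s)"
    "\<And>s. g s \<noteq> 0 \<Longrightarrow> a < s \<and> s < b"
proof -
  obtain a' b' where g: "smooth g" "0 < a'" "a' \<le> b'" "\<And>s. g s \<noteq> 0 \<Longrightarrow> a' \<le> s \<and> s \<le> b'"
    using assms by (auto simp: test_half_line_def)
  \<comment> \<open>The slack on both sides puts the support of \<open>g\<close> strictly between
    \<open>a\<close> and \<open>b\<close>.\<close>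
  define a b where "a = a' / 2" and "b = b' + 1"
  have ab: "0 < a" "a < a'" "b' < b" using g by (auto simp: a_def b_def)
  have low: "primitive g s = 0" if "s < a'" for s
  proof -
    have "(\<lambda>t. indicator {0<..s} t *\<^sub>R g t) = (\<lambda>_. 0)"
      using g(4) that by (force simp: fun_eq_iff indicator_def)
    then show ?thesis by (simp add: primitive_def set_lebesgue_integral_def)
  qed
  have high: "primitive g s = primitive g b" if "b \<le> s" for s
  proof -
    have "(\<lambda>t. indicator {0<..s} t *\<^sub>R g t) = (\<lambda>t. indicator {0<..b} t *\<^sub>R g t)"
      using g(4) that ab by (force simp: fun_eq_iff indicator_def)
    then show ?thesis by (simp add: primitive_def set_lebesgue_integral_def)
  qed
  have deriv: "(primitive g has_real_derivative g s) (at s)" for s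
  proof (cases "0 < s")
    case True
    have eq: "integral {0..t} g = primitive g t" for t
    proof -
      have int: "set_integrable lborel {0..t} g"
        by (intro borel_integrable_atLeastAtMost' smooth_continuous_on g)
      have "g 0 = 0" using g by force
      then have "(\<lambda>x. indicator {0<..t} x *\<^sub>R g x) = (\<lambda>x. indicator {0..t} x *\<^sub>R g x)"
        by (auto simp: fun_eq_iff indicator_def less_le)
      then have "primitive g t = (LINT x:{0..t}|lborel. g x)"
        by (simp add: primitive_def set_lebesgue_integral_def)
      then show ?thesis
        using set_borel_integral_eq_integral(2)[OF int] by simp
    qed
    have "((\<lambda>t. integral {0..t} g) has_real_derivative g s) (at s)"
      by (rule integral_from_0_deriv[of "s + 1"]) (use True g in \<open>auto intro: smooth_continuous_on\<close>)
    then show ?thesis by (simp add: eq)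
  next
    case False
    have "(primitive g has_real_derivative 0) (at s)"
      by (rule has_field_derivative_transform_within_open[of "\<lambda>_. 0" _ _ "{..<a'}"])
         (use False g(2) low in auto)
    moreover have "g s = 0" using False g by force
    ultimately show ?thesis by simp
  qed
  show ?thesis
  proof (rule that[of a b])
    show "a < s \<and> s < b" if "g s \<noteq> 0" for s
      using g(4)[OF that] ab by linarith
    show "primitive g s = 0" if "s \<le> a" for s
      using low[of s] that ab by linarith
    show "primitive g s = primitive g b" if "b \<le> s" for s
      by (rule high[OF that])
    show "a \<le> b" using ab g(3) by linarith
  qed (rule ab deriv)+
qed

lemma primitive_borel [measurable]:
  assumes [measurable]: "g \<in> borel_measurable borel"
  shows "primitive g \<in> borel_measurable borel"
proof -
  have "Measurable.pred (borel \<Otimes>\<^sub>M borel) (\<lambda>x :: real \<times> real. snd x \<in> {0<..fst x})"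
    unfolding greaterThanAtMost_iff by measurable
  then have "(\<lambda>x :: real \<times> real. indicator {0<..fst x} (snd x) *\<^sub>R g (snd x)) \<in> borel_measurable (borel \<Otimes>\<^sub>M borel)"
    by measurable
  then have "(\<lambda>s. LINT t|lborel. indicator {0<..s} t *\<^sub>R g t) \<in> borel_measurable borel"
    by (intro lborel.borel_measurable_lebesgue_integral) (simp add: split_beta cong: measurable_cong_sets sets_pair_measure_cong)
  then show ?thesis
    by (simp add: primitive_def[abs_def] set_lebesgue_integral_def)
qed

text \<open>Hoelder's inequality on \<open>{0<..s}\<close>. The growth rate
  \<open>s powr (1 - 1 / p)\<close> is slow enough for the p-th power of a primitive to be
  integrable against \<open>weight\<close>.\<close>

lemma abs_primitive_le_moment:
  assumes [measurable]: "g \<in> borel_measurable borel"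
    and "moment p half_line g \<le> ennreal E" "0 < E" "1 < p" "0 < s"
  shows "set_integrable lborel {0<..s} g" "\<bar>primitive g s\<bar> \<le> E powr (1 / p) * s powr (1 - 1 / p)"
proof -
  define M where "M = restrict_space lborel {0<..s}"
  have [measurable]: "g \<in> borel_measurable M"
    unfolding M_def by (intro measurable_restrict_space1) simp
  have "(\<integral>\<^sup>+t\<in>{0<..s}. ennreal \<bar>g t\<bar> \<partial>lborel) = (\<integral>\<^sup>+t. ennreal (norm (g t)) \<partial>M)"
    unfolding M_def by (subst nn_integral_restrict_space) auto
  also have "\<dots> \<le> ennreal (E powr (1 / p) * s powr (1 - 1 / p))"
  proof (rule nn_integral_le_moment)
    show "moment p M g \<le> ennreal E"
      using moment_restrict_le_half_line[of g p s] assms(2) by (simp add: M_def)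
    show "emeasure M (space M) \<le> ennreal s"
      using assms(5) by (simp add: M_def space_restrict_space emeasure_restrict_space)
  qed (use assms in auto)
  finally have bound: "(\<integral>\<^sup>+t\<in>{0<..s}. ennreal \<bar>g t\<bar> \<partial>lborel) \<le> ennreal (E powr (1 / p) * s powr (1 - 1 / p))" .
  show "\<bar>primitive g s\<bar> \<le> E powr (1 / p) * s powr (1 - 1 / p)"
    using order_trans[OF abs_primitive_le bound] by (subst (asm) ennreal_le_iff) auto
  have "(\<integral>\<^sup>+t. ennreal (norm (indicator {0<..s} t *\<^sub>R g t)) \<partial>lborel) = (\<integral>\<^sup>+t\<in>{0<..s}. ennreal \<bar>g t\<bar> \<partial>lborel)"
    by (intro nn_integral_cong) (auto simp: indicator_def)
  also have "\<dots> < \<infinity>" using bound by (rule le_less_trans) simp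
  finally show "set_integrable lborel {0<..s} g"
    unfolding set_integrable_def by (intro integrableI_bounded) auto
qed

section \<open>Radial gradients and a Poincare inequality\<close>

context radial_ball
begin

text \<open>The chain rule for \<open>primitive g (level x)\<close>: the radial derivative of
  \<open>level\<close> is \<open>- \<alpha> * norm x powr (- \<alpha> - 1)\<close>, and the
  remaining power of the norm normalises \<open>x\<close>. The sign records that levels increase
  towards the origin.\<close>

definition radial_gradient :: "(real \<Rightarrow> real) \<Rightarrow> real^'n \<Rightarrow> real^'n" where
  "radial_gradient g x = (- (\<alpha> * norm x powr (- \<alpha> - 2) * g (level x))) *\<^sub>R x"

definition energy_const :: real where
  "energy_const = unit_ball_vol n * n * \<alpha> powr (p - 1)"

lemma energy_const_pos: "0 < energy_const"
  using n_pos alpha_pos by (simp add: energy_const_def unit_ball_vol_pos)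

lemma radial_gradient_borel [measurable]:
  assumes [measurable]: "g \<in> borel_measurable borel"
  shows "radial_gradient g \<in> borel_measurable borel"
  unfolding radial_gradient_def[abs_def] by measurable

lemma nn_integral_lebesgue_on_B:
  "integral\<^sup>N (lebesgue_on B) F = (\<integral>\<^sup>+x\<in>B. F x \<partial>lborel)"
  by (subst nn_integral_restrict_space) (auto simp: nn_integral_completion)

lemma AE_lebesgue_on_B: "(AE x in lebesgue_on B. P x) \<longleftrightarrow> (AE x in lborel. x \<in> B \<longrightarrow> P x)"
  by (subst AE_restrict_space_iff) (auto simp: AE_completion_iff)

text \<open>By \<open>\<gamma> / p = 1 + 1 / \<alpha>\<close>, the p-th power of
  \<open>\<alpha> * radius s powr (- \<alpha> - 1)\<close> is
  \<open>\<alpha> powr p * (s + c) powr \<gamma>\<close>. It cancels the power in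
  \<open>weight\<close>, leaving the constant \<open>n * \<alpha> powr (p - 1)\<close>.\<close>

lemma moment_radial_gradient:
  assumes [measurable]: "g \<in> borel_measurable borel"
  shows "moment p (lebesgue_on B) (radial_gradient g) = ennreal energy_const * moment p half_line g"
proof -
  define h where "h s = ennreal ((\<alpha> * radius s powr (- \<alpha> - 1) * \<bar>g s\<bar>) powr p)" for s
  have "moment p (lebesgue_on B) (radial_gradient g) = (\<integral>\<^sup>+x\<in>B. h (level x) \<partial>lborel)"
    unfolding moment_def nn_integral_lebesgue_on_B
  proof (intro nn_integral_cong_AE, use AE_lborel_singleton[of "0::real^'n"] in eventually_elim)
    case (elim x)
    have "norm x powr (- \<alpha> - 2) * norm x = norm x powr (- \<alpha> - 1)"
    proof -
      have "- \<alpha> - 1 = (- \<alpha> - 2) + 1" by linarith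
      then have "norm x powr (- \<alpha> - 1) = norm x powr (- \<alpha> - 2) * norm x powr 1"
        by (simp only: powr_add)
      with elim show ?thesis by simp
    qed
    then have "norm (radial_gradient g x) = \<alpha> * norm x powr (- \<alpha> - 1) * \<bar>g (level x)\<bar>"
      using alpha_pos by (simp add: radial_gradient_def abs_mult mult_ac)
    then show ?case
      using elim by (auto simp: h_def indicator_def radius_level)
  qed
  also have "\<dots> = ennreal (unit_ball_vol n) * (\<integral>\<^sup>+s. ennreal (weight s) * h s \<partial>half_line)"
    by (rule radial_nn_integral) (simp add: h_def[abs_def])
  also have "(\<integral>\<^sup>+s. ennreal (weight s) * h s \<partial>half_line)
      = (\<integral>\<^sup>+s. ennreal (n * \<alpha> powr (p - 1)) * ennreal (norm (g s) powr p) \<partial>half_line)"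
  proof (rule nn_integral_cong)
    fix s assume "s \<in> space half_line"
    then have s: "0 < s + c" using c_pos by simp
    have "(- 1 / \<alpha>) * ((- \<alpha> - 1) * p) = \<gamma>"
      using gamma_div_p p_gt_1 alpha_pos by (simp add: field_simps)
    then have "(radius s powr (- \<alpha> - 1)) powr p = (s + c) powr \<gamma>"
      by (simp add: radius_def powr_powr)
    then have "(\<alpha> * radius s powr (- \<alpha> - 1) * \<bar>g s\<bar>) powr p = \<alpha> powr p * (s + c) powr \<gamma> * \<bar>g s\<bar> powr p"
      using alpha_pos by (simp add: powr_mult)
    moreover have "\<alpha> powr p = \<alpha> * \<alpha> powr (p - 1)"
      using alpha_pos powr_add[of \<alpha> 1 "p - 1"] by simp
    moreover have "(s + c) powr (- \<gamma>) * (s + c) powr \<gamma> = 1"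
      using s by (simp add: powr_add[symmetric])
    ultimately have "weight s * (\<alpha> * radius s powr (- \<alpha> - 1) * \<bar>g s\<bar>) powr p = n * \<alpha> powr (p - 1) * \<bar>g s\<bar> powr p"
      using alpha_pos by (simp add: weight_def)
    then show "ennreal (weight s) * h s = ennreal (n * \<alpha> powr (p - 1)) * ennreal (norm (g s) powr p)"
      using weight_pos[of s] \<open>s \<in> space half_line\<close> n_pos
      by (simp add: h_def ennreal_mult[symmetric])
  qed
  also have "\<dots> = ennreal (n * \<alpha> powr (p - 1)) * moment p half_line g"
    unfolding moment_def by (rule nn_integral_cmult) (auto intro: half_line_borel)
  finally show ?thesis
    using n_pos by (simp add: energy_const_def ennreal_mult mult.assoc unit_ball_vol_nonneg)
qed

definition poincare_const :: real where
  "poincare_const = unit_ball_vol n * (n / \<alpha> * (c powr (- (p / \<alpha>)) * (\<alpha> / p)))"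

lemma poincare_const_pos: "0 < poincare_const"
  using n_pos alpha_pos c_pos p_gt_1 by (simp add: poincare_const_def unit_ball_vol_pos)

text \<open>Replacing \<open>s powr (p - 1)\<close> by \<open>(s + c) powr (p - 1)\<close> leaves
  the single power \<open>- (p / \<alpha>) - 1\<close> of \<open>s + c\<close>, whose integral is
  explicit and finite because \<open>c > 0\<close>. This is the origin of
  \<open>poincare_const\<close>.\<close>

lemma nn_integral_weight_powr:
  "ennreal (unit_ball_vol n) * (\<integral>\<^sup>+s. ennreal (weight s) * ennreal (s powr (p - 1)) \<partial>half_line) \<le> ennreal poincare_const"
proof -
  have "(\<integral>\<^sup>+s. ennreal (weight s) * ennreal (s powr (p - 1)) \<partial>half_line)
      \<le> (\<integral>\<^sup>+s. ennreal (n / \<alpha> * (s + c) powr (- (p / \<alpha>) - 1)) * indicator {0..} s \<partial>lborel)"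
    unfolding nn_integral_half_line
  proof (rule nn_integral_mono)
    fix s :: real
    have "weight s * s powr (p - 1) \<le> n / \<alpha> * (s + c) powr (- (p / \<alpha>) - 1)" if s: "0 < s"
    proof -
      have "s powr (p - 1) \<le> (s + c) powr (p - 1)"
        using s c_pos p_gt_1 by (intro powr_mono2) auto
      then have "weight s * s powr (p - 1) \<le> weight s * (s + c) powr (p - 1)"
        using weight_pos[of s] s by (intro mult_left_mono) auto
      also have "\<dots> = n / \<alpha> * ((s + c) powr (- \<gamma>) * (s + c) powr (p - 1))"
        by (simp add: weight_def)
      also have "(s + c) powr (- \<gamma>) * (s + c) powr (p - 1) = (s + c) powr (- (p / \<alpha>) - 1)"
      proof -
        have "- \<gamma> + (p - 1) = - (p / \<alpha>) - 1"
          using gamma_div_p p_gt_1 by (simp add: field_simps)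
        then show ?thesis by (simp only: powr_add[symmetric])
      qed
      finally show ?thesis .
    qed
    then show "ennreal (weight s) * ennreal (s powr (p - 1)) * indicator {0<..} s
        \<le> ennreal (n / \<alpha> * (s + c) powr (- (p / \<alpha>) - 1)) * indicator {0..} s"
      using weight_pos[of s] by (auto simp: indicator_def ennreal_mult[symmetric] intro: ennreal_leI)
  qed
  also have "\<dots> = ennreal (0 - (- (n / \<alpha> * ((0 + c) powr (- (p / \<alpha>)) * (\<alpha> / p)))))"
  proof (rule nn_integral_FTC_atLeast)
    have "0 < p / \<alpha>" using p_gt_1 alpha_pos by simp
    then have "((\<lambda>s. (s + c) powr (- (p / \<alpha>))) \<longlongrightarrow> 0) at_top"
      by real_asymp
    then have "((\<lambda>s. - (n / \<alpha> * ((s + c) powr (- (p / \<alpha>)) * (\<alpha> / p)))) \<longlongrightarrow> - (n / \<alpha> * (0 * (\<alpha> / p)))) at_top"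
      by (intro tendsto_minus tendsto_mult tendsto_const)
    then show "((\<lambda>s. - (n / \<alpha> * ((s + c) powr (- (p / \<alpha>)) * (\<alpha> / p)))) \<longlongrightarrow> 0) at_top" by simp
    fix s :: real assume s: "0 \<le> s"
    then have "0 < s + c" using c_pos by simp
    then have "((\<lambda>s. - (n / \<alpha> * ((s + c) powr (- (p / \<alpha>)) * (\<alpha> / p)))) has_real_derivative
        - (n / \<alpha> * ((- (p / \<alpha>)) * (s + c) powr (- (p / \<alpha>) - of_nat 1) * (1 + 0) * (\<alpha> / p)))) (at s)"
      by (intro DERIV_minus DERIV_cmult DERIV_cmult_right DERIV_fun_powr DERIV_add DERIV_ident DERIV_const)
    then show "((\<lambda>s. - (n / \<alpha> * ((s + c) powr (- (p / \<alpha>)) * (\<alpha> / p)))) has_real_derivative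
        n / \<alpha> * (s + c) powr (- (p / \<alpha>) - 1)) (at s)"
      using alpha_pos p_gt_1 by simp
    show "0 \<le> n / \<alpha> * (s + c) powr (- (p / \<alpha>) - 1)"
      using alpha_pos n_pos by simp
  qed simp
  finally have "(\<integral>\<^sup>+s. ennreal (weight s) * ennreal (s powr (p - 1)) \<partial>half_line)
      \<le> ennreal (n / \<alpha> * (c powr (- (p / \<alpha>)) * (\<alpha> / p)))" by simp
  then have "ennreal (unit_ball_vol n) * (\<integral>\<^sup>+s. ennreal (weight s) * ennreal (s powr (p - 1)) \<partial>half_line)
      \<le> ennreal (unit_ball_vol n) * ennreal (n / \<alpha> * (c powr (- (p / \<alpha>)) * (\<alpha> / p)))"
    by (intro mult_left_mono) auto
  then show ?thesis
    using n_pos by (simp add: poincare_const_def ennreal_mult'[symmetric] unit_ball_vol_nonneg)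
qed

text \<open>A Poincare inequality for radial functions, from Hoelder's bound on primitives
  integrated against \<open>weight\<close>. It makes the function on the ball depend continuously on
  its profile \<open>g\<close>.\<close>

lemma moment_primitive_level_le:
  assumes g [measurable]: "g \<in> borel_measurable borel"
  shows "moment p (lebesgue_on B) (\<lambda>x. primitive g (level x)) \<le> ennreal poincare_const * moment p half_line g"
proof (cases "moment p half_line g")
  case (real E)
  \<comment> \<open>Hoelder's bound is stated for positive energies, so \<open>E\<close> is enlarged
    by \<open>e\<close>, which tends to 0 afterwards.\<close>
  have bound: "moment p (lebesgue_on B) (\<lambda>x. primitive g (level x)) \<le> ennreal (poincare_const * (E + e))"
    if e: "0 < e" for e
  proof -
    have mE: "moment p half_line g \<le> ennreal (E + e)" "0 < E + e"
      using real e by (auto intro: ennreal_leI)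
    have "moment p (lebesgue_on B) (\<lambda>x. primitive g (level x))
        = (\<integral>\<^sup>+x\<in>B. ennreal (norm (primitive g (level x)) powr p) \<partial>lborel)"
      by (simp add: moment_def nn_integral_lebesgue_on_B)
    also have "\<dots> = ennreal (unit_ball_vol n) * (\<integral>\<^sup>+s. ennreal (weight s) * ennreal (norm (primitive g s) powr p) \<partial>half_line)"
      by (rule radial_nn_integral) measurable
    also have "\<dots> \<le> ennreal (unit_ball_vol n) * (\<integral>\<^sup>+s. ennreal (weight s) * (ennreal (s powr (p - 1)) * ennreal (E + e)) \<partial>half_line)"
    proof (intro mult_left_mono nn_integral_mono)
      fix s assume "s \<in> space half_line"
      then have s: "0 < s" by simp
      have "norm (primitive g s) powr p \<le> ((E + e) powr (1 / p) * s powr (1 - 1 / p)) powr p"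
        using abs_primitive_le_moment(2)[OF g mE p_gt_1 s] p_gt_1 by (intro powr_mono2) auto
      also have "\<dots> = (E + e) * s powr (p - 1)"
        using mE(2) s p_gt_1 by (simp add: powr_mult powr_powr left_diff_distrib)
      finally show "ennreal (norm (primitive g s) powr p) \<le> ennreal (s powr (p - 1)) * ennreal (E + e)"
        using mE(2) by (simp add: ennreal_mult[symmetric] ennreal_leI mult.commute)
    qed auto
    also have "\<dots> = ennreal (unit_ball_vol n) * (\<integral>\<^sup>+s. ennreal (weight s) * ennreal (s powr (p - 1)) \<partial>half_line) * ennreal (E + e)"
      by (simp add: mult.assoc[symmetric] nn_integral_multc half_line_borel)
    also have "\<dots> \<le> ennreal poincare_const * ennreal (E + e)"
      by (intro mult_right_mono nn_integral_weight_powr) auto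
    finally show ?thesis
      using poincare_const_pos mE by (simp add: ennreal_mult)
  qed
  have "((\<lambda>e. ennreal (poincare_const * (E + e))) \<longlongrightarrow> ennreal (poincare_const * (E + 0))) (at_right 0)"
    by (intro tendsto_ennrealI tendsto_intros)
  then have "moment p (lebesgue_on B) (\<lambda>x. primitive g (level x)) \<le> ennreal (poincare_const * (E + 0))"
    by (rule tendsto_lowerbound) (use bound in \<open>auto intro!: eventually_at_rightI[of 0 1]\<close>)
  then show ?thesis
    using real poincare_const_pos by (simp add: ennreal_mult)
next
  case top
  then show ?thesis
    using poincare_const_pos by (simp add: ennreal_mult_top)
qed

end

lemma moment_half_line_imp_set_integrable:
  fixes g :: "real \<Rightarrow> real"
  assumes "g \<in> borel_measurable borel" "moment p half_line g < \<infinity>" "1 < p" "0 < s"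
  shows "set_integrable lborel {0<..s} g"
proof -
  obtain E where "moment p half_line g = ennreal E" "0 \<le> E"
    using assms(2) by (cases "moment p half_line g") auto
  then have "moment p half_line g \<le> ennreal (E + 1)" "0 < E + 1"
    by (auto intro: ennreal_leI)
  from abs_primitive_le_moment(1)[OF assms(1) this assms(3,4)] show ?thesis .
qed

lemma primitive_diff:
  assumes "set_integrable lborel {0<..s} g" "set_integrable lborel {0<..s} h"
  shows "primitive (\<lambda>t. g t - h t) s = primitive g s - primitive h s"
  unfolding primitive_def by (rule set_integral_diff(2)[OF assms])

lemma moment_test_half_line_finite:
  assumes "g \<in> test_half_line" "0 < p"
  shows "moment p half_line g < \<infinity>"
proof -
  obtain a b where g: "smooth g" "0 < a" "a \<le> b" "\<And>s. g s \<noteq> 0 \<Longrightarrow> a \<le> s \<and> s \<le> b"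
    using assms by (auto simp: test_half_line_def)
  have "compact (g ` {a..b})"
    using g by (intro compact_continuous_image smooth_continuous_on) auto
  then obtain C where "\<forall>s\<in>{a..b}. \<bar>g s\<bar> \<le> C"
    by (auto simp: bounded_iff dest!: compact_imp_bounded)
  then have C: "\<bar>g s\<bar> powr p \<le> C powr p" if "s \<in> {a..b}" for s
    using that assms(2) by (intro powr_mono2) auto
  have "moment p half_line g \<le> (\<integral>\<^sup>+s. ennreal (C powr p) * indicator {a..b} s \<partial>lborel)"
    unfolding moment_def nn_integral_half_line
  proof (rule nn_integral_mono)
    fix s
    show "ennreal (norm (g s) powr p) * indicator {0<..} s \<le> ennreal (C powr p) * indicator {a..b} s"
      using C[of s] g(4)[of s] assms(2)
      by (cases "s \<in> {a..b}") (auto simp: indicator_def intro: ennreal_leI)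
  qed
  also have "\<dots> < \<infinity>"
    by (simp add: nn_integral_cmult ennreal_mult_less_top emeasure_lborel_Icc_eq)
  finally show ?thesis .
qed

section \<open>From profiles on the half line to radial Sobolev functions\<close>

context radial_ball
begin

text \<open>The variable \<open>t\<close> stands for the squared norm, which unlike the norm is
  smooth at the origin. Derivatives of such functions are linear combinations of functions of the
  same form, with other \<open>\<beta>\<close> and other \<open>g\<close>. All of them vanish near
  \<open>t = 0\<close>, where the level exceeds the support of \<open>g\<close>.\<close>

lemma smooth_powr_test_half_line:
  assumes "g \<in> test_half_line"
  shows "smooth (\<lambda>t. if 0 < t then t powr \<beta> * g (t powr (- \<alpha> / 2) - c) else 0)"
proof -
  define e where "e \<beta> g t = (if 0 < t then t powr \<beta> * g (t powr (- \<alpha> / 2) - c) else 0)"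
    for \<beta> t :: real and g :: "real \<Rightarrow> real"
  have zero: "\<exists>t0>0. \<forall>t<t0. \<forall>\<beta>. e \<beta> g t = 0" if "g \<in> test_half_line" for g
  proof -
    obtain a b where g: "0 < a" "a \<le> b" "\<And>s. g s \<noteq> 0 \<Longrightarrow> a \<le> s \<and> s \<le> b"
      using \<open>g \<in> test_half_line\<close> by (auto simp: test_half_line_def)
    \<comment> \<open>The value of \<open>t\<close> at which the level equals
      \<open>b\<close>.\<close>
    define t0 where "t0 = (b + c) powr (- 2 / \<alpha>)"
    have bc: "0 < b + c" using g c_pos by simp
    have t0: "0 < t0" "t0 powr (- \<alpha> / 2) = b + c"
      using bc alpha_pos by (auto simp: t0_def powr_powr)
    have "g (t powr (- \<alpha> / 2) - c) = 0" if "0 < t" "t < t0" for t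
    proof -
      have "b < t powr (- \<alpha> / 2) - c"
        using powr_less_mono2_neg[of "- \<alpha> / 2" t t0] that alpha_pos t0 by simp
      then show ?thesis using g(3) by force
    qed
    then show ?thesis using t0(1) by (auto simp: e_def intro!: exI[of _ t0])
  qed
  have deriv: "(e \<beta> g has_real_derivative \<beta> * e (\<beta> - 1) g t + (- \<alpha> / 2) * e (\<beta> + (- \<alpha> / 2 - 1)) g' t) (at t)"
    if g: "g \<in> test_half_line" "g' \<in> test_half_line" and g': "\<And>s. (g has_real_derivative g' s) (at s)"
    for g g' \<beta> t
  proof (cases "0 < t")
    case True
    have "((\<lambda>t. g (t powr (- \<alpha> / 2) - c)) has_real_derivative
        g' (t powr (- \<alpha> / 2) - c) * ((- \<alpha> / 2) * t powr (- \<alpha> / 2 - 1) - 0)) (at t)"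
      by (rule DERIV_chain2[OF g']) (intro DERIV_diff DERIV_const has_real_derivative_powr True)
    from DERIV_mult[OF has_real_derivative_powr[OF True, of \<beta>] this]
    have "((\<lambda>t. t powr \<beta> * g (t powr (- \<alpha> / 2) - c)) has_real_derivative
       \<beta> * e (\<beta> - 1) g t + (- \<alpha> / 2) * e (\<beta> + (- \<alpha> / 2 - 1)) g' t) (at t)"
      using True unfolding e_def powr_add by (simp add: mult_ac)
    then show ?thesis
      by (rule has_field_derivative_transform_within_open[of _ _ _ "{0<..}"])
         (use True in \<open>auto simp: e_def\<close>)
  next
    case False
    obtain t0 where t0: "t0 > 0" "\<And>t \<beta>. t < t0 \<Longrightarrow> e \<beta> g t = 0" using zero[OF g(1)] by blast
    have "(e \<beta> g has_real_derivative 0) (at t)"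
      by (rule has_field_derivative_transform_within_open[of "\<lambda>_. 0" _ _ "{..<t0}"])
         (use False t0 in auto)
    moreover have "e (\<beta> - 1) g t = 0" "e (\<beta> + (- \<alpha> / 2 - 1)) g' t = 0"
      using False by (auto simp: e_def)
    ultimately show ?thesis by simp
  qed
  have "smooth_upto k (e \<beta> g)" if "g \<in> test_half_line" for k \<beta> g
    using that
  proof (induction k arbitrary: \<beta> g)
    case (0 \<beta> g)
    obtain g' where g': "g' \<in> test_half_line" "\<And>s. (g has_real_derivative g' s) (at s)"
      using test_half_line_deriv[OF 0] by blast
    have "isCont (e \<beta> g) t" for t
      using DERIV_isCont[OF deriv[OF 0 g']] .
    then show ?case by (simp add: continuous_at_imp_continuous_on)
  next
    case (Suc k \<beta> g)
    obtain g' where g': "g' \<in> test_half_line" "\<And>s. (g has_real_derivative g' s) (at s)"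
      using test_half_line_deriv[OF Suc.prems] by blast
    show ?case
    proof (rule smooth_uptoI)
      show "(e \<beta> g has_derivative
          (\<lambda>v. v * (\<beta> * e (\<beta> - 1) g t + (- \<alpha> / 2) * e (\<beta> + (- \<alpha> / 2 - 1)) g' t))) (at t)" for t
        using deriv[OF Suc.prems g', of \<beta> t] unfolding has_field_derivative_def mult_commute_abs .
      show "smooth_upto k (\<lambda>t. v * (\<beta> * e (\<beta> - 1) g t + (- \<alpha> / 2) * e (\<beta> + (- \<alpha> / 2 - 1)) g' t))" for v
        using Suc.IH Suc.prems g'(1) by (intro smooth_upto_mult smooth_upto_add smooth_upto_const) auto
    qed
  qed
  with assms show ?thesis
    unfolding smooth_def e_def by blast
qed

lemma norm_square_powr: "((norm x)\<^sup>2) powr (- \<alpha> / 2) - c = level x" if "x \<noteq> 0" for x :: "real^'n"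
proof -
  have "(norm x)\<^sup>2 = norm x powr 2" using that by simp
  then show ?thesis by (simp only: powr_powr level_def) simp
qed

text \<open>Beyond \<open>b\<close>, that is near the origin, \<open>primitive g\<close> is
  constant, so \<open>H\<close> extends smoothly to \<open>t \<le> 0\<close>. Below
  \<open>a\<close>, that is near the boundary of the ball, it is 0, which gives compact
  support.\<close>

lemma test_function_of_half_line:
  assumes g: "g \<in> test_half_line"
  obtains \<phi> where "\<phi> \<in> test_functions B" "\<And>x. x \<noteq> 0 \<Longrightarrow> \<phi> x = primitive g (level x)"
    "\<And>x. x \<noteq> 0 \<Longrightarrow> gradient \<phi> x = radial_gradient g x"
proof -
  obtain a b where ab: "0 < a" "a \<le> b" and low: "\<And>s. s \<le> a \<Longrightarrow> primitive g s = 0"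
    and high: "\<And>s. b \<le> s \<Longrightarrow> primitive g s = primitive g b"
    and deriv: "\<And>s. (primitive g has_real_derivative g s) (at s)"
    and supp: "\<And>s. g s \<noteq> 0 \<Longrightarrow> a < s \<and> s < b"
    by (rule primitive_test_half_line[OF g]) blast
  define H where "H t = (if 0 < t then primitive g (t powr (- \<alpha> / 2) - c) else primitive g b)" for t
  define h where "h t = (- \<alpha> / 2) * (if 0 < t then t powr (- \<alpha> / 2 - 1) * g (t powr (- \<alpha> / 2) - c) else 0)" for t
  have h_smooth: "smooth h"
    unfolding h_def[abs_def] by (intro smooth_cmult smooth_powr_test_half_line g)
  have H_deriv: "(H has_real_derivative h t) (at t)" for t
  proof (cases "0 < t")
    case True
    have "((\<lambda>t. primitive g (t powr (- \<alpha> / 2) - c)) has_real_derivative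
        g (t powr (- \<alpha> / 2) - c) * ((- \<alpha> / 2) * t powr (- \<alpha> / 2 - 1) - 0)) (at t)"
      by (rule DERIV_chain2[OF deriv]) (intro DERIV_diff DERIV_const has_real_derivative_powr True)
    then have "((\<lambda>t. primitive g (t powr (- \<alpha> / 2) - c)) has_real_derivative h t) (at t)"
      using True by (simp add: h_def mult_ac)
    then show ?thesis
      by (rule has_field_derivative_transform_within_open[of _ _ _ "{0<..}"])
         (use True in \<open>auto simp: H_def\<close>)
  next
    case False
    define t0 where "t0 = (b + c) powr (- 2 / \<alpha>)"
    have bc: "0 < b + c" using ab c_pos by simp
    have t0: "0 < t0" "t0 powr (- \<alpha> / 2) = b + c"
      using bc alpha_pos by (auto simp: t0_def powr_powr)
    have H_const: "H t = primitive g b" if "t < t0" for t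
    proof (cases "0 < t")
      case True
      then have "b \<le> t powr (- \<alpha> / 2) - c"
        using powr_less_mono2_neg[of "- \<alpha> / 2" t t0] that alpha_pos t0 by simp
      from high[OF this] True show ?thesis by (simp only: H_def if_True)
    qed (simp add: H_def)
    have "(H has_real_derivative 0) (at t)"
    proof (rule has_field_derivative_transform_within_open[of "\<lambda>_. primitive g b" _ _ "{..<t0}"])
      show "primitive g b = H s" if "s \<in> {..<t0}" for s
        using H_const[of s] that by simp
      show "t \<in> {..<t0}" using False t0(1) by simp
    qed (rule DERIV_const open_lessThan)+
    then show ?thesis using False by (simp add: h_def)
  qed
  have H_smooth: "smooth H"
  proof (rule smoothI_derivative)
    show "(H has_derivative (\<lambda>v. v * h t)) (at t)" for t
      using H_deriv[of t] unfolding has_field_derivative_def mult_commute_abs .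
    show "smooth (\<lambda>t. v * h t)" for v by (intro smooth_cmult h_smooth)
  qed
  define \<phi> where "\<phi> x = H ((norm x)\<^sup>2)" for x :: "real^'n"
  have \<phi>_smooth: "smooth \<phi>"
    unfolding \<phi>_def[abs_def] by (rule smooth_compose[OF H_smooth smooth_norm_square])
  have \<phi>_eq: "\<phi> x = primitive g (level x)" if "x \<noteq> 0" for x
    using that norm_square_powr[OF that] by (simp add: \<phi>_def H_def)
  have test: "\<phi> \<in> test_functions B"
  proof (rule test_functionsI[OF \<phi>_smooth compact_cball])
    show "cball 0 (radius a) \<subseteq> B"
      using radius_less_R[OF ab(1)] by (auto simp: B_eq)
    fix x :: "real^'n" assume x: "x \<notin> cball 0 (radius a)"
    then have x0: "x \<noteq> 0" "radius a < norm x" using radius_pos[of a] ab by auto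
    then have "level x \<le> a"
      using radius_less_iff[of a "norm x"] ab by (simp add: level_def)
    then show "\<phi> x = 0" using \<phi>_eq[OF x0(1)] low by simp
  qed
  have grad: "gradient \<phi> x = radial_gradient g x" if x: "x \<noteq> 0" for x
  proof -
    have "((\<lambda>x::real^'n. x \<bullet> x) has_derivative (\<lambda>v. x \<bullet> v + v \<bullet> x)) (at x)"
      by (intro has_derivative_inner has_derivative_ident)
    moreover have "(H has_derivative (\<lambda>v. v * h ((norm x)\<^sup>2))) (at (x \<bullet> x))"
      using H_deriv[of "(norm x)\<^sup>2"]
      unfolding has_field_derivative_def mult_commute_abs power2_norm_eq_inner .
    ultimately have "(\<phi> has_derivative (\<lambda>v. (x \<bullet> v + v \<bullet> x) * h ((norm x)\<^sup>2))) (at x)"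
      unfolding \<phi>_def[abs_def] power2_norm_eq_inner by (rule has_derivative_compose)
    from frechet_derivative_at[OF this, symmetric]
    have "gradient \<phi> x = (2 * h ((norm x)\<^sup>2)) *\<^sub>R x"
      by (simp add: gradient_def vec_eq_iff inner_axis inner_commute[of "axis _ _"])
    moreover have "2 * h ((norm x)\<^sup>2) = - (\<alpha> * norm x powr (- \<alpha> - 2) * g (level x))"
    proof -
      have "(norm x)\<^sup>2 = norm x powr 2" using x by simp
      then have "((norm x)\<^sup>2) powr (- \<alpha> / 2 - 1) = norm x powr (2 * (- \<alpha> / 2 - 1))"
        by (simp only: powr_powr)
      also have "2 * (- \<alpha> / 2 - 1) = - \<alpha> - 2" by simp
      finally show ?thesis
        using x norm_square_powr[OF x] by (simp add: h_def)
    qed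
    ultimately show ?thesis by (simp add: radial_gradient_def)
  qed
  show ?thesis using test \<phi>_eq grad by (rule that)
qed

lemma Lp_space_B_locally_integrable:
  fixes f :: "real^'n \<Rightarrow> 'b::euclidean_space"
  assumes "f \<in> Lp_space p B"
  shows "locally_integrable B f"
  using assms unfolding B_eq
  by (intro integrable_imp_locally_integrable Lp_space_ball_integrable[OF _ p_gt_1]) auto

lemma radial_gradient_diff:
  "radial_gradient (\<lambda>s. g s - h s) x = radial_gradient g x - radial_gradient h x"
proof -
  have "- (k * (a - b)) = - (k * a) - - (k * b)" for k a b :: real
    by (simp add: right_diff_distrib)
  then show ?thesis
    unfolding radial_gradient_def by (simp only: scaleR_diff_left)
qed

text \<open>The maps from \<open>g\<close> to \<open>primitive g (level x)\<close> and to
  \<open>radial_gradient g\<close> are bounded between the L^p spaces, by the Poincare inequality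
  and the energy identity. Approximating \<open>g\<close> therefore approximates \<open>u\<close>
  and its gradient simultaneously, and the weak gradient of \<open>u\<close> is identified as a
  limit.\<close>

lemma primitive_level_sobolev:
  assumes g [measurable]: "g \<in> borel_measurable borel" and fin: "moment p half_line g < \<infinity>"
    and u: "AE x in lebesgue_on B. u x = primitive g (level x)"
  shows "u \<in> radial_sobolev_space0 p B" and "is_weak_gradient B u (radial_gradient g)"
    and "radial_gradient g \<in> Lp_space p B"
proof -
  have p1: "1 \<le> p" using p_gt_1 by simp
  have B_leb: "B \<in> sets lebesgue" by (simp add: B_eq)
  define v where "v x = primitive g (level x)" for x
  have [measurable]: "v \<in> borel_measurable borel" unfolding v_def by measurable
  have "moment p (lebesgue_on B) v \<le> ennreal poincare_const * moment p half_line g"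
    unfolding v_def by (rule moment_primitive_level_le[OF g])
  also have "\<dots> < \<infinity>"
    using fin by (simp add: ennreal_mult_less_top)
  finally have "moment p (lebesgue_on B) v < \<infinity>" .
  then have v_Lp: "v \<in> Lp_space p B"
    by (auto simp: Lp_space_iff_moment intro: borel_imp_lebesgue_on)
  have uv: "AE x in lebesgue_on B. v x = u x" using u by (auto simp: v_def elim: eventually_mono)
  have u_Lp: "u \<in> Lp_space p B" by (rule Lp_space_cong_AE[OF v_Lp B_leb uv])
  show grad_Lp: "radial_gradient g \<in> Lp_space p B"
    using fin by (auto simp: Lp_space_iff_moment moment_radial_gradient ennreal_mult_less_top
        intro: borel_imp_lebesgue_on)
  obtain G where G: "\<And>k. G k \<in> test_half_line" "(\<lambda>k. moment p half_line (\<lambda>s. G k s - g s)) \<longlonglongrightarrow> 0"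
    by (rule test_half_line_approx[OF g fin p1]) blast
  have [measurable]: "G k \<in> borel_measurable borel" for k
    by (rule test_half_line_borel[OF G(1)])
  have "\<exists>\<phi>\<in>test_functions B. (\<forall>x. x \<noteq> 0 \<longrightarrow> \<phi> x = primitive (G k) (level x)) \<and>
      (\<forall>x. x \<noteq> 0 \<longrightarrow> gradient \<phi> x = radial_gradient (G k) x)" for k
    by (rule test_function_of_half_line[OF G(1)[of k]]) blast
  then obtain \<phi> where \<phi>: "\<And>k. \<phi> k \<in> test_functions B" "\<And>k x. x \<noteq> 0 \<Longrightarrow> \<phi> k x = primitive (G k) (level x)"
    "\<And>k x. x \<noteq> 0 \<Longrightarrow> gradient (\<phi> k) x = radial_gradient (G k) x"
    by metis
  have nz: "AE x in lebesgue_on B. x \<noteq> 0"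
    unfolding AE_lebesgue_on_B using AE_lborel_singleton[of "0::real^'n"] by eventually_elim simp
  have in_B: "AE x in lebesgue_on B. x \<in> B"
    unfolding AE_lebesgue_on_B by simp
  have smooth: "smooth (\<phi> k)" for k using \<phi>(1)[of k] by (simp add: test_functions_iff)
  have \<phi>_meas: "\<phi> k \<in> borel_measurable (lebesgue_on B)" "gradient (\<phi> k) \<in> borel_measurable (lebesgue_on B)" for k
    by (intro borel_imp_lebesgue_on borel_measurable_continuous_onI smooth_continuous_on gradient_continuous_on smooth)+
  have lim1: "(\<lambda>k. moment p (lebesgue_on B) (\<lambda>x. \<phi> k x - u x)) \<longlonglongrightarrow> 0"
  proof (rule tendsto_sandwich[OF _ _ tendsto_const])
    have "moment p (lebesgue_on B) (\<lambda>x. \<phi> k x - u x)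
        = moment p (lebesgue_on B) (\<lambda>x. primitive (\<lambda>s. G k s - g s) (level x))" for k
    proof (rule moment_cong_AE, use nz in_B u in eventually_elim)
      case (elim x)
      have "0 < level x" using elim level_pos by simp
      then have "primitive (\<lambda>s. G k s - g s) (level x) = primitive (G k) (level x) - primitive g (level x)"
        by (intro primitive_diff moment_half_line_imp_set_integrable[OF _ _ p_gt_1] fin
            moment_test_half_line_finite G(1)) (use p1 in auto)
      then show ?case using elim \<phi>(2) by simp
    qed
    also have "moment p (lebesgue_on B) (\<lambda>x. primitive (\<lambda>s. G k s - g s) (level x))
        \<le> ennreal poincare_const * moment p half_line (\<lambda>s. G k s - g s)" for k
      by (rule moment_primitive_level_le) measurable
    finally show "\<forall>\<^sub>F k in sequentially. moment p (lebesgue_on B) (\<lambda>x. \<phi> k x - u x)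
        \<le> ennreal poincare_const * moment p half_line (\<lambda>s. G k s - g s)"
      by (intro always_eventually allI)
    have "(\<lambda>k. ennreal poincare_const * moment p half_line (\<lambda>s. G k s - g s)) \<longlonglongrightarrow> ennreal poincare_const * 0"
      by (intro ennreal_tendsto_cmult G) simp
    then show "(\<lambda>k. ennreal poincare_const * moment p half_line (\<lambda>s. G k s - g s)) \<longlonglongrightarrow> 0" by simp
  qed simp
  have lim2: "(\<lambda>k. moment p (lebesgue_on B) (\<lambda>x. gradient (\<phi> k) x - radial_gradient g x)) \<longlonglongrightarrow> 0"
  proof -
    have "moment p (lebesgue_on B) (\<lambda>x. gradient (\<phi> k) x - radial_gradient g x)
        = moment p (lebesgue_on B) (radial_gradient (\<lambda>s. G k s - g s))" for k
      by (rule moment_cong_AE, use nz in eventually_elim) (simp add: \<phi>(3) radial_gradient_diff)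
    also have "moment p (lebesgue_on B) (radial_gradient (\<lambda>s. G k s - g s))
        = ennreal energy_const * moment p half_line (\<lambda>s. G k s - g s)" for k
      by (rule moment_radial_gradient) measurable
    finally have eq: "moment p (lebesgue_on B) (\<lambda>x. gradient (\<phi> k) x - radial_gradient g x)
        = ennreal energy_const * moment p half_line (\<lambda>s. G k s - g s)" for k .
    have "(\<lambda>k. ennreal energy_const * moment p half_line (\<lambda>s. G k s - g s)) \<longlonglongrightarrow> ennreal energy_const * 0"
      by (intro ennreal_tendsto_cmult G) simp
    then show ?thesis by (simp add: eq)
  qed
  have fin_B: "emeasure (lebesgue_on B) (space (lebesgue_on B)) < \<infinity>"
    unfolding B_eq by (rule emeasure_lebesgue_on_ball)
  have u_meas: "u \<in> borel_measurable (lebesgue_on B)" "radial_gradient g \<in> borel_measurable (lebesgue_on B)"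
    using u_Lp grad_Lp by (auto simp: Lp_space_iff_moment)
  show weak: "is_weak_gradient B u (radial_gradient g)"
  proof (rule is_weak_gradient_limit[OF B_leb])
    show "is_weak_gradient B (\<phi> k) (gradient (\<phi> k))" for k
      by (intro smooth_is_weak_gradient smooth B_leb)
    show "locally_integrable B u" "locally_integrable B (radial_gradient g)"
      by (intro Lp_space_B_locally_integrable u_Lp grad_Lp)+
    show "(\<lambda>k. \<integral>\<^sup>+x. ennreal (norm (\<phi> k x - u x)) \<partial>lebesgue_on B) \<longlonglongrightarrow> 0"
      by (rule moment_tendsto_imp_nn_integral_tendsto[OF _ fin_B p_gt_1 lim1])
         (intro borel_measurable_diff \<phi>_meas u_meas)
    show "(\<lambda>k. \<integral>\<^sup>+x. ennreal (norm (gradient (\<phi> k) x - radial_gradient g x)) \<partial>lebesgue_on B) \<longlonglongrightarrow> 0"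
      by (rule moment_tendsto_imp_nn_integral_tendsto[OF _ fin_B p_gt_1 lim2])
         (intro borel_measurable_diff \<phi>_meas u_meas)
  qed (rule \<phi>_meas u_meas)+
  have "u \<in> sobolev_space0 p B"
    using u_Lp grad_Lp weak \<phi>(1) lim1 lim2 sobolev_space0_iff[OF R_pos p_gt_1, of u]
    unfolding B_eq by blast
  moreover have "radially_symmetric B u"
    unfolding radially_symmetric_def
    by (rule exI[of _ "\<lambda>r. primitive g (r powr (- \<alpha>) - c)"]) (use u in \<open>simp add: level_def\<close>)
  ultimately show "u \<in> radial_sobolev_space0 p B"
    by (simp add: radial_sobolev_space0_def)
qed

end

section \<open>From radial Sobolev functions to profiles on the half line\<close>

lemma borel_representative_real:
  fixes f :: "'a::euclidean_space \<Rightarrow> real"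
  assumes "f \<in> borel_measurable (lebesgue_on S)" "S \<in> sets borel"
  obtains f' where "f' \<in> borel_measurable borel" "AE x in lborel. x \<in> S \<longrightarrow> f x = f' x"
proof -
  have "(\<lambda>x. if x \<in> S then f x else 0) \<in> borel_measurable lebesgue"
    using assms by (simp add: borel_measurable_if)
  then obtain f' where f': "f' \<in> borel_measurable lborel" "AE x in lborel. (if x \<in> S then f x else 0) = f' x"
    using completion_ex_borel_measurable_real by blast
  then have "AE x in lborel. x \<in> S \<longrightarrow> f x = f' x"
    by (auto elim: eventually_mono)
  with f'(1) show ?thesis by (intro that) auto
qed

lemma borel_representative_vec:
  fixes f :: "'a::euclidean_space \<Rightarrow> real^'n"
  assumes "f \<in> borel_measurable (lebesgue_on S)" "S \<in> sets borel"
  obtains f' where "f' \<in> borel_measurable borel" "AE x in lborel. x \<in> S \<longrightarrow> f x = f' x"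
proof -
  have "\<exists>f'. f' \<in> borel_measurable borel \<and> (AE x in lborel. x \<in> S \<longrightarrow> f x $ i = f' x)" for i
  proof -
    have "(\<lambda>x. f x $ i) \<in> borel_measurable (lebesgue_on S)"
      using assms(1) by (rule measurable_compose) (simp add: borel_measurable_continuous_onI continuous_on_component)
    from borel_representative_real[OF this assms(2)] show ?thesis by blast
  qed
  then obtain F where F: "\<And>i. F i \<in> borel_measurable borel" "\<And>i. AE x in lborel. x \<in> S \<longrightarrow> f x $ i = F i x"
    by metis
  have "AE x in lborel. \<forall>i. x \<in> S \<longrightarrow> f x $ i = F i x"
    unfolding AE_all_countable using F(2) by blast
  then have "AE x in lborel. x \<in> S \<longrightarrow> f x = (\<chi> i. F i x)"
    by (rule eventually_mono) (auto simp: vec_eq_iff)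
  moreover have "(\<lambda>x. \<chi> i. F i x) \<in> borel_measurable borel"
    using F(1) by (subst borel_measurable_euclidean_space) (auto simp: Basis_vec_def inner_axis)
  ultimately show ?thesis by (intro that)
qed

text \<open>If the right-hand side is finite, \<open>h\<close> inherits integrability from \<open>g\<close>.\<close>

lemma abs_primitive_diff_le:
  assumes [measurable]: "h \<in> borel_measurable borel" "g \<in> borel_measurable borel"
    and g: "set_integrable lborel {0<..s} g"
  shows "ennreal \<bar>primitive g s - primitive h s\<bar> \<le> (\<integral>\<^sup>+t\<in>{0<..s}. ennreal \<bar>g t - h t\<bar> \<partial>lborel)"
proof (cases "(\<integral>\<^sup>+t\<in>{0<..s}. ennreal \<bar>g t - h t\<bar> \<partial>lborel) < \<infinity>")
  case True
  have "(\<integral>\<^sup>+t. ennreal (norm (indicator {0<..s} t *\<^sub>R (g t - h t))) \<partial>lborel)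
      = (\<integral>\<^sup>+t\<in>{0<..s}. ennreal \<bar>g t - h t\<bar> \<partial>lborel)"
    by (intro nn_integral_cong) (auto simp: indicator_def)
  with True have "set_integrable lborel {0<..s} (\<lambda>t. g t - h t)"
    unfolding set_integrable_def by (intro integrableI_bounded) auto
  from set_integral_diff(1)[OF g this] have "set_integrable lborel {0<..s} h" by simp
  from primitive_diff[OF g this] show ?thesis
    using abs_primitive_le[of "\<lambda>t. g t - h t" s] by simp
next
  case False
  then have "(\<integral>\<^sup>+t\<in>{0<..s}. ennreal \<bar>g t - h t\<bar> \<partial>lborel) = top"
    by (metis infinity_ennreal_def top.not_eq_extremum)
  then show ?thesis by (simp only: top_greatest)
qed

context radial_ball
begin

definition radius' :: "real \<Rightarrow> real" where
  "radius' s = - 1 / \<alpha> * (s + c) powr (- 1 / \<alpha> - 1)"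

lemma radius_deriv: "0 \<le> s \<Longrightarrow> (radius has_real_derivative radius' s) (at s)"
proof -
  assume "0 \<le> s"
  then have "0 < s + c" using c_pos by simp
  then have "((\<lambda>s. (s + c) powr (- 1 / \<alpha>)) has_real_derivative
      - 1 / \<alpha> * (s + c) powr (- 1 / \<alpha> - of_nat 1) * (1 + 0)) (at s)"
    by (intro DERIV_fun_powr DERIV_add DERIV_ident DERIV_const)
  then show ?thesis by (simp add: radius_def[abs_def] radius'_def)
qed

lemma radius'_borel [measurable]: "radius' \<in> borel_measurable borel"
  unfolding radius'_def[abs_def] by measurable

text \<open>Along a ray this turns the weighted p-th moment of the gradient into the unweighted p-th
  moment of the profile's derivative.\<close>

lemma abs_radius'_powr: "0 \<le> s \<Longrightarrow> \<bar>radius' s\<bar> powr p = weight s / (n * \<alpha> powr (p - 1))"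
proof -
  assume s: "0 \<le> s"
  have e: "(- 1 / \<alpha> - 1) * p = - \<gamma>"
    using gamma_div_p p_gt_1 alpha_pos by (simp add: field_simps)
  have "\<bar>radius' s\<bar> powr p = (1 / \<alpha>) powr p * ((s + c) powr (- 1 / \<alpha> - 1)) powr p"
    using alpha_pos by (simp add: radius'_def abs_mult powr_divide)
  also have "((s + c) powr (- 1 / \<alpha> - 1)) powr p = (s + c) powr (- \<gamma>)"
    by (simp only: powr_powr e)
  also have "(1 / \<alpha>) powr p = 1 / (\<alpha> * \<alpha> powr (p - 1))"
    using alpha_pos powr_add[of \<alpha> 1 "p - 1"] by (simp add: powr_divide)
  finally show ?thesis using n_pos by (simp add: weight_def)
qed

text \<open>On \<open>{0<..N}\<close> the weight is thus at least \<open>weight N > 0\<close>, so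
  weighted L^1 bounds control unweighted ones.\<close>

lemma weight_antimono: "0 \<le> s \<Longrightarrow> s \<le> t \<Longrightarrow> weight t \<le> weight s"
  unfolding weight_def using c_pos n_pos alpha_pos gamma_gt_1
  by (intro mult_left_mono powr_mono2') auto

lemma abs_radius'_le: "0 \<le> s \<Longrightarrow> \<bar>radius' s\<bar> \<le> \<bar>radius' 0\<bar>"
proof -
  assume s: "0 \<le> s"
  then have "(s + c) powr (- 1 / \<alpha> - 1) \<le> (0 + c) powr (- 1 / \<alpha> - 1)"
    using c_pos alpha_pos by (intro powr_mono2') (auto simp: field_simps)
  then show ?thesis
    using alpha_pos by (simp add: radius'_def abs_mult divide_right_mono)
qed

text \<open>The fundamental theorem of calculus from the boundary inwards: level 0 is the radius
  \<open>R\<close>, where a test function of the ball vanishes.\<close>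

lemma test_function_along_ray:
  assumes \<phi>: "\<phi> \<in> test_functions B" and \<theta>: "norm \<theta> = 1" and s: "0 < s"
  defines "g \<equiv> \<lambda>t. radius' t * (gradient \<phi> (radius t *\<^sub>R \<theta>) \<bullet> \<theta>)"
  shows "set_integrable lborel {0<..s} g" "\<phi> (radius s *\<^sub>R \<theta>) = primitive g s"
proof -
  have smooth: "smooth \<phi>" using \<phi> by (simp add: test_functions_iff)
  have rad_cont: "continuous_on {0..s} radius"
    by (rule DERIV_continuous_on[of _ _ radius']) (auto intro: has_field_derivative_at_within radius_deriv)
  have g_cont: "continuous_on {0..s} g"
    unfolding g_def
  proof (intro continuous_on_mult continuous_on_inner continuous_on_const)
    show "continuous_on {0..s} radius'"
      unfolding radius'_def[abs_def] using c_pos by (intro continuous_intros) auto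
    show "continuous_on {0..s} (\<lambda>t. gradient \<phi> (radius t *\<^sub>R \<theta>))"
      by (rule continuous_on_compose2[OF gradient_continuous_on[OF smooth, of UNIV]])
         (auto intro!: continuous_intros rad_cont)
  qed
  have deriv: "((\<lambda>t. \<phi> (radius t *\<^sub>R \<theta>)) has_real_derivative g t) (at t)" if "0 \<le> t" for t
  proof -
    have "((\<lambda>r. \<phi> (0 + r *\<^sub>R \<theta>)) has_real_derivative frechet_derivative \<phi> (at (0 + radius t *\<^sub>R \<theta>)) \<theta>) (at (radius t))"
      by (rule smooth_line_derivative[OF smooth])
    from DERIV_chain2[OF this radius_deriv[OF that]] show ?thesis
      by (simp add: g_def gradient_inner[OF smooth] mult.commute)
  qed
  have int: "set_integrable lborel {0..s} g"
    by (rule borel_integrable_atLeastAtMost'[OF g_cont])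
  then show int': "set_integrable lborel {0<..s} g"
    by (rule set_integrable_subset) auto
  have "(g has_integral (\<phi> (radius s *\<^sub>R \<theta>) - \<phi> (radius 0 *\<^sub>R \<theta>))) {0..s}"
    using s deriv
    by (intro fundamental_theorem_of_calculus)
       (auto simp: has_real_derivative_iff_has_vector_derivative[symmetric] intro: has_field_derivative_at_within)
  moreover have "\<phi> (radius 0 *\<^sub>R \<theta>) = 0"
  proof -
    have "radius 0 *\<^sub>R \<theta> \<notin> B" using \<theta> R_pos by (simp add: radius_0 B_eq)
    then show ?thesis
      using \<phi> closure_subset[of "{x. \<phi> x \<noteq> 0}"] by (auto simp: test_functions_iff)
  qed
  ultimately have "\<phi> (radius s *\<^sub>R \<theta>) = (LINT t:{0..s}|lborel. g t)"
    using set_borel_integral_eq_integral(2)[OF int] by (simp add: integral_unique)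
  also have "\<dots> = primitive g s"
    unfolding primitive_def set_lebesgue_integral_def
  proof (rule integral_cong_AE)
    show "AE t in lborel. indicator {0..s} t *\<^sub>R g t = indicator {0<..s} t *\<^sub>R g t"
      using AE_lborel_singleton[of 0] by eventually_elim (auto simp: indicator_def)
  qed (use int int' in \<open>auto simp: set_integrable_def\<close>)
  finally show "\<phi> (radius s *\<^sub>R \<theta>) = primitive g s" .
qed

text \<open>On almost every ray the errors of the approximating test functions and of their
  gradients have lower limit 0, which identifies \<open>u\<close> with the primitive of its
  derivative along the ray. Since \<open>u\<close> is radial, a single such ray determines it on the
  whole ball.\<close>

lemma radial_sobolev_imp_primitive:
  assumes "u \<in> radial_sobolev_space0 p B"
  obtains g where "g \<in> borel_measurable borel" "moment p half_line g < \<infinity>"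
    "AE x in lebesgue_on B. u x = primitive g (level x)"
proof -
  have u0: "u \<in> sobolev_space0 p (ball 0 R)" and rad: "radially_symmetric B u"
    using assms by (auto simp: radial_sobolev_space0_def B_eq)
  obtain v \<phi> where u: "u \<in> Lp_space p B" and v: "v \<in> Lp_space p B"
    and \<phi>: "\<And>k::nat. \<phi> k \<in> test_functions B"
    and lim1: "(\<lambda>k. moment p (lebesgue_on B) (\<lambda>x. \<phi> k x - u x)) \<longlonglongrightarrow> 0"
    and lim2: "(\<lambda>k. moment p (lebesgue_on B) (\<lambda>x. gradient (\<phi> k) x - v x)) \<longlonglongrightarrow> 0"
    using u0 unfolding sobolev_space0_iff[OF R_pos p_gt_1] B_eq by blast
  obtain f0 where f0: "AE x in lebesgue_on B. u x = f0 (norm x)"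
    using rad by (auto simp: radially_symmetric_def)
  have meas: "u \<in> borel_measurable (lebesgue_on B)" "v \<in> borel_measurable (lebesgue_on B)"
    using u v by (auto simp: Lp_space_iff_moment)
  obtain u' where u' [measurable]: "u' \<in> borel_measurable borel" and uu': "AE x in lborel. x \<in> B \<longrightarrow> u x = u' x"
    using borel_representative_real[OF meas(1) B_sets] by blast
  obtain v' where v' [measurable]: "v' \<in> borel_measurable borel" and vv': "AE x in lborel. x \<in> B \<longrightarrow> v x = v' x"
    using borel_representative_vec[OF meas(2) B_sets] by blast
  have smooth: "smooth (\<phi> k)" for k using \<phi>[of k] by (simp add: test_functions_iff)
  have [measurable]: "\<phi> k \<in> borel_measurable borel" "gradient (\<phi> k) \<in> borel_measurable borel" for k
    by (intro borel_measurable_continuous_onI smooth_continuous_on gradient_continuous_on smooth)+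
  have fin_B: "emeasure (lebesgue_on B) (space (lebesgue_on B)) < \<infinity>"
    unfolding B_eq by (rule emeasure_lebesgue_on_ball)
  \<comment> \<open>The derivative of \<open>u\<close> along the ray of direction
    \<open>\<theta>\<close>, taken in the coordinate \<open>s\<close>.\<close>
  define h where "h \<theta> s = radius' s * (v' (radius s *\<^sub>R \<theta>) \<bullet> \<theta>)" for \<theta> :: "real^'n" and s
  have h_meas [measurable]: "h \<theta> \<in> borel_measurable borel" for \<theta>
    unfolding h_def[abs_def] by measurable
  define I1 where "I1 k \<theta> = (\<integral>\<^sup>+s. ennreal (weight s) * ennreal \<bar>\<phi> k (radius s *\<^sub>R \<theta>) - u' (radius s *\<^sub>R \<theta>)\<bar> \<partial>half_line)"
    for k and \<theta> :: "real^'n"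
  define I2 where "I2 k \<theta> = (\<integral>\<^sup>+s. ennreal (weight s) * ennreal (norm (gradient (\<phi> k) (radius s *\<^sub>R \<theta>) - v' (radius s *\<^sub>R \<theta>))) \<partial>half_line)"
    for k and \<theta> :: "real^'n"
  have [measurable]: "I1 k \<in> borel_measurable borel" "I2 k \<in> borel_measurable borel" for k
    unfolding I1_def[abs_def] I2_def[abs_def] nn_integral_half_line by measurable
  have I1_lim: "(\<lambda>k. \<integral>\<^sup>+\<theta>. I1 k \<theta> \<partial>sphere_measure) \<longlonglongrightarrow> 0"
  proof -
    have "(\<integral>\<^sup>+\<theta>. I1 k \<theta> \<partial>sphere_measure) = (\<integral>\<^sup>+x\<in>B. ennreal \<bar>\<phi> k x - u' x\<bar> \<partial>lborel)" for k
      unfolding I1_def by (rule polar_nn_integral[symmetric]) measurable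
    also have "(\<integral>\<^sup>+x\<in>B. ennreal \<bar>\<phi> k x - u' x\<bar> \<partial>lborel) = (\<integral>\<^sup>+x. ennreal (norm (\<phi> k x - u x)) \<partial>lebesgue_on B)" for k
      unfolding nn_integral_lebesgue_on_B
      by (intro nn_integral_cong_AE, use uu' in eventually_elim) (auto simp: indicator_def)
    finally have eq: "(\<integral>\<^sup>+\<theta>. I1 k \<theta> \<partial>sphere_measure) = (\<integral>\<^sup>+x. ennreal (norm (\<phi> k x - u x)) \<partial>lebesgue_on B)" for k .
    have "(\<lambda>x. \<phi> k x - u x) \<in> borel_measurable (lebesgue_on B)" for k
      by (intro borel_measurable_diff meas borel_imp_lebesgue_on) measurable
    from moment_tendsto_imp_nn_integral_tendsto[OF this fin_B p_gt_1 lim1] show ?thesis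
      by (simp only: eq)
  qed
  have I2_lim: "(\<lambda>k. \<integral>\<^sup>+\<theta>. I2 k \<theta> \<partial>sphere_measure) \<longlonglongrightarrow> 0"
  proof -
    have "(\<integral>\<^sup>+\<theta>. I2 k \<theta> \<partial>sphere_measure) = (\<integral>\<^sup>+x\<in>B. ennreal (norm (gradient (\<phi> k) x - v' x)) \<partial>lborel)" for k
      unfolding I2_def by (rule polar_nn_integral[symmetric]) measurable
    also have "(\<integral>\<^sup>+x\<in>B. ennreal (norm (gradient (\<phi> k) x - v' x)) \<partial>lborel)
        = (\<integral>\<^sup>+x. ennreal (norm (gradient (\<phi> k) x - v x)) \<partial>lebesgue_on B)" for k
      unfolding nn_integral_lebesgue_on_B
      by (intro nn_integral_cong_AE, use vv' in eventually_elim) (auto simp: indicator_def)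
    finally have eq: "(\<integral>\<^sup>+\<theta>. I2 k \<theta> \<partial>sphere_measure) = (\<integral>\<^sup>+x. ennreal (norm (gradient (\<phi> k) x - v x)) \<partial>lebesgue_on B)" for k .
    have "(\<lambda>x. gradient (\<phi> k) x - v x) \<in> borel_measurable (lebesgue_on B)" for k
      by (intro borel_measurable_diff meas borel_imp_lebesgue_on) measurable
    from moment_tendsto_imp_nn_integral_tendsto[OF this fin_B p_gt_1 lim2] show ?thesis
      by (simp only: eq)
  qed
  \<comment> \<open>A bound for the L^1 distance on \<open>{0<..N}\<close> between \<open>u\<close>
    and the candidate primitive. Division by \<open>weight N\<close> removes the weight; the factor
    \<open>N\<close> is the length over which the error of the derivative is integrated once
    more.\<close>
  define J where "J N k \<theta> = ennreal (1 / weight N) * I1 k \<theta> + ennreal N * (ennreal (\<bar>radius' 0\<bar> / weight N) * I2 k \<theta>)" for N k \<theta>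
  \<comment> \<open>Fatou's lemma gives lower limit 0 for almost every direction. This replaces the
    choice of a subsequence, since the quantity bounded by \<open>J N k\<close> is independent of
    \<open>k\<close>.\<close>
  have J_zero: "AE \<theta> in sphere_measure. liminf (\<lambda>k. J N k \<theta>) = 0" for N
  proof -
    have [measurable]: "J N k \<in> borel_measurable borel" for k
      unfolding J_def[abs_def] by measurable
    have "(\<integral>\<^sup>+\<theta>. J N k \<theta> \<partial>sphere_measure) = ennreal (1 / weight N) * (\<integral>\<^sup>+\<theta>. I1 k \<theta> \<partial>sphere_measure)
        + ennreal N * (ennreal (\<bar>radius' 0\<bar> / weight N) * (\<integral>\<^sup>+\<theta>. I2 k \<theta> \<partial>sphere_measure))" for k
      unfolding J_def by (subst nn_integral_add) (auto simp: nn_integral_cmult nn_integral_multc)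
    moreover have "(\<lambda>k. ennreal (1 / weight N) * (\<integral>\<^sup>+\<theta>. I1 k \<theta> \<partial>sphere_measure)
        + ennreal N * (ennreal (\<bar>radius' 0\<bar> / weight N) * (\<integral>\<^sup>+\<theta>. I2 k \<theta> \<partial>sphere_measure)))
        \<longlonglongrightarrow> ennreal (1 / weight N) * 0 + ennreal N * (ennreal (\<bar>radius' 0\<bar> / weight N) * 0)"
      by (intro tendsto_add ennreal_tendsto_cmult I1_lim I2_lim) auto
    ultimately have lim: "(\<lambda>k. \<integral>\<^sup>+\<theta>. J N k \<theta> \<partial>sphere_measure) \<longlonglongrightarrow> 0" by simp
    have "(\<integral>\<^sup>+\<theta>. liminf (\<lambda>k. J N k \<theta>) \<partial>sphere_measure) \<le> liminf (\<lambda>k. \<integral>\<^sup>+\<theta>. J N k \<theta> \<partial>sphere_measure)"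
      by (rule nn_integral_liminf) measurable
    also have "\<dots> = 0" using lim by (intro lim_imp_Liminf) auto
    finally show ?thesis by (subst (asm) le_zero_eq, subst (asm) nn_integral_0_iff_AE) auto
  qed
  have bound: "(\<integral>\<^sup>+s\<in>{0<..N}. ennreal \<bar>u' (radius s *\<^sub>R \<theta>) - primitive (h \<theta>) s\<bar> \<partial>lborel) \<le> J N k \<theta>"
    if \<theta>: "norm \<theta> = 1" and N: "0 < N" for N \<theta> k
  proof -
    define g where "g t = radius' t * (gradient (\<phi> k) (radius t *\<^sub>R \<theta>) \<bullet> \<theta>)" for t
    have [measurable]: "g \<in> borel_measurable borel"
      unfolding g_def[abs_def] by measurable
    define C where "C = ennreal (\<bar>radius' 0\<bar> / weight N) * I2 k \<theta>"
    have wN: "0 < weight N" using weight_pos[of N] N by simp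
    have diff: "(\<integral>\<^sup>+t\<in>{0<..s}. ennreal \<bar>g t - h \<theta> t\<bar> \<partial>lborel) \<le> C" if s: "s \<le> N" for s
    proof -
      let ?d = "\<lambda>t. norm (gradient (\<phi> k) (radius t *\<^sub>R \<theta>) - v' (radius t *\<^sub>R \<theta>))"
      have "(\<integral>\<^sup>+t\<in>{0<..s}. ennreal \<bar>g t - h \<theta> t\<bar> \<partial>lborel)
         \<le> (\<integral>\<^sup>+t. ennreal (\<bar>radius' 0\<bar> / weight N) * (ennreal (weight t) * ennreal (?d t)) * indicator {0<..} t \<partial>lborel)"
      proof (rule nn_integral_mono)
        fix t
        have "\<bar>g t - h \<theta> t\<bar> \<le> \<bar>radius' 0\<bar> / weight N * (weight t * ?d t)" if t: "0 < t" "t \<le> s"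
        proof -
          have "g t - h \<theta> t = radius' t * ((gradient (\<phi> k) (radius t *\<^sub>R \<theta>) - v' (radius t *\<^sub>R \<theta>)) \<bullet> \<theta>)"
            by (simp add: g_def h_def inner_diff_left right_diff_distrib)
          then have "\<bar>g t - h \<theta> t\<bar> \<le> \<bar>radius' 0\<bar> * ?d t"
            using abs_radius'_le[of t] t \<theta>
              Cauchy_Schwarz_ineq2[of "gradient (\<phi> k) (radius t *\<^sub>R \<theta>) - v' (radius t *\<^sub>R \<theta>)" \<theta>]
            by (simp add: abs_mult mult_mono)
          also have "\<dots> \<le> \<bar>radius' 0\<bar> * ?d t * (weight t / weight N)"
            using weight_antimono[of t N] t s wN mult_left_mono[of 1 "weight t / weight N" "\<bar>radius' 0\<bar> * ?d t"]
            by (simp add: field_simps)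
          finally show ?thesis by (simp add: mult_ac)
        qed
        then show "ennreal \<bar>g t - h \<theta> t\<bar> * indicator {0<..s} t
            \<le> ennreal (\<bar>radius' 0\<bar> / weight N) * (ennreal (weight t) * ennreal (?d t)) * indicator {0<..} t"
          using weight_pos[of t] wN
          by (auto simp: indicator_def ennreal_mult[symmetric] intro!: ennreal_leI)
      qed
      also have "\<dots> = C"
        unfolding C_def I2_def nn_integral_half_line by (subst nn_integral_cmult[symmetric]) (auto simp: mult.assoc)
      finally show ?thesis .
    qed
    have pw: "ennreal \<bar>u' (radius s *\<^sub>R \<theta>) - primitive (h \<theta>) s\<bar>
        \<le> ennreal (1 / weight N) * (ennreal (weight s) * ennreal \<bar>\<phi> k (radius s *\<^sub>R \<theta>) - u' (radius s *\<^sub>R \<theta>)\<bar>) + C"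
      if s: "0 < s" "s \<le> N" for s
    proof -
      have ray: "set_integrable lborel {0<..s} g" "\<phi> k (radius s *\<^sub>R \<theta>) = primitive g s"
        unfolding g_def by (rule test_function_along_ray[OF \<phi> \<theta> s(1)])+
      have "ennreal \<bar>u' (radius s *\<^sub>R \<theta>) - primitive (h \<theta>) s\<bar>
          \<le> ennreal (\<bar>\<phi> k (radius s *\<^sub>R \<theta>) - u' (radius s *\<^sub>R \<theta>)\<bar> + \<bar>primitive g s - primitive (h \<theta>) s\<bar>)"
        by (rule ennreal_leI) (use ray(2) in linarith)
      also have "\<dots> = ennreal \<bar>\<phi> k (radius s *\<^sub>R \<theta>) - u' (radius s *\<^sub>R \<theta>)\<bar> + ennreal \<bar>primitive g s - primitive (h \<theta>) s\<bar>"
        by simp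
      also have "\<dots> \<le> ennreal (1 / weight N) * (ennreal (weight s) * ennreal \<bar>\<phi> k (radius s *\<^sub>R \<theta>) - u' (radius s *\<^sub>R \<theta>)\<bar>) + C"
      proof (rule add_mono)
        have "1 \<le> weight s / weight N" using weight_antimono[of s N] s wN by simp
        then have "\<bar>\<phi> k (radius s *\<^sub>R \<theta>) - u' (radius s *\<^sub>R \<theta>)\<bar>
            \<le> 1 / weight N * (weight s * \<bar>\<phi> k (radius s *\<^sub>R \<theta>) - u' (radius s *\<^sub>R \<theta>)\<bar>)"
          using mult_right_mono[of 1 "weight s / weight N" "\<bar>\<phi> k (radius s *\<^sub>R \<theta>) - u' (radius s *\<^sub>R \<theta>)\<bar>"] by simp
        then show "ennreal \<bar>\<phi> k (radius s *\<^sub>R \<theta>) - u' (radius s *\<^sub>R \<theta>)\<bar>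
          \<le> ennreal (1 / weight N) * (ennreal (weight s) * ennreal \<bar>\<phi> k (radius s *\<^sub>R \<theta>) - u' (radius s *\<^sub>R \<theta>)\<bar>)"
          using wN weight_pos[of s] s by (simp add: ennreal_mult[symmetric] ennreal_leI)
        show "ennreal \<bar>primitive g s - primitive (h \<theta>) s\<bar> \<le> C"
          by (rule order_trans[OF abs_primitive_diff_le[OF h_meas _ ray(1)] diff[OF s(2)]]) measurable
      qed
      finally show ?thesis .
    qed
    have "(\<integral>\<^sup>+s\<in>{0<..N}. ennreal \<bar>u' (radius s *\<^sub>R \<theta>) - primitive (h \<theta>) s\<bar> \<partial>lborel)
       \<le> (\<integral>\<^sup>+s. ennreal (1 / weight N) * (ennreal (weight s) * ennreal \<bar>\<phi> k (radius s *\<^sub>R \<theta>) - u' (radius s *\<^sub>R \<theta>)\<bar> * indicator {0<..} s)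
              + C * indicator {0<..N} s \<partial>lborel)"
      using pw by (intro nn_integral_mono) (auto simp: indicator_def)
    also have "\<dots> = ennreal (1 / weight N) * I1 k \<theta> + C * ennreal N"
      unfolding I1_def nn_integral_half_line
      using N by (subst nn_integral_add) (auto simp: nn_integral_cmult nn_integral_cmult_indicator)
    finally show ?thesis by (simp add: J_def C_def mult.commute)
  qed
  have AE1: "AE \<theta> in sphere_measure. \<forall>N::nat. liminf (\<lambda>k. J (real (Suc N)) k \<theta>) = 0"
    unfolding AE_all_countable using J_zero by blast
  have "AE x in lborel. x \<in> B \<longrightarrow> u' x = f0 (norm x)"
    using f0[unfolded AE_lebesgue_on_B] uu' by eventually_elim auto
  then have AE2: "AE \<theta> in sphere_measure. AE s in half_line. u' (radius s *\<^sub>R \<theta>) = f0 (norm (radius s *\<^sub>R \<theta>))"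
    by (rule AE_polar)
  have AE3: "AE \<theta> in sphere_measure. (\<integral>\<^sup>+s. ennreal (weight s) * ennreal (norm (v' (radius s *\<^sub>R \<theta>)) powr p) \<partial>half_line) < \<infinity>"
  proof -
    have "(\<integral>\<^sup>+\<theta>. \<integral>\<^sup>+s. ennreal (weight s) * ennreal (norm (v' (radius s *\<^sub>R \<theta>)) powr p) \<partial>half_line \<partial>sphere_measure)
        = (\<integral>\<^sup>+x\<in>B. ennreal (norm (v' x) powr p) \<partial>lborel)"
      by (rule polar_nn_integral[symmetric]) measurable
    also have "\<dots> = moment p (lebesgue_on B) v"
      unfolding moment_def nn_integral_lebesgue_on_B
      by (intro nn_integral_cong_AE, use vv' in eventually_elim) (auto simp: indicator_def)
    also have "\<dots> < \<infinity>" using v by (simp add: Lp_space_iff_moment)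
    finally have "(\<integral>\<^sup>+\<theta>. \<integral>\<^sup>+s. ennreal (weight s) * ennreal (norm (v' (radius s *\<^sub>R \<theta>)) powr p) \<partial>half_line \<partial>sphere_measure) \<noteq> \<infinity>"
      by (rule less_imp_neq)
    moreover have "(\<lambda>\<theta>. \<integral>\<^sup>+s. ennreal (weight s) * ennreal (norm (v' (radius s *\<^sub>R \<theta>)) powr p) \<partial>half_line) \<in> borel_measurable borel"
      unfolding nn_integral_half_line by measurable
    ultimately have "AE \<theta> in sphere_measure. (\<integral>\<^sup>+s. ennreal (weight s) * ennreal (norm (v' (radius s *\<^sub>R \<theta>)) powr p) \<partial>half_line) \<noteq> \<infinity>"
      by (intro nn_integral_PInf_AE) (auto cong: measurable_cong_sets)
    then show ?thesis by (rule eventually_mono) (simp add: top.not_eq_extremum)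
  qed
  \<comment> \<open>The sphere has positive measure, so a property of almost every direction holds
    for some direction.\<close>
  have nontrivial: "ae_filter (sphere_measure :: (real^'n) measure) \<noteq> bot"
    using less_imp_neq[OF unit_ball_vol_pos[of n]] n_pos
    by (simp add: ae_filter_eq_bot_iff emeasure_sphere_measure_UNIV n_card[symmetric])
  have "AE \<theta> in sphere_measure. norm (\<theta>::real^'n) = 1 \<and> (\<forall>N::nat. liminf (\<lambda>k. J (real (Suc N)) k \<theta>) = 0) \<and>
      (AE s in half_line. u' (radius s *\<^sub>R \<theta>) = f0 (norm (radius s *\<^sub>R \<theta>))) \<and>
      (\<integral>\<^sup>+s. ennreal (weight s) * ennreal (norm (v' (radius s *\<^sub>R \<theta>)) powr p) \<partial>half_line) < \<infinity>"
    using AE_sphere_measure_norm AE1 AE2 AE3 by eventually_elim blast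
  from eventually_happens[OF this] nontrivial obtain \<theta> :: "real^'n" where \<theta>: "norm \<theta> = 1"
    and J0: "\<And>N::nat. liminf (\<lambda>k. J (real (Suc N)) k \<theta>) = 0"
    and f0': "AE s in half_line. u' (radius s *\<^sub>R \<theta>) = f0 (norm (radius s *\<^sub>R \<theta>))"
    and fin: "(\<integral>\<^sup>+s. ennreal (weight s) * ennreal (norm (v' (radius s *\<^sub>R \<theta>)) powr p) \<partial>half_line) < \<infinity>"
    by blast
  have "AE s in lborel. \<forall>N::nat. s \<in> {0<..real (Suc N)} \<longrightarrow> u' (radius s *\<^sub>R \<theta>) = primitive (h \<theta>) s"
    unfolding AE_all_countable
  proof
    fix N :: nat
    have "(\<integral>\<^sup>+s\<in>{0<..real (Suc N)}. ennreal \<bar>u' (radius s *\<^sub>R \<theta>) - primitive (h \<theta>) s\<bar> \<partial>lborel)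
        \<le> liminf (\<lambda>k. J (real (Suc N)) k \<theta>)"
      using bound[OF \<theta>, of "real (Suc N)"] by (intro Liminf_bounded always_eventually allI) simp
    then have "(\<integral>\<^sup>+s\<in>{0<..real (Suc N)}. ennreal \<bar>u' (radius s *\<^sub>R \<theta>) - primitive (h \<theta>) s\<bar> \<partial>lborel) = 0"
      unfolding J0 by simp
    then have "AE s in lborel. ennreal \<bar>u' (radius s *\<^sub>R \<theta>) - primitive (h \<theta>) s\<bar> * indicator {0<..real (Suc N)} s = 0"
      by (subst (asm) nn_integral_0_iff_AE) auto
    then show "AE s in lborel. s \<in> {0<..real (Suc N)} \<longrightarrow> u' (radius s *\<^sub>R \<theta>) = primitive (h \<theta>) s"
      by (rule eventually_mono) (auto simp: indicator_def split: if_splits)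
  qed
  then have prim: "AE s in half_line. u' (radius s *\<^sub>R \<theta>) = primitive (h \<theta>) s"
    unfolding AE_half_line
  proof (rule eventually_mono, intro impI)
    fix s :: real
    assume *: "\<forall>N::nat. s \<in> {0<..real (Suc N)} \<longrightarrow> u' (radius s *\<^sub>R \<theta>) = primitive (h \<theta>) s" and "0 < s"
    obtain N :: nat where "s < real N" using reals_Archimedean2 by blast
    with \<open>0 < s\<close> have "s \<in> {0<..real (Suc N)}" by simp
    with * show "u' (radius s *\<^sub>R \<theta>) = primitive (h \<theta>) s" by blast
  qed
  have "AE s in half_line. f0 (radius s) = primitive (h \<theta>) s"
    using prim f0' AE_space[of half_line]
  proof eventually_elim
    case (elim s)
    then show ?case using \<theta> radius_pos[of s] by simp
  qed
  then have "AE x in lborel. x \<in> B \<longrightarrow> f0 (radius (level x)) = primitive (h \<theta>) (level x)"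
    by (rule AE_level)
  then have u_eq: "AE x in lebesgue_on B. u x = primitive (h \<theta>) (level x)"
    unfolding AE_lebesgue_on_B using f0[unfolded AE_lebesgue_on_B] AE_lborel_singleton[of "0::real^'n"]
    by eventually_elim (use radius_level in auto)
  have "moment p half_line (h \<theta>)
      \<le> (\<integral>\<^sup>+s. ennreal (1 / (n * \<alpha> powr (p - 1))) * (ennreal (weight s) * ennreal (norm (v' (radius s *\<^sub>R \<theta>)) powr p)) \<partial>half_line)"
    unfolding moment_def
  proof (rule nn_integral_mono)
    fix s assume "s \<in> space half_line"
    then have s: "0 < s" by simp
    have "norm (h \<theta> s) \<le> \<bar>radius' s\<bar> * norm (v' (radius s *\<^sub>R \<theta>))"
      using Cauchy_Schwarz_ineq2[of "v' (radius s *\<^sub>R \<theta>)" \<theta>] \<theta> by (simp add: h_def abs_mult mult_left_mono)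
    then have "norm (h \<theta> s) powr p \<le> (\<bar>radius' s\<bar> * norm (v' (radius s *\<^sub>R \<theta>))) powr p"
      using p_gt_1 by (intro powr_mono2) auto
    also have "\<dots> = 1 / (n * \<alpha> powr (p - 1)) * (weight s * norm (v' (radius s *\<^sub>R \<theta>)) powr p)"
      using abs_radius'_powr[of s] s by (simp add: powr_mult)
    finally show "ennreal (norm (h \<theta> s) powr p)
        \<le> ennreal (1 / (n * \<alpha> powr (p - 1))) * (ennreal (weight s) * ennreal (norm (v' (radius s *\<^sub>R \<theta>)) powr p))"
      using weight_pos[of s] s n_pos by (simp add: ennreal_mult[symmetric] ennreal_leI)
  qed
  also have "\<dots> = ennreal (1 / (n * \<alpha> powr (p - 1))) * (\<integral>\<^sup>+s. ennreal (weight s) * ennreal (norm (v' (radius s *\<^sub>R \<theta>)) powr p) \<partial>half_line)"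
    by (intro nn_integral_cmult half_line_borel) measurable
  also have "\<dots> < \<infinity>"
    using fin by (simp add: ennreal_mult_less_top)
  finally have "moment p half_line (h \<theta>) < \<infinity>" .
  with h_meas u_eq show ?thesis by (intro that)
qed

end

section \<open>Dilations of the half line\<close>

lemma nn_integral_half_line_scale:
  assumes [measurable]: "F \<in> borel_measurable borel" and c: "0 < c"
  shows "(\<integral>\<^sup>+s. F (c * s) \<partial>half_line) = ennreal (1 / c) * (\<integral>\<^sup>+s. F s \<partial>half_line)"
proof -
  have "(\<integral>\<^sup>+s. F s \<partial>half_line) = ennreal \<bar>c\<bar> * (\<integral>\<^sup>+s. F (0 + c * s) * indicator {0<..} (0 + c * s) \<partial>lborel)"
    unfolding nn_integral_half_line using c by (intro nn_integral_real_affine) auto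
  also have "(\<integral>\<^sup>+s. F (0 + c * s) * indicator {0<..} (0 + c * s) \<partial>lborel) = (\<integral>\<^sup>+s. F (c * s) \<partial>half_line)"
    unfolding nn_integral_half_line
    using c by (intro nn_integral_cong) (auto simp: indicator_def zero_less_mult_iff)
  finally have "ennreal (1 / c) * (\<integral>\<^sup>+s. F s \<partial>half_line) = (ennreal (1 / c) * ennreal c) * (\<integral>\<^sup>+s. F (c * s) \<partial>half_line)"
    using c by (simp add: mult.assoc)
  also have "ennreal (1 / c) * ennreal c = 1"
    using c by (simp add: ennreal_mult[symmetric])
  finally show ?thesis by simp
qed

lemma AE_half_line_scale:
  assumes P: "AE s in half_line. P s" and c: "0 < c"
  shows "AE s in half_line. P (c * s)"
proof -
  have "AE s in lborel. 0 < s \<longrightarrow> P s" using P by (simp add: AE_half_line)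
  then obtain N where N: "{s. \<not> (0 < s \<longrightarrow> P s)} \<subseteq> N" "emeasure lborel N = 0" "N \<in> sets borel"
    by (auto elim!: AE_E)
  note [measurable] = N(3)
  have "AE s in lborel. s \<notin> N"
    using N by (intro AE_not_in) auto
  then have "(\<integral>\<^sup>+s. indicator N s \<partial>half_line) = (\<integral>\<^sup>+s. 0 \<partial>half_line)"
    by (intro nn_integral_cong_AE) (auto simp: AE_half_line elim: eventually_mono)
  then have "(\<integral>\<^sup>+s. indicator N (c * s) \<partial>half_line) = 0"
    using nn_integral_half_line_scale[of "indicator N", OF _ c] by simp
  then have "AE s in half_line. indicator N (c * s) = (0::ennreal)"
    by (subst (asm) nn_integral_0_iff_AE) (auto intro!: half_line_borel)
  then show ?thesis
    unfolding AE_half_line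
  proof (rule eventually_mono, intro impI)
    fix s :: real assume "0 < s \<longrightarrow> indicator N (c * s) = (0::ennreal)" "0 < s"
    then have "c * s \<notin> N" "0 < c * s"
      using c by (auto simp: indicator_def split: if_splits)
    with N(1) show "P (c * s)" by blast
  qed
qed

lemma primitive_scale:
  assumes c: "0 < c"
  shows "primitive (\<lambda>t. k * g (c * t)) s = k / c * primitive g (c * s)"
proof -
  have "primitive g (c * s) = \<bar>c\<bar> *\<^sub>R (LINT t|lborel. indicator {0<..c * s} (0 + c * t) *\<^sub>R g (0 + c * t))"
    unfolding primitive_def set_lebesgue_integral_def
    using c by (intro lborel_integral_real_affine) simp
  also have "(\<lambda>t. indicator {0<..c * s} (0 + c * t) *\<^sub>R g (0 + c * t)) = (\<lambda>t. indicator {0<..s} t *\<^sub>R g (c * t))"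
    using c by (auto simp: fun_eq_iff indicator_def zero_less_mult_iff)
  finally show ?thesis
    using c by (simp add: primitive_def set_lebesgue_integral_def mult.left_commute[of _ k])
qed

section \<open>The weighted inequality and its constant\<close>

context radial_ball
begin

definition mass_const :: real where
  "mass_const = unit_ball_vol n * n * \<alpha> powr (\<gamma> - 1)"

lemma mass_const_pos: "0 < mass_const"
  using n_pos alpha_pos by (simp add: mass_const_def unit_ball_vol_pos)

text \<open>The index of the logarithm satisfies \<open>1 - (n - 1) / (p - 1) = - \<alpha>\<close>,
  which is why it becomes a simple function of the level.\<close>

lemma log_q_level:
  assumes "x \<in> B" "x \<noteq> 0"
  shows "log_q ((n - 1) / (p - 1)) (R / norm x) = level x / (\<alpha> * (level x + c))"
proof -
  have e: "1 - (n - 1) / (p - 1) = - \<alpha>"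
    using p_gt_1 by (simp add: \<alpha>_def field_simps)
  have r: "(R / norm x) powr (- \<alpha>) = c / norm x powr (- \<alpha>)"
    using R_pos assms by (simp add: powr_divide c_def)
  have l: "norm x powr (- \<alpha>) = level x + c" "0 < level x + c"
    using level_pos[OF assms] c_pos by (auto simp: level_def)
  show ?thesis
    unfolding log_q_def e r l(1) using l(2) alpha_pos by (simp add: field_simps)
qed

definition level_integral :: "(real \<Rightarrow> real) \<Rightarrow> ennreal" where
  "level_integral f = (\<integral>\<^sup>+s. ennreal (\<bar>f s\<bar> powr q * s powr (- \<gamma>)) \<partial>half_line)"

text \<open>The denominator contributes a factor \<open>(s + c) powr \<gamma>\<close>, which cancels
  the power in \<open>weight\<close> just as in the energy; what remains is
  \<open>s powr (- \<gamma>)\<close> and the constants collected in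
  \<open>mass_const\<close>.\<close>

lemma weighted_integrand_level:
  assumes f [measurable]: "f \<in> borel_measurable borel" and u: "AE x in lebesgue_on B. u x = f (level x)"
  shows "weighted_integrand n p q R u \<in> borel_measurable (lebesgue_on B)"
    and "(\<integral>\<^sup>+x. ennreal (weighted_integrand n p q R u x) \<partial>lebesgue_on B)
      = ennreal mass_const * level_integral f"
proof -
  define h where "h s = \<bar>f s\<bar> powr q * (\<alpha> powr \<gamma> * (s + c) powr \<gamma> * s powr (- \<gamma>))" for s
  have [measurable]: "h \<in> borel_measurable borel" unfolding h_def[abs_def] by measurable
  have eq: "AE x in lebesgue_on B. h (level x) = weighted_integrand n p q R u x"
    using u AE_lborel_singleton[of "0::real^'n"] unfolding AE_lebesgue_on_B
  proof eventually_elim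
    case (elim x)
    show ?case
    proof
      assume x: "x \<in> B"
      have s: "0 < level x" "0 < level x + c" using level_pos[OF x] elim c_pos by auto
      have "weighted_integrand n p q R u x = \<bar>f (level x)\<bar> powr q / (level x / (\<alpha> * (level x + c))) powr \<gamma>"
        using elim x by (simp add: weighted_integrand_def log_q_level \<gamma>_def)
      also have "(level x / (\<alpha> * (level x + c))) powr \<gamma> = level x powr \<gamma> / (\<alpha> powr \<gamma> * (level x + c) powr \<gamma>)"
        using s alpha_pos by (simp add: powr_divide powr_mult)
      finally show "h (level x) = weighted_integrand n p q R u x"
        by (simp add: h_def powr_minus divide_inverse mult_ac)
    qed
  qed
  show "weighted_integrand n p q R u \<in> borel_measurable (lebesgue_on B)"
    by (rule borel_measurable_lebesgue_on_AE[OF _ _ eq]) (auto intro!: borel_imp_lebesgue_on)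
  have "(\<integral>\<^sup>+x. ennreal (weighted_integrand n p q R u x) \<partial>lebesgue_on B) = (\<integral>\<^sup>+x. ennreal (h (level x)) \<partial>lebesgue_on B)"
    using eq by (intro nn_integral_cong_AE) (auto elim: eventually_mono)
  also have "\<dots> = ennreal (unit_ball_vol n) * (\<integral>\<^sup>+s. ennreal (weight s) * ennreal (h s) \<partial>half_line)"
    unfolding nn_integral_lebesgue_on_B by (rule radial_nn_integral) measurable
  also have "(\<integral>\<^sup>+s. ennreal (weight s) * ennreal (h s) \<partial>half_line)
      = (\<integral>\<^sup>+s. ennreal (n * \<alpha> powr (\<gamma> - 1)) * ennreal (\<bar>f s\<bar> powr q * s powr (- \<gamma>)) \<partial>half_line)"
  proof (rule nn_integral_cong)
    fix s assume "s \<in> space half_line"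
    then have s: "0 < s" "0 < s + c" using c_pos by auto
    have "\<alpha> powr \<gamma> = \<alpha> * \<alpha> powr (\<gamma> - 1)"
      using alpha_pos powr_add[of \<alpha> 1 "\<gamma> - 1"] by simp
    moreover have "(s + c) powr (- \<gamma>) * (s + c) powr \<gamma> = 1"
      using s by (simp add: powr_add[symmetric])
    ultimately have "weight s * h s = n * \<alpha> powr (\<gamma> - 1) * (\<bar>f s\<bar> powr q * s powr (- \<gamma>))"
      using alpha_pos by (simp add: weight_def h_def)
    then show "ennreal (weight s) * ennreal (h s) = ennreal (n * \<alpha> powr (\<gamma> - 1)) * ennreal (\<bar>f s\<bar> powr q * s powr (- \<gamma>))"
      using weight_pos[of s] s n_pos by (simp add: ennreal_mult[symmetric] h_def)
  qed
  also have "\<dots> = ennreal (n * \<alpha> powr (\<gamma> - 1)) * level_integral f"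
    unfolding level_integral_def by (intro nn_integral_cmult half_line_borel) measurable
  finally show "(\<integral>\<^sup>+x. ennreal (weighted_integrand n p q R u x) \<partial>lebesgue_on B)
      = ennreal mass_const * level_integral f"
    using n_pos by (simp add: mass_const_def ennreal_mult mult.assoc unit_ball_vol_nonneg)
qed

lemma weighted_norm_level:
  assumes "f \<in> borel_measurable borel" "AE x in lebesgue_on B. u x = f (level x)"
    and A: "level_integral f = ennreal A" "0 \<le> A"
  shows "integrable (lebesgue_on B) (weighted_integrand n p q R u)"
    and "weighted_norm n p q R u = (mass_const * A) powr (1 / q)"
proof -
  have nn: "(\<integral>\<^sup>+x. ennreal (weighted_integrand n p q R u x) \<partial>lebesgue_on B) = ennreal (mass_const * A)"
    using weighted_integrand_level(2)[OF assms(1,2)] A mass_const_pos by (simp add: ennreal_mult)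
  have nonneg: "0 \<le> weighted_integrand n p q R u x" for x
    by (simp add: weighted_integrand_def)
  have meas: "weighted_integrand n p q R u \<in> borel_measurable (lebesgue_on B)"
    by (rule weighted_integrand_level(1)[OF assms(1,2)])
  show "integrable (lebesgue_on B) (weighted_integrand n p q R u)"
    using nn nonneg meas by (intro integrableI_bounded) auto
  have "(LINT x|lebesgue_on B. weighted_integrand n p q R u x) = mass_const * A"
    using integral_eq_nn_integral[OF meas] nonneg A(2) mass_const_pos by (simp add: nn)
  then show "weighted_norm n p q R u = (mass_const * A) powr (1 / q)"
    by (simp add: weighted_norm_def B_eq)
qed

lemma gradient_norm_level:
  assumes g: "g \<in> borel_measurable borel" and u: "AE x in lebesgue_on B. u x = primitive g (level x)"
    and E: "moment p half_line g = ennreal E" "0 \<le> E"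
  shows "Lp_norm p B (weak_gradient B u) = (energy_const * E) powr (1 / p)"
proof -
  have fin: "moment p half_line g < \<infinity>" using E by simp
  note sob = primitive_level_sobolev[OF g fin u]
  note wg = weak_gradient_ball[OF sob(2,3)[unfolded B_eq] R_pos, folded B_eq]
  have "ennreal (Lp_norm p B (weak_gradient B u) powr p) = ennreal (energy_const * E)"
    using Lp_norm_powr[OF wg(1)] wg(2) moment_radial_gradient[OF g] E energy_const_pos p_gt_1
    by (simp add: ennreal_mult)
  then have "Lp_norm p B (weak_gradient B u) powr p = energy_const * E"
    using E energy_const_pos by (subst (asm) ennreal_inj) auto
  then have "(Lp_norm p B (weak_gradient B u) powr p) powr (1 / p) = (energy_const * E) powr (1 / p)"
    by simp
  then show ?thesis
    using p_gt_1 by (simp add: powr_powr Lp_norm_def)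
qed

text \<open>The quotient of gamma functions contains the beta integral:
  \<open>Gamma (n + 1 - n / p) = (n - n / p) * Gamma (n - n / p)\<close> and
  \<open>n / \<alpha> = (n - n / p) * \<kappa>\<close> yield
  \<open>n / \<alpha> * total_mass\<close>, while \<open>sqrt pi\<close> and
  \<open>Gamma (1 + n / 2)\<close> combine to the volume of the unit ball.\<close>

lemma sobolev_const_eq:
  "sobolev_const n p = n powr (1 / p) * \<alpha> powr (1 - 1 / p) * (unit_ball_vol n * (n / \<alpha>) * total_mass) powr (1 / n)"
proof -
  define \<Gamma> where "\<Gamma> = Gamma (1 + n / 2)"
  have pos: "0 < n / p" "0 < n - n / p" "0 < n" "0 < \<Gamma>" "0 < Gamma n"
    using p_gt_1 p_less_n by (auto simp: \<Gamma>_def field_simps intro!: Gamma_real_pos)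
  have G1: "Gamma (n + 1 - n / p) = (n - n / p) * Gamma (n - n / p)"
  proof -
    have "n - n / p \<notin> \<int>\<^sub>\<le>\<^sub>0" using pos(2) by (auto elim!: nonpos_Ints_cases)
    from Gamma_plus1[OF this] show ?thesis by (simp add: algebra_simps)
  qed
  have k: "n / \<alpha> = (n - n / p) * \<kappa>"
    using p_gt_1 p_less_n by (simp add: \<kappa>_def \<alpha>_def divide_simps) (simp add: algebra_simps)
  have "Gamma (n / p) * Gamma (n + 1 - n / p) / Gamma n = (n / \<alpha>) * total_mass"
    unfolding G1 k total_mass_def Beta_def using kappa_pos by simp
  then have G: "Gamma (n / p) * Gamma (n + 1 - n / p) / (Gamma n * \<Gamma>) = (n / \<alpha>) * total_mass / \<Gamma>"
    by (metis divide_divide_eq_left)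
  have "sqrt pi = (pi powr (n / 2)) powr (1 / n)"
    using pos by (simp add: powr_powr powr_half_sqrt)
  then have "sqrt pi * ((n / \<alpha>) * total_mass / \<Gamma>) powr (1 / n)
      = (pi powr (n / 2) / \<Gamma> * (n / \<alpha>) * total_mass) powr (1 / n)"
    using pos alpha_pos total_mass_pos by (simp add: powr_mult powr_divide mult_ac)
  moreover have "unit_ball_vol n = pi powr (n / 2) / \<Gamma>"
    by (simp add: unit_ball_vol_def \<Gamma>_def add.commute)
  moreover have "(p - 1) / p = 1 - 1 / p"
    using p_gt_1 by (simp add: diff_divide_distrib)
  ultimately show ?thesis
    unfolding sobolev_const_def \<Gamma>_def[symmetric] G by (simp add: \<alpha>_def mult_ac)
qed

text \<open>The constant is the quotient of the two sides at the extremal profile, whose mass is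
  \<open>total_mass\<close> and whose energy is \<open>n / \<alpha> * total_mass\<close>. The powers
  of the ball volume match because \<open>1 / n + 1 / q = 1 / p\<close>.\<close>

lemma weighted_const_eq:
  "weighted_const n p * (mass_const * total_mass) powr (1 / q) = (energy_const * (n / \<alpha> * total_mass)) powr (1 / p)"
proof -
  define X where "X = unit_ball_vol n * (n / \<alpha>) * total_mass"
  have X: "0 < X"
    using unit_ball_vol_pos[of n] n_pos alpha_pos total_mass_pos by (simp add: X_def)
  have split: "\<alpha> powr a = \<alpha> powr (a - 1) * \<alpha>" for a
    using alpha_pos powr_add[of \<alpha> "a - 1" 1] by simp
  have m: "mass_const * total_mass = X * \<alpha> powr \<gamma>"
    using alpha_pos by (simp add: mass_const_def X_def split[of \<gamma>])
  have e: "energy_const * (n / \<alpha> * total_mass) = X * n * \<alpha> powr (p - 1)"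
    by (simp add: energy_const_def X_def)
  have w: "weighted_const n p = n powr (1 / p) * \<alpha> powr (1 - 1 / p) * X powr (1 / n) * \<alpha> powr (1 / n - 1)"
    by (simp add: weighted_const_def sobolev_const_eq X_def \<alpha>_def)
  have x1: "1 / n + 1 / q = 1 / p" and x2: "(1 - 1 / p) + (1 / n - 1) + \<gamma> * (1 / q) = (p - 1) * (1 / p)"
    using p_gt_1 p_less_n by (auto simp: q_def \<gamma>_def divide_simps; auto simp: algebra_simps)+
  have "weighted_const n p * (mass_const * total_mass) powr (1 / q)
      = n powr (1 / p) * (X powr (1 / n) * X powr (1 / q)) * (\<alpha> powr (1 - 1 / p) * \<alpha> powr (1 / n - 1) * \<alpha> powr (\<gamma> * (1 / q)))"
    using X alpha_pos by (simp add: w m powr_mult powr_powr mult_ac)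
  also have "\<dots> = n powr (1 / p) * X powr (1 / p) * \<alpha> powr ((p - 1) * (1 / p))"
    by (simp only: powr_add[symmetric] x1 x2)
  also have "\<dots> = (X * n * \<alpha> powr (p - 1)) powr (1 / p)"
    using X n_pos alpha_pos by (simp add: powr_mult powr_powr mult_ac)
  finally show ?thesis by (simp only: e)
qed

lemma weighted_const_pos: "0 < weighted_const n p"
proof -
  have "0 < (energy_const * (n / \<alpha> * total_mass)) powr (1 / p)"
    using energy_const_pos n_pos alpha_pos total_mass_pos by simp
  then have "0 < weighted_const n p * (mass_const * total_mass) powr (1 / q)"
    by (simp only: weighted_const_eq)
  then show ?thesis by (auto simp: zero_less_mult_iff)
qed

text \<open>The bound of \<open>Bliss\<close> is homogeneous of degree \<open>q / p\<close> in
  \<open>E\<close>, so the case \<open>E = n / \<alpha> * total_mass\<close> of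
  \<open>weighted_const_eq\<close> settles all energies.\<close>

lemma weighted_const_scaled:
  assumes "0 \<le> E"
  shows "weighted_const n p * (mass_const * (total_mass * (\<alpha> / n * E / total_mass) powr (q / p))) powr (1 / q)
    = (energy_const * E) powr (1 / p)"
proof -
  define Y where "Y = \<alpha> / n * E / total_mass"
  have Y: "0 \<le> Y" using assms alpha_pos n_pos total_mass_pos by (simp add: Y_def)
  have "weighted_const n p * (mass_const * (total_mass * Y powr (q / p))) powr (1 / q)
     = (weighted_const n p * (mass_const * total_mass) powr (1 / q)) * (Y powr (q / p)) powr (1 / q)"
    using mass_const_pos total_mass_pos by (simp add: powr_mult mult_ac)
  also have "\<dots> = (energy_const * (n / \<alpha> * total_mass)) powr (1 / p) * Y powr (1 / p)"
    using q_pos by (simp only: weighted_const_eq) (simp add: powr_powr)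
  also have "\<dots> = (energy_const * (n / \<alpha> * total_mass) * Y) powr (1 / p)"
    by (rule powr_mult[symmetric])
  also have "energy_const * (n / \<alpha> * total_mass) * Y = energy_const * E"
    using n_pos alpha_pos total_mass_pos by (simp add: Y_def)
  finally show ?thesis by (simp add: Y_def)
qed

text \<open>Integrability is recorded because the integral of a non-integrable function is 0 by
  default, which would empty the inequality of content.\<close>

lemma weighted_inequality:
  assumes u: "u \<in> radial_sobolev_space0 p B"
  shows "integrable (lebesgue_on B) (weighted_integrand n p q R u)"
    and "weighted_const n p * weighted_norm n p q R u \<le> Lp_norm p B (weak_gradient B u)"
proof -
  obtain g where g: "g \<in> borel_measurable borel" "moment p half_line g < \<infinity>"
    "AE x in lebesgue_on B. u x = primitive g (level x)"
    by (rule radial_sobolev_imp_primitive[OF u]) blast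
  obtain E where E: "moment p half_line g = ennreal E" "0 \<le> E"
    using g(2) by (cases "moment p half_line g") auto
  have bliss: "level_integral (primitive g) \<le> ennreal (total_mass * (\<alpha> / n * E / total_mass) powr (q / p))"
    unfolding level_integral_def by (rule Bliss[OF g(1) _ E(2)]) (simp add: E)
  then have "level_integral (primitive g) < \<infinity>"
    by (rule le_less_trans) simp
  then obtain A where A: "level_integral (primitive g) = ennreal A" "0 \<le> A"
    by (cases "level_integral (primitive g)") auto
  have A_le: "A \<le> total_mass * (\<alpha> / n * E / total_mass) powr (q / p)"
    using bliss total_mass_pos unfolding A(1) by (subst (asm) ennreal_le_iff) auto
  note w = weighted_norm_level[OF primitive_borel[OF g(1)] g(3) A]
  show "integrable (lebesgue_on B) (weighted_integrand n p q R u)" by (rule w)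
  have "(mass_const * A) powr (1 / q) \<le> (mass_const * (total_mass * (\<alpha> / n * E / total_mass) powr (q / p))) powr (1 / q)"
    using A_le A(2) mass_const_pos q_pos by (intro powr_mono2 mult_left_mono) auto
  then have "weighted_const n p * (mass_const * A) powr (1 / q) \<le> (energy_const * E) powr (1 / p)"
    unfolding weighted_const_scaled[OF E(2), symmetric]
    using weighted_const_pos by (intro mult_left_mono) auto
  then show "weighted_const n p * weighted_norm n p q R u \<le> Lp_norm p B (weak_gradient B u)"
    by (simp only: w(2) gradient_norm_level[OF g(1,3) E])
qed

subsection \<open>The extremal functions\<close>

text \<open>In the level coordinate the extremal function is
  \<open>s * (b + a * s powr \<kappa>) powr (- (1 / \<kappa>))\<close>, with derivative
  \<open>g\<close>. The dilation by \<open>\<rho>\<close>, where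
  \<open>\<rho> powr \<kappa> = a / b\<close>, reduces it to the profile with known mass and energy.
  The absolute value in \<open>g\<close> makes it continuous on the whole line.\<close>

lemma extremal_level:
  assumes ab: "0 < a" "0 < b"
  defines "g \<equiv> \<lambda>s. b * (b + a * \<bar>s\<bar> powr \<kappa>) powr (- (n / p))"
    and "\<rho> \<equiv> (a / b) powr (1 / \<kappa>)"
  shows "g \<in> borel_measurable borel"
    and "moment p half_line g = ennreal (b powr (p - n) * (1 / \<rho>) * (n / \<alpha> * total_mass))"
    and "level_integral (primitive g) = ennreal (b powr (- n) * \<rho> powr (- \<kappa>) * (1 / \<rho>) * total_mass)"
    and "AE x in lebesgue_on B. extremal n p R a b x = primitive g (level x)"
proof -
  show [measurable]: "g \<in> borel_measurable borel"
    unfolding g_def by measurable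
  have \<rho>: "0 < \<rho>" "\<rho> powr \<kappa> = a / b"
    using ab kappa_pos by (auto simp: \<rho>_def powr_powr)
  have base: "b + a * s powr \<kappa> = b * (1 + (\<rho> * s) powr \<kappa>)" if "0 \<le> s" for s
    using that ab \<rho> by (simp add: powr_mult field_simps)
  have bpos: "0 < b + a * s powr \<kappa>" for s
    using ab by (simp add: add_pos_nonneg)
  have e1: "1 / \<kappa> = n / p - 1" and e2: "q * (1 / \<kappa>) = n"
    using p_gt_1 p_less_n q_eq by (auto simp: \<kappa>_def field_simps)
  define f where "f s = s * (b + a * \<bar>s\<bar> powr \<kappa>) powr (- (1 / \<kappa>))" for s
  have f_deriv: "(f has_real_derivative g s) (at s)" if s: "0 < s" for s
  proof -
    define W where "W = b + a * s powr \<kappa>"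
    have W: "0 < W" using bpos by (simp add: W_def)
    have d: "((\<lambda>s. s * (b + a * s powr \<kappa>) powr (- (1 / \<kappa>))) has_real_derivative
       1 * W powr (- (1 / \<kappa>)) + (- (1 / \<kappa>)) * W powr (- (1 / \<kappa>) - of_nat 1) * (0 + a * (\<kappa> * s powr (\<kappa> - 1))) * s) (at s)"
      unfolding W_def using s bpos
      by (intro DERIV_mult DERIV_ident DERIV_fun_powr DERIV_add DERIV_const DERIV_cmult has_real_derivative_powr) auto
    have "s powr (\<kappa> - 1) * s = s powr \<kappa>" using s powr_add[of s "\<kappa> - 1" 1] by simp
    then have eq1: "1 * W powr (- (1 / \<kappa>)) + (- (1 / \<kappa>)) * W powr (- (1 / \<kappa>) - of_nat 1) * (0 + a * (\<kappa> * s powr (\<kappa> - 1))) * s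
        = W powr (- (1 / \<kappa>)) - W powr (- (1 / \<kappa>) - 1) * (a * s powr \<kappa>)"
      using kappa_pos by (simp add: mult.assoc)
    have w1: "- (1 / \<kappa>) - 1 = - (n / p)" using e1 by simp
    have w2: "W powr (- (1 / \<kappa>)) = W powr (- (n / p)) * W"
      using W powr_add[of W "- (n / p)" 1] e1 by simp
    have "W powr (- (n / p)) * W - W powr (- (n / p)) * (a * s powr \<kappa>) = W powr (- (n / p)) * b"
      by (simp add: W_def algebra_simps)
    also have "\<dots> = g s" using s by (simp add: g_def W_def)
    finally have eq2: "W powr (- (1 / \<kappa>)) - W powr (- (1 / \<kappa>) - 1) * (a * s powr \<kappa>) = g s"
      by (simp only: w1 w2)
    from d have "((\<lambda>s. s * (b + a * s powr \<kappa>) powr (- (1 / \<kappa>))) has_real_derivative g s) (at s)"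
      unfolding eq1 eq2 .
    then show ?thesis
      by (rule has_field_derivative_transform_within_open[of _ _ _ "{0<..}"])
         (use s in \<open>auto simp: f_def\<close>)
  qed
  have abs_cont: "continuous_on S (\<lambda>s. \<bar>s\<bar> powr \<kappa>)" for S :: "real set"
    using kappa_pos by (intro continuous_on_powr') (auto intro!: continuous_intros)
  have "b + a * \<bar>s\<bar> powr \<kappa> \<noteq> 0" for s
    using ab by (simp add: add_pos_nonneg less_imp_neq[symmetric])
  then have f_cont: "continuous_on S f" and g_cont: "continuous_on S g" for S
    unfolding f_def[abs_def] g_def
    by (intro continuous_on_mult continuous_on_id continuous_on_const continuous_on_add abs_cont
        continuous_on_powr[OF continuous_on_add[OF continuous_on_const continuous_on_mult[OF continuous_on_const abs_cont]] continuous_on_const]; simp)+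
  have prim: "primitive g s = f s" if s: "0 < s" for s
  proof -
    have int: "set_integrable lborel {0..s} g"
      by (intro borel_integrable_atLeastAtMost' g_cont)
    have "(g has_integral (f s - f 0)) {0..s}"
      using s f_deriv f_cont
      by (intro fundamental_theorem_of_calculus_interior)
         (auto simp: has_real_derivative_iff_has_vector_derivative[symmetric])
    then have "(LINT t:{0..s}|lborel. g t) = f s"
      using set_borel_integral_eq_integral(2)[OF int] by (simp add: integral_unique f_def)
    moreover have "(LINT t:{0..s}|lborel. g t) = primitive g s"
      unfolding primitive_def set_lebesgue_integral_def
    proof (rule integral_cong_AE)
      show "AE t in lborel. indicator {0..s} t *\<^sub>R g t = indicator {0<..s} t *\<^sub>R g t"
        using AE_lborel_singleton[of 0] by eventually_elim (auto simp: indicator_def)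
    qed measurable
    ultimately show ?thesis by simp
  qed
  show "moment p half_line g = ennreal (b powr (p - n) * (1 / \<rho>) * (n / \<alpha> * total_mass))"
  proof -
    have "moment p half_line g = (\<integral>\<^sup>+s. ennreal (b powr (p - n)) * ennreal ((1 + (\<rho> * s) powr \<kappa>) powr (- n)) \<partial>half_line)"
      unfolding moment_def
    proof (rule nn_integral_cong)
      fix s assume "s \<in> space half_line"
      then have s: "0 < s" by simp
      have "norm (g s) powr p = b powr p * (b + a * s powr \<kappa>) powr (- n)"
        using s ab p_gt_1 by (simp add: g_def abs_mult powr_mult powr_powr)
      also have "\<dots> = b powr p * b powr (- n) * (1 + (\<rho> * s) powr \<kappa>) powr (- n)"
        using s ab one_plus_powr_pos[of "\<rho> * s" \<kappa>] by (simp add: base powr_mult less_imp_le)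
      also have "b powr p * b powr (- n) = b powr (p - n)"
        by (simp add: powr_add[symmetric])
      finally show "ennreal (norm (g s) powr p) = ennreal (b powr (p - n)) * ennreal ((1 + (\<rho> * s) powr \<kappa>) powr (- n))"
        by (simp add: ennreal_mult)
    qed
    also have "\<dots> = ennreal (b powr (p - n)) * (\<integral>\<^sup>+s. ennreal ((1 + (\<rho> * s) powr \<kappa>) powr (- n)) \<partial>half_line)"
      by (intro nn_integral_cmult half_line_borel) measurable
    also have "(\<integral>\<^sup>+s. ennreal ((1 + (\<rho> * s) powr \<kappa>) powr (- n)) \<partial>half_line)
        = ennreal (1 / \<rho>) * (\<integral>\<^sup>+s. ennreal ((1 + s powr \<kappa>) powr (- n)) \<partial>half_line)"
      by (rule nn_integral_half_line_scale[OF _ \<rho>(1)]) measurable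
    also have "(\<integral>\<^sup>+s. ennreal ((1 + s powr \<kappa>) powr (- n)) \<partial>half_line) = ennreal (n / \<alpha> * total_mass)"
      unfolding nn_integral_half_line by (rule nn_integral_energy)
    finally show ?thesis
      using \<rho>(1) n_pos alpha_pos total_mass_pos by (simp add: ennreal_mult[symmetric] mult.assoc)
  qed
  show "level_integral (primitive g) = ennreal (b powr (- n) * \<rho> powr (- \<kappa>) * (1 / \<rho>) * total_mass)"
  proof -
    have "level_integral (primitive g) = (\<integral>\<^sup>+s. ennreal (b powr (- n) * \<rho> powr (- \<kappa>)) * ennreal (mass (\<rho> * s)) \<partial>half_line)"
      unfolding level_integral_def
    proof (rule nn_integral_cong)
      fix s assume "s \<in> space half_line"
      then have s: "0 < s" by simp
      have "\<bar>primitive g s\<bar> powr q = s powr q * (b + a * s powr \<kappa>) powr (- n)"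
      proof -
        have "(- (1 / \<kappa>)) * q = - n" using e2 by (simp add: mult.commute)
        then show ?thesis
          using s by (simp add: prim f_def abs_mult powr_mult powr_powr)
      qed
      then have "\<bar>primitive g s\<bar> powr q * s powr (- \<gamma>) = (s powr q * s powr (- \<gamma>)) * (b + a * s powr \<kappa>) powr (- n)"
        by simp
      also have "s powr q * s powr (- \<gamma>) = s powr \<kappa>"
        by (simp add: powr_add[symmetric] q_eq_add)
      also have "(b + a * s powr \<kappa>) powr (- n) = b powr (- n) * (1 + (\<rho> * s) powr \<kappa>) powr (- n)"
        using s ab one_plus_powr_pos[of "\<rho> * s" \<kappa>] by (simp add: base powr_mult less_imp_le)
      also have "s powr \<kappa> = \<rho> powr (- \<kappa>) * (\<rho> * s) powr \<kappa>"
        using \<rho>(1) s by (simp add: powr_mult powr_minus)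
      finally have "\<bar>primitive g s\<bar> powr q * s powr (- \<gamma>) = b powr (- n) * \<rho> powr (- \<kappa>) * mass (\<rho> * s)"
        by (simp add: mass_def mult_ac)
      then show "ennreal (\<bar>primitive g s\<bar> powr q * s powr (- \<gamma>)) = ennreal (b powr (- n) * \<rho> powr (- \<kappa>)) * ennreal (mass (\<rho> * s))"
        by (simp add: ennreal_mult[symmetric] mass_nonneg)
    qed
    also have "\<dots> = ennreal (b powr (- n) * \<rho> powr (- \<kappa>)) * (\<integral>\<^sup>+s. ennreal (mass (\<rho> * s)) \<partial>half_line)"
      by (intro nn_integral_cmult half_line_borel) measurable
    also have "(\<integral>\<^sup>+s. ennreal (mass (\<rho> * s)) \<partial>half_line) = ennreal (1 / \<rho>) * (\<integral>\<^sup>+s. ennreal (mass s) \<partial>half_line)"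
      by (rule nn_integral_half_line_scale[OF _ \<rho>(1)]) measurable
    also have "(\<integral>\<^sup>+s. ennreal (mass s) \<partial>half_line) = ennreal total_mass"
      unfolding nn_integral_half_line by (rule nn_integral_mass)
    finally show ?thesis
      using \<rho>(1) total_mass_pos by (simp add: ennreal_mult[symmetric] mult.assoc)
  qed
  show "AE x in lebesgue_on B. extremal n p R a b x = primitive g (level x)"
    unfolding AE_lebesgue_on_B using AE_lborel_singleton[of "0::real^'n"]
  proof eventually_elim
    case (elim x)
    show ?case
    proof
      assume x: "x \<in> B"
      define s where "s = level x"
      have s: "0 < s" using level_pos[OF x] elim by (simp add: s_def)
      have ne: "1 - n / p = - (1 / \<kappa>)" using e1 by simp
      have "1 / norm x powr ((n - p) / (p - 1)) - 1 / R powr ((n - p) / (p - 1)) = s"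
        by (simp add: s_def level_def c_def powr_minus_divide \<alpha>_def)
      then have "extremal n p R a b x = (a + b * s powr (- \<kappa>)) powr (- (1 / \<kappa>))"
        unfolding extremal_def ne[symmetric] by (simp add: \<kappa>_def)
      also have "a + b * s powr (- \<kappa>) = s powr (- \<kappa>) * (b + a * s powr \<kappa>)"
        using s by (simp add: powr_minus field_simps)
      also have "(s powr (- \<kappa>) * (b + a * s powr \<kappa>)) powr (- (1 / \<kappa>)) = f s"
        using s kappa_pos bpos[of s] by (simp add: powr_mult powr_powr less_imp_le f_def)
      finally show "extremal n p R a b x = primitive g (level x)"
        using prim[OF s] by (simp add: s_def)
    qed
  qed
qed

end

context radial_ball
begin

lemma extremal_sobolev:
  assumes ab: "0 < a" "0 < b"
  shows "extremal n p R a b \<in> radial_sobolev_space0 p B"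
    and "weighted_const n p * weighted_norm n p q R (extremal n p R a b :: real^'n \<Rightarrow> real)
      = Lp_norm p B (weak_gradient B (extremal n p R a b))"
    and "0 < weighted_norm n p q R (extremal n p R a b :: real^'n \<Rightarrow> real)"
proof -
  define g where "g s = b * (b + a * \<bar>s\<bar> powr \<kappa>) powr (- (n / p))" for s
  define \<rho> where "\<rho> = (a / b) powr (1 / \<kappa>)"
  define E where "E = b powr (p - n) * (1 / \<rho>) * (n / \<alpha> * total_mass)"
  define A where "A = b powr (- n) * \<rho> powr (- \<kappa>) * (1 / \<rho>) * total_mass"
  note ex = extremal_level[OF ab, folded g_def \<rho>_def, folded E_def A_def]
  have \<rho>: "0 < \<rho>" using ab by (simp add: \<rho>_def)
  have E: "0 \<le> E" using ab \<rho> n_pos alpha_pos total_mass_pos by (simp add: E_def)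
  have A: "0 < A" using ab \<rho> total_mass_pos by (simp add: A_def)
  have fin: "moment p half_line g < \<infinity>" by (simp add: ex(2))
  show "extremal n p R a b \<in> radial_sobolev_space0 p B"
    by (rule primitive_level_sobolev(1)[OF ex(1) fin ex(4)])
  have norm: "weighted_norm n p q R (extremal n p R a b :: real^'n \<Rightarrow> real) = (mass_const * A) powr (1 / q)"
    by (rule weighted_norm_level(2)[OF primitive_borel[OF ex(1)] ex(4) ex(3) less_imp_le[OF A]])
  show "0 < weighted_norm n p q R (extremal n p R a b :: real^'n \<Rightarrow> real)"
    unfolding norm using A mass_const_pos by simp
  \<comment> \<open>By these identities the mass \<open>A\<close> equals Bliss' upper bound for the
    energy \<open>E\<close>, for all \<open>a\<close> and \<open>b\<close>.\<close>
  have e: "(p - n) * (q / p) = - n" "q / p = \<kappa> + 1"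
    using p_gt_1 p_less_n by (auto simp: q_def \<kappa>_def field_simps)
  have "\<alpha> / n * E / total_mass = b powr (p - n) * (1 / \<rho>)"
    using n_pos alpha_pos total_mass_pos by (simp add: E_def)
  then have "(\<alpha> / n * E / total_mass) powr (q / p) = (b powr (p - n)) powr (q / p) * (1 / \<rho>) powr (q / p)"
    by (simp only: powr_mult)
  also have "(b powr (p - n)) powr (q / p) = b powr (- n)"
    by (simp only: powr_powr e(1))
  also have "(1 / \<rho>) powr (q / p) = \<rho> powr (- \<kappa>) * (1 / \<rho>)"
    using \<rho> unfolding e(2) by (simp add: powr_divide powr_add powr_minus_divide)
  finally have "total_mass * (\<alpha> / n * E / total_mass) powr (q / p) = A"
    by (simp add: A_def mult_ac)
  then show "weighted_const n p * weighted_norm n p q R (extremal n p R a b :: real^'n \<Rightarrow> real)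
      = Lp_norm p B (weak_gradient B (extremal n p R a b))"
    using weighted_const_scaled[OF E] gradient_norm_level[OF ex(1,4,2) E] by (simp add: norm)
qed

subsection \<open>Scaling\<close>

lemma scaled_point_eq:
  assumes "0 < \<mu>" and x: "x \<noteq> 0"
  shows "scaled_point n p R \<mu> x = radius (\<mu> * level x) *\<^sub>R direction x"
proof -
  have "\<mu> * norm x powr (- \<alpha>) + (1 - \<mu>) * R powr (- \<alpha>) = \<mu> * level x + c"
    by (simp add: level_def c_def algebra_simps)
  moreover have "(p - 1) / (n - p) = 1 / \<alpha>" by (simp add: \<alpha>_def)
  ultimately show ?thesis
    by (simp add: scaled_point_def radius_def direction_def \<alpha>_def[symmetric])
qed

text \<open>A Sobolev function is known only up to null sets, so composing it with
  \<open>scaled_point\<close> requires preimages of null sets to be null. In polar coordinates the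
  map keeps the direction and dilates the level, which preserves null sets on each ray.\<close>

lemma AE_scaled_point:
  assumes P: "AE x in lborel. x \<in> B \<longrightarrow> P x" and \<mu>: "0 < \<mu>"
  shows "AE x in lborel. x \<in> B \<longrightarrow> P (scaled_point n p R \<mu> x)"
proof -
  obtain N where N: "{x. \<not> (x \<in> B \<longrightarrow> P x)} \<subseteq> N" "emeasure lborel N = 0" "N \<in> sets borel"
    using P by (auto elim!: AE_E)
  note [measurable] = N(3)
  define T where "T x = radius (\<mu> * level x) *\<^sub>R direction x" for x :: "real^'n"
  have [measurable]: "T \<in> borel_measurable borel" unfolding T_def[abs_def] by measurable
  have "N \<in> null_sets lborel"
    using N by auto
  from AE_not_in[OF this] have "AE x in lborel. x \<in> B \<longrightarrow> x \<notin> N"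
    by (rule eventually_mono) simp
  then have "AE \<theta> in sphere_measure. AE s in half_line. radius s *\<^sub>R \<theta> \<notin> N"
    by (rule AE_polar)
  then have inner: "AE \<theta> in sphere_measure.
      (\<integral>\<^sup>+s. ennreal (weight s) * indicator N (T (radius s *\<^sub>R \<theta>)) \<partial>half_line) = 0"
    using AE_sphere_measure_norm
  proof eventually_elim
    case (elim \<theta>)
    have "AE s in half_line. radius (\<mu> * s) *\<^sub>R \<theta> \<notin> N"
      by (rule AE_half_line_scale[OF elim(1) \<mu>])
    then have "AE s in half_line. ennreal (weight s) * indicator N (T (radius s *\<^sub>R \<theta>)) = 0"
      using AE_space[of half_line]
    proof eventually_elim
      case (elim s)
      have "direction (radius s *\<^sub>R \<theta>) = \<theta>"
        using elim(2) radius_pos[of s] \<open>norm \<theta> = 1\<close> by (simp add: direction_def)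
      with elim show ?case
        using \<open>norm \<theta> = 1\<close> by (simp add: T_def level_radius)
    qed
    then have "(\<integral>\<^sup>+s. ennreal (weight s) * indicator N (T (radius s *\<^sub>R \<theta>)) \<partial>half_line) = (\<integral>\<^sup>+s. 0 \<partial>half_line)"
      by (rule nn_integral_cong_AE)
    then show ?case by simp
  qed
  have "(\<integral>\<^sup>+x\<in>B. indicator N (T x) \<partial>lborel)
      = (\<integral>\<^sup>+\<theta>. \<integral>\<^sup>+s. ennreal (weight s) * indicator N (T (radius s *\<^sub>R \<theta>)) \<partial>half_line \<partial>sphere_measure)"
    by (rule polar_nn_integral) measurable
  also have "\<dots> = (\<integral>\<^sup>+\<theta>. 0 \<partial>(sphere_measure :: (real^'n) measure))"
    by (rule nn_integral_cong_AE[OF inner])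
  finally have "(\<integral>\<^sup>+x\<in>B. indicator N (T x) \<partial>lborel) = 0" by simp
  then have "AE x in lborel. indicator N (T x) * indicator B x = (0::ennreal)"
    by (subst (asm) nn_integral_0_iff_AE) auto
  with AE_lborel_singleton[of "0::real^'n"] show ?thesis
  proof eventually_elim
    case (elim x)
    show ?case
    proof
      assume x: "x \<in> B"
      then have "T x \<notin> N" using elim by (auto simp: indicator_def split: if_splits)
      moreover have "T x \<in> B"
        using radius_less_R[of "\<mu> * level x"] radius_pos[of "\<mu> * level x"] level_pos[OF x] elim \<mu>
        by (simp add: T_def B_eq norm_direction)
      ultimately show "P (scaled_point n p R \<mu> x)"
        using N(1) scaled_point_eq[OF \<mu>, of x] elim by (auto simp: T_def)
    qed
  qed
qed

lemma level_scaled_point: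
  assumes "0 < \<mu>" "x \<in> B" "x \<noteq> 0"
  shows "level (scaled_point n p R \<mu> x) = \<mu> * level x"
  using assms level_pos[of x] by (simp add: scaled_point_eq level_radius norm_direction)

text \<open>The profile becomes \<open>\<mu> powr (1 / p) * g (\<mu> * s)\<close>, whose p-th moment
  is that of \<open>g\<close>. Its primitive carries the factor \<open>\<mu> powr k\<close>, and
  \<open>k * q + \<gamma> = 1\<close> is cancelled by the \<open>1 / \<mu>\<close> from dilating the
  integral.\<close>

lemma scaled_sobolev:
  assumes u: "u \<in> radial_sobolev_space0 p B" and \<mu>: "0 < \<mu>"
  shows "scaled n p R \<mu> u \<in> radial_sobolev_space0 p B"
    and "weighted_norm n p q R (scaled n p R \<mu> u) = weighted_norm n p q R u"
    and "Lp_norm p B (weak_gradient B (scaled n p R \<mu> u)) = Lp_norm p B (weak_gradient B u)"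
proof -
  obtain g where g [measurable]: "g \<in> borel_measurable borel" and fin: "moment p half_line g < \<infinity>"
    and ug: "AE x in lebesgue_on B. u x = primitive g (level x)"
    by (rule radial_sobolev_imp_primitive[OF u]) blast
  obtain E where E: "moment p half_line g = ennreal E" "0 \<le> E"
    using fin by (cases "moment p half_line g") auto
  define h where "h s = \<mu> powr (1 / p) * g (\<mu> * s)" for s
  have h [measurable]: "h \<in> borel_measurable borel" unfolding h_def[abs_def] by measurable
  have "moment p half_line h = (\<integral>\<^sup>+s. ennreal \<mu> * ennreal (norm (g (\<mu> * s)) powr p) \<partial>half_line)"
    unfolding moment_def
    using \<mu> p_gt_1 by (intro nn_integral_cong) (simp add: h_def abs_mult powr_mult powr_powr ennreal_mult[symmetric])
  also have "\<dots> = ennreal \<mu> * (\<integral>\<^sup>+s. ennreal (norm (g (\<mu> * s)) powr p) \<partial>half_line)"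
    by (intro nn_integral_cmult half_line_borel) measurable
  also have "(\<integral>\<^sup>+s. ennreal (norm (g (\<mu> * s)) powr p) \<partial>half_line) = ennreal (1 / \<mu>) * moment p half_line g"
    unfolding moment_def by (rule nn_integral_half_line_scale[OF _ \<mu>]) measurable
  finally have h_moment: "moment p half_line h = ennreal E"
    using \<mu> E by (simp add: ennreal_mult[symmetric])
  have h_prim: "primitive h s = \<mu> powr (- ((p - 1) / p)) * primitive g (\<mu> * s)" for s
  proof -
    have "\<mu> powr (1 / p) / \<mu> = \<mu> powr (1 / p - 1)"
      using \<mu> powr_diff[of \<mu> "1 / p" 1] by simp
    also have "1 / p - 1 = - ((p - 1) / p)"
      using p_gt_1 by (simp add: field_simps)
    finally show ?thesis
      unfolding h_def[abs_def] primitive_scale[OF \<mu>] by simp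
  qed
  have su: "AE x in lebesgue_on B. scaled n p R \<mu> u x = primitive h (level x)"
    unfolding AE_lebesgue_on_B
    using AE_scaled_point[OF ug[unfolded AE_lebesgue_on_B] \<mu>] AE_lborel_singleton[of "0::real^'n"]
    by eventually_elim (auto simp: scaled_def level_scaled_point[OF \<mu>] h_prim)
  show "scaled n p R \<mu> u \<in> radial_sobolev_space0 p B"
    by (rule primitive_level_sobolev(1)[OF h _ su]) (simp add: h_moment)
  show "Lp_norm p B (weak_gradient B (scaled n p R \<mu> u)) = Lp_norm p B (weak_gradient B u)"
    by (simp only: gradient_norm_level[OF h su h_moment E(2)] gradient_norm_level[OF g ug E])
  have "level_integral (primitive g) \<le> ennreal (total_mass * (\<alpha> / n * E / total_mass) powr (q / p))"
    unfolding level_integral_def by (rule Bliss[OF g _ E(2)]) (simp add: E)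
  then have "level_integral (primitive g) < \<infinity>"
    by (rule le_less_trans) simp
  then obtain A where A: "level_integral (primitive g) = ennreal A" "0 \<le> A"
    by (cases "level_integral (primitive g)") auto
  define k where "k = - ((p - 1) / p)"
  have e: "k * q + \<gamma> = 1"
    unfolding k_def using p_gt_1 p_less_n by (simp add: q_def \<gamma>_def divide_simps) (simp add: algebra_simps)
  have "level_integral (primitive h)
      = (\<integral>\<^sup>+s. ennreal \<mu> * ennreal (\<bar>primitive g (\<mu> * s)\<bar> powr q * (\<mu> * s) powr (- \<gamma>)) \<partial>half_line)"
    unfolding level_integral_def
  proof (rule nn_integral_cong)
    fix s assume "s \<in> space half_line"
    then have s: "0 < s" by simp
    have a1: "\<bar>primitive h s\<bar> powr q = \<mu> powr (k * q) * \<bar>primitive g (\<mu> * s)\<bar> powr q"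
      unfolding h_prim[folded k_def] by (simp add: abs_mult powr_mult powr_powr)
    have a2: "s powr (- \<gamma>) = \<mu> powr \<gamma> * (\<mu> * s) powr (- \<gamma>)"
      using \<mu> s by (simp add: powr_mult powr_minus)
    have a3: "\<mu> powr (k * q) * \<mu> powr \<gamma> = \<mu>"
      using \<mu> by (simp only: powr_add[symmetric] e) simp
    have "\<bar>primitive h s\<bar> powr q * s powr (- \<gamma>)
        = (\<mu> powr (k * q) * \<mu> powr \<gamma>) * (\<bar>primitive g (\<mu> * s)\<bar> powr q * (\<mu> * s) powr (- \<gamma>))"
      unfolding a1 a2 by (simp only: mult_ac)
    then show "ennreal (\<bar>primitive h s\<bar> powr q * s powr (- \<gamma>))
        = ennreal \<mu> * ennreal (\<bar>primitive g (\<mu> * s)\<bar> powr q * (\<mu> * s) powr (- \<gamma>))"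
      using \<mu> by (simp add: a3 ennreal_mult)
  qed
  also have "\<dots> = ennreal \<mu> * (\<integral>\<^sup>+s. ennreal (\<bar>primitive g (\<mu> * s)\<bar> powr q * (\<mu> * s) powr (- \<gamma>)) \<partial>half_line)"
    by (intro nn_integral_cmult half_line_borel) measurable
  also have "(\<integral>\<^sup>+s. ennreal (\<bar>primitive g (\<mu> * s)\<bar> powr q * (\<mu> * s) powr (- \<gamma>)) \<partial>half_line)
      = ennreal (1 / \<mu>) * level_integral (primitive g)"
    unfolding level_integral_def by (rule nn_integral_half_line_scale[OF _ \<mu>]) measurable
  finally have "level_integral (primitive h) = ennreal A"
    using \<mu> A by (simp add: ennreal_mult[symmetric])
  then show "weighted_norm n p q R (scaled n p R \<mu> u) = weighted_norm n p q R u"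
    by (simp only: weighted_norm_level(2)[OF primitive_borel[OF h] su _ A(2)]
        weighted_norm_level(2)[OF primitive_borel[OF g] ug A])
qed

end

theorem theorem1p1:
  fixes n p ps R :: real and B :: "(real^'n) set"
  assumes "n = real CARD('n)" and "2 \<le> n" and "1 < p" and "p < n"
    and "1 / ps = 1 / p - 1 / n" and "0 < R" and "B = ball 0 R"
  shows
    "(\<forall>u \<in> radial_sobolev_space0 p B.
        integrable (lebesgue_on B) (weighted_integrand n p ps R u) \<and>
        weighted_const n p * weighted_norm n p ps R u \<le> Lp_norm p B (weak_gradient B u))
     \<and>
     (\<forall>C. (\<forall>u \<in> radial_sobolev_space0 p B.
              C * weighted_norm n p ps R u \<le> Lp_norm p B (weak_gradient B u))
            \<longrightarrow> C \<le> weighted_const n p)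
     \<and>
     (\<forall>a>0. \<forall>b>0.
        extremal n p R a b \<in> radial_sobolev_space0 p B \<and>
        weighted_const n p * weighted_norm n p ps R (extremal n p R a b :: real^'n \<Rightarrow> real) =
          Lp_norm p B (weak_gradient B (extremal n p R a b)))
     \<and>
     (\<forall>u \<in> radial_sobolev_space0 p B. \<forall>\<mu>>0.
        scaled n p R \<mu> u \<in> radial_sobolev_space0 p B \<and>
        weighted_const n p * weighted_norm n p ps R (scaled n p R \<mu> u) =
          weighted_const n p * weighted_norm n p ps R u \<and>
        Lp_norm p B (weak_gradient B (scaled n p R \<mu> u)) = Lp_norm p B (weak_gradient B u))"
proof -
  interpret radial_ball n p R B
    by unfold_locales (use assms in auto)
  have "1 / ps = 1 / q"
    using assms(3-5) by (simp add: q_def field_simps)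
  then have ps: "ps = q" by simp
  have best: "C \<le> weighted_const n p"
    if C: "\<forall>u \<in> radial_sobolev_space0 p B. C * weighted_norm n p q R u \<le> Lp_norm p B (weak_gradient B u)" for C
  proof -
    \<comment> \<open>Equality holds for this function and its weighted norm is positive, so the
      norm can be cancelled.\<close>
    let ?U = "extremal n p R 1 1 :: real^'n \<Rightarrow> real"
    have "C * weighted_norm n p q R ?U \<le> weighted_const n p * weighted_norm n p q R ?U"
      using C extremal_sobolev(1,2)[of 1 1] by simp
    then show ?thesis
      using extremal_sobolev(3)[of 1 1] by simp
  qed
  show ?thesis
    unfolding ps
    by (intro conjI ballI allI impI weighted_inequality best extremal_sobolev(1,2)
        scaled_sobolev arg_cong[where f = "(*) (weighted_const n p)"])
      (assumption | (erule bspec, assumption))+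
qed

end
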